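(* For every integer $N$ there exists a compact $3$-dimensional Riemannian manifold $M^3$ (connected, oriented, without boundary) with first Betti number $b_1(M^3)\geq N$ that admits a minimal Wintgen ideal isometric immersion into the unit sphere $\mathbb{S}^6$.
   Context: An isometric immersion of an $n$-dimensional Riemannian manifold $M^n$ into a space form of constant curvature $c$ is Wintgen ideal if $\rho=c+H^2-\rho^\perp$ holds at every point. Here $\rho=\frac{1}{n(n-1)}\mathrm{tr}\,\mathrm{Ric}$ is the normalized scalar curvature of $M^n$, $H$ is the length of the mean curvature vector field $\frac1n\mathrm{tr}\,\alpha$ ($\alpha$ the second fundamental form), and $\rho^\perp=\frac{1}{n(n-1)}\|R^\perp\|$, where $R^\perp$ is the normal curvature tensor and $\|R^\perp\|^2=\sum_{i,j}\sum_{a,b}\langle R^\perp(e_i,e_j)\xi_a,\xi_b\rangle^2$ for orthonormal bases $\{e_i\}$ of the tangent space and $\{\xi_a\}$ of the normal space. In the claim $n=3$ and $c=1$; the immersion is minimal if $H=0$ everywhere. *)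

theory Defs
  imports "HOL-Analysis.Analysis" "HOL-Homology.Homology" "HOL-Library.Extended_Nat"
begin

section \<open>Smooth maps on open subsets of Euclidean spaces\<close>

primrec Ck_on :: "nat \<Rightarrow> 'a::euclidean_space set \<Rightarrow> ('a \<Rightarrow> 'b::euclidean_space) \<Rightarrow> bool" where
  "Ck_on 0 S f \<longleftrightarrow> continuous_on S f"
| "Ck_on (Suc k) S f \<longleftrightarrow>
     (\<forall>x\<in>S. f differentiable (at x)) \<and> (\<forall>v. Ck_on k S (\<lambda>x. frechet_derivative f (at x) v))"

text \<open>Only meaningful for open \<open>S\<close>: the derivatives are taken in the whole space.\<close>

definition smooth_on :: "'a::euclidean_space set \<Rightarrow> ('a \<Rightarrow> 'b::euclidean_space) \<Rightarrow> bool" where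
  "smooth_on S f \<longleftrightarrow> (\<forall>k. Ck_on k S f)"

definition partial :: "'n::finite \<Rightarrow> (real^'n \<Rightarrow> 'b::euclidean_space) \<Rightarrow> real^'n \<Rightarrow> 'b" where
  "partial i f u = frechet_derivative f (at u) (axis i 1)"


section \<open>Smooth and Riemannian manifolds\<close>

text \<open>
  The smooth structure is given by local parametrizations (inverses of charts): a pair
  \<open>(V, x)\<close> stands for the map \<open>x\<close> restricted to \<open>V\<close>. The values of \<open>x\<close> off \<open>V\<close> play no role.
  The manifold is an abstract topology on points of type \<open>'a\<close>; this topology need not be related
  to any topology that the type \<open>'a\<close> may carry. A second countable Hausdorff manifold has at most
  continuum many points, so any type with continuum many elements, such as \<open>real^7\<close>, carries a
  copy of every such manifold.
\<close>

type_synonym ('a, 'n) param = "(real^'n) set \<times> (real^'n \<Rightarrow> 'a)"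

definition trans_dom :: "('a, 'n::finite) param \<Rightarrow> ('a, 'n) param \<Rightarrow> (real^'n) set" where
  "trans_dom = (\<lambda>(V, x) (W, y). {u \<in> V. x u \<in> y ` W})"

definition trans_map :: "('a, 'n::finite) param \<Rightarrow> ('a, 'n) param \<Rightarrow> real^'n \<Rightarrow> real^'n" where
  "trans_map = (\<lambda>(V, x) (W, y) u. inv_into W y (x u))"

definition smooth_manifold :: "'a topology \<Rightarrow> ('a, 'n::finite) param set \<Rightarrow> bool" where
  "smooth_manifold M A \<longleftrightarrow>
     topspace M \<noteq> {} \<and> Hausdorff_space M \<and> second_countable M \<and>
     (\<forall>(V, x)\<in>A. open V \<and> openin M (x ` V) \<and>
        homeomorphic_map (top_of_set V) (subtopology M (x ` V)) x) \<and>
     (\<Union>(V, x)\<in>A. x ` V) = topspace M \<and>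
     (\<forall>p\<in>A. \<forall>q\<in>A. smooth_on (trans_dom p q) (trans_map p q))"

definition oriented_atlas :: "('a, 'n::finite) param set \<Rightarrow> bool" where
  "oriented_atlas A \<longleftrightarrow>
     (\<forall>p\<in>A. \<forall>q\<in>A. \<forall>u\<in>trans_dom p q. det (jacobian (trans_map p q) (at u)) > 0)"

text \<open>
  A Riemannian metric is given by its matrices \<open>g p u = (g\<^sub>i\<^sub>j(u))\<close> in all parametrizations
  \<open>p\<close> of the atlas, subject to the transformation law of a covariant 2-tensor.
\<close>

definition riemannian_metric ::
    "('a, 'n::finite) param set \<Rightarrow> (('a, 'n) param \<Rightarrow> real^'n \<Rightarrow> real^'n^'n) \<Rightarrow> bool" where
  "riemannian_metric A g \<longleftrightarrow>
     (\<forall>p\<in>A. smooth_on (fst p) (g p) \<and>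
        (\<forall>u\<in>fst p. transpose (g p u) = g p u \<and> (\<forall>v. v \<noteq> 0 \<longrightarrow> v \<bullet> (g p u *v v) > 0))) \<and>
     (\<forall>p\<in>A. \<forall>q\<in>A. \<forall>u\<in>trans_dom p q.
        let J = jacobian (trans_map p q) (at u)
        in g p u = transpose J ** g q (trans_map p q u) ** J)"

definition riemannian_manifold ::
    "'a topology \<Rightarrow> ('a, 'n::finite) param set \<Rightarrow> (('a, 'n) param \<Rightarrow> real^'n \<Rightarrow> real^'n^'n) \<Rightarrow> bool"
  where
  "riemannian_manifold M A g \<longleftrightarrow> smooth_manifold M A \<and> riemannian_metric A g"


section \<open>Scalar curvature\<close>

text \<open>
  Here \<open>G\<close> is the metric matrix in a fixed parametrization. Conventions:
  \<open>\<nabla>\<^sub>i \<partial>\<^sub>j = \<Sum>\<^sub>k christoffel G k i j \<partial>\<^sub>k\<close>, \<open>R(X,Y) = \<nabla>\<^sub>X\<nabla>\<^sub>Y - \<nabla>\<^sub>Y\<nabla>\<^sub>X - \<nabla>\<^bsub>[X,Y]\<^esub>\<close>,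
  \<open>R(\<partial>\<^sub>i,\<partial>\<^sub>j)\<partial>\<^sub>k = \<Sum>\<^sub>l riemann G l i j k \<partial>\<^sub>l\<close>, \<open>Ric(Y,Z) = tr (X \<mapsto> R(X,Y)Z)\<close>. With these
  signs the unit sphere has positive Ricci curvature.
\<close>

definition christoffel :: "(real^'n \<Rightarrow> real^'n^'n) \<Rightarrow> 'n::finite \<Rightarrow> 'n \<Rightarrow> 'n \<Rightarrow> real^'n \<Rightarrow> real" where
  "christoffel G k i j u = (1/2) * (\<Sum>l\<in>UNIV. matrix_inv (G u) $ k $ l *
     (partial i (\<lambda>w. G w $ j $ l) u + partial j (\<lambda>w. G w $ i $ l) u
      - partial l (\<lambda>w. G w $ i $ j) u))"

definition riemann ::
    "(real^'n \<Rightarrow> real^'n^'n) \<Rightarrow> 'n::finite \<Rightarrow> 'n \<Rightarrow> 'n \<Rightarrow> 'n \<Rightarrow> real^'n \<Rightarrow> real" where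
  "riemann G l i j k u =
     partial i (christoffel G l j k) u - partial j (christoffel G l i k) u
     + (\<Sum>m\<in>UNIV. christoffel G m j k u * christoffel G l i m u
                 - christoffel G m i k u * christoffel G l j m u)"

definition ricci :: "(real^'n \<Rightarrow> real^'n^'n) \<Rightarrow> 'n::finite \<Rightarrow> 'n \<Rightarrow> real^'n \<Rightarrow> real" where
  "ricci G j k u = (\<Sum>i\<in>UNIV. riemann G i i j k u)"

definition normalized_scalar_curvature :: "(real^'n \<Rightarrow> real^'n^'n) \<Rightarrow> real^'n::finite \<Rightarrow> real" where
  "normalized_scalar_curvature G u =
     (\<Sum>j\<in>UNIV. \<Sum>k\<in>UNIV. matrix_inv (G u) $ j $ k * ricci G j k u)
       / (real CARD('n) * (real CARD('n) - 1))"


section \<open>Extrinsic geometry of immersions into the unit sphere\<close>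

text \<open>
  \<open>F\<close> is an immersion, written in a parametrization, into the unit sphere \<open>sphere 0 1\<close> of
  \<open>real^'m\<close>. Vectors \<open>v :: real^'n\<close> are coordinate vectors of tangent vectors, and extend to
  the constant (hence commuting) vector fields in these coordinates.
\<close>

definition orth_proj :: "'b::euclidean_space set \<Rightarrow> 'b \<Rightarrow> 'b" where
  "orth_proj S v = (THE w. w \<in> S \<and> (\<forall>s\<in>S. orthogonal (v - w) s))"

text \<open>The normal space inside the tangent space \<open>{\<xi>. orthogonal \<xi> (F u)}\<close> of the sphere.\<close>

definition normal_space :: "(real^'n \<Rightarrow> real^'m) \<Rightarrow> real^'n::finite \<Rightarrow> (real^'m::finite) set" where
  "normal_space F u =
     {\<xi>. orthogonal \<xi> (F u) \<and> (\<forall>v. orthogonal \<xi> (frechet_derivative F (at u) v))}"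

text \<open>The Levi-Civita connection of the sphere along \<open>F\<close>, for fields \<open>Z\<close> along \<open>F\<close>.\<close>

definition sphere_conn ::
    "(real^'n \<Rightarrow> real^'m) \<Rightarrow> real^'n::finite \<Rightarrow> (real^'n \<Rightarrow> real^'m::finite) \<Rightarrow> real^'n \<Rightarrow> real^'m" where
  "sphere_conn F v Z u = orth_proj {w. orthogonal w (F u)} (frechet_derivative Z (at u) v)"

definition second_fundamental_form ::
    "(real^'n \<Rightarrow> real^'m) \<Rightarrow> real^'n::finite \<Rightarrow> real^'n \<Rightarrow> real^'n \<Rightarrow> real^'m::finite" where
  "second_fundamental_form F u v w =
     orth_proj (normal_space F u) (sphere_conn F v (\<lambda>y. frechet_derivative F (at y) w) u)"

definition mean_curvature_vector ::
    "(real^'n \<Rightarrow> real^'n^'n) \<Rightarrow> (real^'n \<Rightarrow> real^'m) \<Rightarrow> real^'n::finite \<Rightarrow> real^'m::finite" where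
  "mean_curvature_vector G F u = (1 / real CARD('n)) *\<^sub>R
     (\<Sum>i\<in>UNIV. \<Sum>j\<in>UNIV. matrix_inv (G u) $ i $ j *\<^sub>R
        second_fundamental_form F u (axis i 1) (axis j 1))"

definition mean_curvature ::
    "(real^'n \<Rightarrow> real^'n^'n) \<Rightarrow> (real^'n \<Rightarrow> real^'m::finite) \<Rightarrow> real^'n::finite \<Rightarrow> real" where
  "mean_curvature G F u = norm (mean_curvature_vector G F u)"

definition normal_conn ::
    "(real^'n \<Rightarrow> real^'m) \<Rightarrow> real^'n::finite \<Rightarrow> (real^'n \<Rightarrow> real^'m::finite) \<Rightarrow> real^'n \<Rightarrow> real^'m" where
  "normal_conn F v \<xi> u = orth_proj (normal_space F u) (sphere_conn F v \<xi> u)"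

text \<open>
  \<open>R\<^sup>\<bottom>(v,w)\<xi> = \<nabla>\<^sup>\<bottom>\<^sub>v\<nabla>\<^sup>\<bottom>\<^sub>w\<xi> - \<nabla>\<^sup>\<bottom>\<^sub>w\<nabla>\<^sup>\<bottom>\<^sub>v\<xi>\<close> at \<open>u\<close>, the bracket term vanishing for constant fields.
  This is tensorial in \<open>\<xi>\<close>, so the normal vector \<open>\<xi>\<close> at \<open>u\<close> may be extended to any local
  normal field; we take its orthogonal projection to the nearby normal spaces.
\<close>

definition normal_curvature ::
    "(real^'n \<Rightarrow> real^'m) \<Rightarrow> real^'n::finite \<Rightarrow> real^'n \<Rightarrow> real^'n \<Rightarrow> real^'m \<Rightarrow> real^'m::finite" where
  "normal_curvature F u v w \<xi> =
     (let \<Xi> = (\<lambda>y. orth_proj (normal_space F y) \<xi>)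
      in normal_conn F v (normal_conn F w \<Xi>) u - normal_conn F w (normal_conn F v \<Xi>) u)"

definition orthonormal_tangent_basis :: "real^'n^'n \<Rightarrow> ('n::finite \<Rightarrow> real^'n) \<Rightarrow> bool" where
  "orthonormal_tangent_basis Q e \<longleftrightarrow> (\<forall>i j. e i \<bullet> (Q *v e j) = (if i = j then 1 else 0))"

definition orthonormal_basis_of :: "'b::euclidean_space set \<Rightarrow> 'b set \<Rightarrow> bool" where
  "orthonormal_basis_of S B \<longleftrightarrow>
     pairwise orthogonal B \<and> (\<forall>b\<in>B. norm b = 1) \<and> span B = S"

text \<open>The value does not depend on the orthonormal bases.\<close>

definition normal_curvature_norm ::
    "(real^'n \<Rightarrow> real^'n^'n) \<Rightarrow> (real^'n \<Rightarrow> real^'m::finite) \<Rightarrow> real^'n::finite \<Rightarrow> real" where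
  "normal_curvature_norm G F u =
     (let e = (SOME e. orthonormal_tangent_basis (G u) e);
          B = (SOME B. orthonormal_basis_of (normal_space F u) B)
      in sqrt (\<Sum>i\<in>UNIV. \<Sum>j\<in>UNIV. \<Sum>a\<in>B. \<Sum>b\<in>B. (normal_curvature F u (e i) (e j) a \<bullet> b)\<^sup>2))"

definition normalized_normal_curvature ::
    "(real^'n \<Rightarrow> real^'n^'n) \<Rightarrow> (real^'n \<Rightarrow> real^'m::finite) \<Rightarrow> real^'n::finite \<Rightarrow> real" where
  "normalized_normal_curvature G F u =
     normal_curvature_norm G F u / (real CARD('n) * (real CARD('n) - 1))"


section \<open>Minimal and Wintgen ideal isometric immersions\<close>

definition isometric_immersion_unit_sphere ::
    "('a, 'n::finite) param set \<Rightarrow> (('a, 'n) param \<Rightarrow> real^'n \<Rightarrow> real^'n^'n)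
     \<Rightarrow> ('a \<Rightarrow> real^'m::finite) \<Rightarrow> bool" where
  "isometric_immersion_unit_sphere A g f \<longleftrightarrow>
     (\<forall>(V, x)\<in>A. smooth_on V (f \<circ> x) \<and>
        (\<forall>u\<in>V. f (x u) \<in> sphere 0 1 \<and>
           inj (frechet_derivative (f \<circ> x) (at u)) \<and>
           (\<forall>v w. frechet_derivative (f \<circ> x) (at u) v \<bullet> frechet_derivative (f \<circ> x) (at u) w
                  = v \<bullet> (g (V, x) u *v w))))"

definition minimal_immersion ::
    "('a, 'n::finite) param set \<Rightarrow> (('a, 'n) param \<Rightarrow> real^'n \<Rightarrow> real^'n^'n)
     \<Rightarrow> ('a \<Rightarrow> real^'m::finite) \<Rightarrow> bool" where
  "minimal_immersion A g f \<longleftrightarrow> (\<forall>(V, x)\<in>A. \<forall>u\<in>V. mean_curvature (g (V, x)) (f \<circ> x) u = 0)"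

text \<open>The equality \<open>\<rho> = c + H\<^sup>2 - \<rho>\<^sup>\<bottom>\<close> with \<open>c = 1\<close>.\<close>

definition wintgen_ideal ::
    "('a, 'n::finite) param set \<Rightarrow> (('a, 'n) param \<Rightarrow> real^'n \<Rightarrow> real^'n^'n)
     \<Rightarrow> ('a \<Rightarrow> real^'m::finite) \<Rightarrow> bool" where
  "wintgen_ideal A g f \<longleftrightarrow>
     (\<forall>(V, x)\<in>A. \<forall>u\<in>V.
        normalized_scalar_curvature (g (V, x)) u =
          1 + (mean_curvature (g (V, x)) (f \<circ> x) u)\<^sup>2
            - normalized_normal_curvature (g (V, x)) (f \<circ> x) u)"


section \<open>Betti numbers\<close>

text \<open>
  The rank of the integral singular homology group, i.e. the supremum of the sizes of its
  \<open>\<int>\<close>-linearly independent subsets (the group is written multiplicatively).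
\<close>

definition Z_independent :: "'g monoid \<Rightarrow> 'g set \<Rightarrow> bool" where
  "Z_independent G S \<longleftrightarrow> S \<subseteq> carrier G \<and>
     (\<forall>c :: 'g \<Rightarrow> int. finprod G (\<lambda>s. s [^]\<^bsub>G\<^esub> c s) S = \<one>\<^bsub>G\<^esub> \<longrightarrow> (\<forall>s\<in>S. c s = 0))"

definition betti_number :: "nat \<Rightarrow> 'a topology \<Rightarrow> enat" where
  "betti_number p X =
     (SUP S \<in> {S. finite S \<and> Z_independent (homology_group (int p) X) S}. enat (card S))"

end

theory Submission
  imports Defs "HOL-Complex_Analysis.Complex_Analysis"
begin

text \<open>
  The manifold is the link \<open>{z \<in> \<complex>\<^sup>3. |z| = 1, z\<^sub>1\<^sup>d + z\<^sub>2\<^sup>d + z\<^sub>3\<^sup>d = 0}\<close> of the Fermat cone with \<open>d\<close> even, inside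
  \<open>S\<^sup>5 \<subseteq> S\<^sup>6\<close>. As the cone is a complex hypersurface, its second fundamental form is complex bilinear and
  vanishes on the radial direction. On the link it therefore vanishes in the Hopf direction \<open>iz\<close>, and in a
  unitary frame \<open>w, iw\<close> of the complementary complex line it is \<open>\<sigma>, i\<sigma>, -\<sigma>\<close>. This gives minimality, and the
  Gauss and Ricci equations turn the Wintgen equality into \<open>1 - 4|\<sigma>|\<^sup>2/6\<close> on both sides.

  The link is a circle bundle over the Fermat curve. The function \<open>Im (cnj z\<^sub>2 * z\<^sub>3)\<close> vanishes exactly on \<open>d/2\<close>
  disjoint tori. Dual to them there are explicit maps to the circle and explicit loops, which pair to the identity
  matrix, so that \<open>b\<^sub>1 \<ge> d/2 - 1\<close>.
\<close>

section \<open>Calculus of smooth maps\<close>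

text \<open>Evenness of \<open>d = 2 * k\<close> is what cuts out the tori: where
  \<open>z\<^sub>2\<close> and \<open>z\<^sub>3\<close> have a real ratio \<open>r\<close>, the
  number \<open>1 + r ^ d\<close> is positive, so \<open>z\<^sub>1\<close> cannot vanish there and
  \<open>(z\<^sub>1 / z\<^sub>2) ^ 2\<close> has a \<open>k\<close>-th power on the negative real
  axis, hence one of \<open>k\<close> arguments. One class is lost in the bound because all tori are
  crossed in the direction of increasing or decreasing height: the signed crossings of a loop add up
  to zero. Each loop therefore leaves through one torus and returns through a fixed one. The
  homology of the bundle is never computed; integer degrees of self-maps of the circle already force
  independence. Passing from the 5-sphere to the 6-sphere adds a constant unit normal \<nu>, on
  which the second fundamental form has no component. Charts are written down with complex
  logarithms in place of an implicit function theorem, and the orientation comes from a nowhere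
  vanishing 3-form.\<close>

lemma Ck_on_cong:
  assumes "open S" "\<And>x. x \<in> S \<Longrightarrow> f x = g x" "Ck_on k S f"
  shows "Ck_on k S g"
  using assms(2,3)
proof (induction k arbitrary: f g)
  case 0
  then show ?case by (simp cong: continuous_on_cong_simp)
next
  case (Suc k)
  have d: "f differentiable (at x)" if "x \<in> S" for x
    using Suc.prems(2) that by simp
  have fd: "frechet_derivative f (at x) = frechet_derivative g (at x)" if "x \<in> S" for x
    using frechet_derivative_transform_within_open[OF d[OF that] assms(1) that] Suc.prems(1) by metis
  have "g differentiable (at x)" if "x \<in> S" for x
    using d[OF that] Suc.prems(1) assms(1) that
    by (meson differentiable_def has_derivative_transform_within_open)
  moreover have "Ck_on k S (\<lambda>x. frechet_derivative g (at x) v)" for v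
    by (rule Suc.IH[of "\<lambda>x. frechet_derivative f (at x) v"]) (use fd Suc.prems in auto)
  ultimately show ?case by simp
qed

lemma Ck_on_subset: "Ck_on k S f \<Longrightarrow> T \<subseteq> S \<Longrightarrow> Ck_on k T f"
  by (induction k arbitrary: f) (auto intro: continuous_on_subset)

lemma Ck_on_Suc_D: "Ck_on (Suc k) S f \<Longrightarrow> Ck_on k S f"
proof (induction k arbitrary: f)
  case 0
  then show ?case
    by (auto intro!: continuous_at_imp_continuous_on differentiable_imp_continuous_within)
next
  case (Suc k)
  then show ?case by (metis Ck_on.simps(2))
qed

text \<open>Replaces the chosen \<open>frechet_derivative\<close> in the recursion by any explicit
  derivative, which is the form that the product rule and the chain rule deliver.\<close>

lemma Ck_on_SucI:
  assumes "open S" "\<And>x. x \<in> S \<Longrightarrow> (f has_derivative f' x) (at x)"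
    "\<And>v. Ck_on k S (\<lambda>x. f' x v)"
  shows "Ck_on (Suc k) S f"
proof -
  have "Ck_on k S (\<lambda>x. frechet_derivative f (at x) v)" for v
    by (rule Ck_on_cong[OF assms(1) _ assms(3)[of v]])
      (use assms(2) frechet_derivative_at in metis)
  then show ?thesis
    using assms(2) by (auto simp: differentiable_def)
qed

lemma Ck_on_has_derivative:
  assumes "Ck_on (Suc k) S f" "x \<in> S"
  shows "(f has_derivative frechet_derivative f (at x)) (at x)"
  using assms by (simp add: frechet_derivative_works)

lemma Ck_on_const: "Ck_on k S (\<lambda>x. c)"
proof (induction k arbitrary: c)
  case (Suc k)
  then show ?case by simp
qed simp

lemma Ck_on_linear:
  assumes "bounded_linear L" "open S" "Ck_on k S f"
  shows "Ck_on k S (\<lambda>x. L (f x))"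
  using assms(3)
proof (induction k arbitrary: f)
  case 0
  then show ?case
    by (simp add: bounded_linear.continuous_on[OF assms(1)])
next
  case (Suc k)
  show ?case
    by (rule Ck_on_SucI[OF assms(2) bounded_linear.has_derivative[OF assms(1) Ck_on_has_derivative[OF Suc.prems]]])
      (use Suc in auto)
qed

lemma Ck_on_add:
  assumes "open S" "Ck_on k S f" "Ck_on k S g"
  shows "Ck_on k S (\<lambda>x. f x + g x)"
  using assms(2,3)
proof (induction k arbitrary: f g)
  case (Suc k)
  show ?case
    by (rule Ck_on_SucI[OF assms(1) has_derivative_add[OF Ck_on_has_derivative[OF Suc.prems(1)] Ck_on_has_derivative[OF Suc.prems(2)]]])
      (use Suc in auto)
qed (simp add: continuous_on_add)

lemma Ck_on_sum:
  assumes "open S" "\<And>i. i \<in> I \<Longrightarrow> Ck_on k S (f i)"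
  shows "Ck_on k S (\<lambda>x. \<Sum>i\<in>I. f i x)"
  using assms(2)
  by (induction I rule: infinite_finite_induct) (auto intro: Ck_on_add assms(1) Ck_on_const)

text \<open>The product rule produces two terms of the same bilinear shape, so the induction over
  arbitrary \<open>f\<close> and \<open>g\<close> closes. This covers scalar multiples, inner
  products and complex products at once.\<close>

lemma Ck_on_bilinear:
  assumes "bounded_bilinear pr" "open S" "Ck_on k S f" "Ck_on k S g"
  shows "Ck_on k S (\<lambda>x. pr (f x) (g x))"
  using assms(3,4)
proof (induction k arbitrary: f g)
  case 0
  then show ?case
    using bounded_bilinear.continuous_on[OF assms(1)] by auto
next
  case (Suc k)
  have c: "Ck_on k S f" "Ck_on k S g"
    using Suc.prems Ck_on_Suc_D by blast+
  have d: "Ck_on k S (\<lambda>x. frechet_derivative f (at x) v)" "Ck_on k S (\<lambda>x. frechet_derivative g (at x) v)" for v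
    using Suc.prems by simp_all
  have D: "((\<lambda>x. pr (f x) (g x)) has_derivative
      (\<lambda>h. pr (f x) (frechet_derivative g (at x) h) + pr (frechet_derivative f (at x) h) (g x))) (at x)"
    if "x \<in> S" for x
    by (rule bounded_bilinear.FDERIV[OF assms(1)]) (rule Ck_on_has_derivative[OF _ that], fact Suc.prems)+
  show ?case
    by (rule Ck_on_SucI[OF assms(2) D], assumption)
      (intro Ck_on_add[OF assms(2)] Suc.IH c d)
qed

lemma linear_basis_expand:
  fixes h :: "'a::euclidean_space \<Rightarrow> 'b::real_vector"
  assumes "linear h"
  shows "h w = (\<Sum>b\<in>Basis. (w \<bullet> b) *\<^sub>R h b)"
proof -
  have "h w = h (\<Sum>b\<in>Basis. (w \<bullet> b) *\<^sub>R b)"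
    by (simp only: euclidean_representation)
  also have "\<dots> = (\<Sum>b\<in>Basis. (w \<bullet> b) *\<^sub>R h b)"
    by (simp add: linear_sum[OF assms] linear_scale[OF assms])
  finally show ?thesis .
qed

text \<open>The chain rule evaluates the derivative of \<open>f\<close> in a direction that moves
  with the point, whereas \<open>Ck_on\<close> speaks of fixed directions. Expanding the direction
  in a basis turns the derivative into a finite sum of products that the induction can
  treat.\<close>

lemma Ck_on_compose:
  assumes "open S" "open T" "\<And>x. x \<in> S \<Longrightarrow> g x \<in> T" "Ck_on k T f" "Ck_on k S g"
  shows "Ck_on k S (\<lambda>x. f (g x))"
  using assms(4,5)
proof (induction k arbitrary: f)
  case 0
  then show ?case
    using assms(3) by (auto intro: continuous_on_compose2[of T])
next
  case (Suc k)
  let ?f' = "\<lambda>x b. frechet_derivative f (at (g x)) b"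
  have D: "((\<lambda>x. f (g x)) has_derivative (\<lambda>v. ?f' x (frechet_derivative g (at x) v))) (at x)"
    if "x \<in> S" for x
    using has_derivative_compose[OF Ck_on_has_derivative[OF Suc.prems(2) that]
        Ck_on_has_derivative[OF Suc.prems(1) assms(3)[OF that]]] .
  have D': "((\<lambda>x. f (g x)) has_derivative
     (\<lambda>v. \<Sum>b\<in>Basis. (frechet_derivative g (at x) v \<bullet> b) *\<^sub>R ?f' x b)) (at x)"
    if "x \<in> S" for x
  proof -
    have lin: "linear (?f' x)"
      using Ck_on_has_derivative[OF Suc.prems(1) assms(3)[OF that]] has_derivative_linear by blast
    show ?thesis
      using D[OF that] by (subst (asm) linear_basis_expand[OF lin])
  qed
  show ?case
  proof (rule Ck_on_SucI[OF assms(1) D'], assumption)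
    fix v
    show "Ck_on k S (\<lambda>x. \<Sum>b\<in>Basis. (frechet_derivative g (at x) v \<bullet> b) *\<^sub>R ?f' x b)"
    proof (intro Ck_on_sum assms(1) Ck_on_bilinear[OF bounded_bilinear_scaleR]
        Ck_on_linear[OF bounded_linear_inner_left])
      fix b :: 'b
      show "Ck_on k S (\<lambda>x. ?f' x b)"
        by (rule Suc.IH[of "\<lambda>y. frechet_derivative f (at y) b"])
          (use Suc.prems Ck_on_Suc_D in auto)
    qed (use Suc.prems in simp)
  qed
qed

text \<open>The real derivative is multiplication by \<open>deriv f x\<close>, again holomorphic.
  Powers, inverses, \<open>exp\<close> and \<open>Ln\<close> all obtain their smoothness from
  here.\<close>

lemma Ck_on_holomorphic:
  assumes "open S" "f holomorphic_on S"
  shows "Ck_on k S f"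
  using assms(2)
proof (induction k arbitrary: f)
  case 0
  then show ?case by (simp add: holomorphic_on_imp_continuous_on)
next
  case (Suc k)
  show ?case
  proof (rule Ck_on_SucI[OF assms(1)])
    show "(f has_derivative (*) (deriv f x)) (at x)" if "x \<in> S" for x
      using holomorphic_derivI[OF Suc.prems assms(1) that] by (simp add: has_field_derivative_def)
    show "Ck_on k S (\<lambda>x. deriv f x * v)" for v
      by (intro Ck_on_bilinear[OF bounded_bilinear_mult] assms(1) Ck_on_const Suc.IH
          holomorphic_deriv Suc.prems)
  qed
qed

lemma smooth_on_cong:
  "open S \<Longrightarrow> (\<And>x. x \<in> S \<Longrightarrow> f x = g x) \<Longrightarrow> smooth_on S f \<Longrightarrow> smooth_on S g"
  unfolding smooth_on_def by (meson Ck_on_cong)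

lemma smooth_on_subset: "smooth_on S f \<Longrightarrow> T \<subseteq> S \<Longrightarrow> smooth_on T f"
  unfolding smooth_on_def by (meson Ck_on_subset)

lemma smooth_on_const: "smooth_on S (\<lambda>x. c)"
  by (simp add: smooth_on_def Ck_on_const)

lemma smooth_on_linear: "bounded_linear L \<Longrightarrow> open S \<Longrightarrow> smooth_on S f \<Longrightarrow> smooth_on S (\<lambda>x. L (f x))"
  by (simp add: smooth_on_def Ck_on_linear)

lemma smooth_on_add:
  "open S \<Longrightarrow> smooth_on S f \<Longrightarrow> smooth_on S g \<Longrightarrow> smooth_on S (\<lambda>x. f x + g x)"
  by (simp add: smooth_on_def Ck_on_add)

lemma smooth_on_sum:
  "open S \<Longrightarrow> (\<And>i. i \<in> I \<Longrightarrow> smooth_on S (f i)) \<Longrightarrow> smooth_on S (\<lambda>x. \<Sum>i\<in>I. f i x)"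
  by (simp add: smooth_on_def Ck_on_sum)

lemma smooth_on_bilinear:
  "bounded_bilinear pr \<Longrightarrow> open S \<Longrightarrow> smooth_on S f \<Longrightarrow> smooth_on S g \<Longrightarrow> smooth_on S (\<lambda>x. pr (f x) (g x))"
  by (simp add: smooth_on_def Ck_on_bilinear)

lemma smooth_on_compose:
  "open S \<Longrightarrow> open T \<Longrightarrow> (\<And>x. x \<in> S \<Longrightarrow> g x \<in> T) \<Longrightarrow> smooth_on T f \<Longrightarrow> smooth_on S g
    \<Longrightarrow> smooth_on S (\<lambda>x. f (g x))"
  unfolding smooth_on_def by (metis Ck_on_compose)

lemma smooth_on_holomorphic_compose:
  "open S \<Longrightarrow> open T \<Longrightarrow> (\<And>x. x \<in> S \<Longrightarrow> g x \<in> T) \<Longrightarrow> f holomorphic_on T \<Longrightarrow> smooth_on S g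
    \<Longrightarrow> smooth_on S (\<lambda>x. f (g x))"
  by (rule smooth_on_compose) (auto simp: smooth_on_def Ck_on_holomorphic)

lemma smooth_on_id: "open S \<Longrightarrow> smooth_on S (\<lambda>x. x)"
proof -
  assume "open S"
  have "Ck_on k S (\<lambda>x. x)" for k
  proof (cases k)
    case (Suc k')
    show ?thesis unfolding Suc
      by (rule Ck_on_SucI[OF \<open>open S\<close> has_derivative_ident]) (rule Ck_on_const)
  qed simp
  then show ?thesis by (simp add: smooth_on_def)
qed

lemma smooth_on_frechet_derivative:
  "smooth_on S f \<Longrightarrow> smooth_on S (\<lambda>x. frechet_derivative f (at x) v)"
  unfolding smooth_on_def by (metis Ck_on.simps(2))

lemma smooth_on_has_derivative:
  "smooth_on S f \<Longrightarrow> x \<in> S \<Longrightarrow> (f has_derivative frechet_derivative f (at x)) (at x)"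
  unfolding smooth_on_def by (metis Ck_on_has_derivative)

lemma smooth_on_differentiable: "smooth_on S f \<Longrightarrow> x \<in> S \<Longrightarrow> f differentiable (at x)"
  using smooth_on_has_derivative differentiable_def by blast

lemma smooth_on_continuous: "smooth_on S f \<Longrightarrow> continuous_on S f"
  unfolding smooth_on_def by (metis Ck_on.simps(1))

lemma smooth_on_frechet_linear: "smooth_on S f \<Longrightarrow> x \<in> S \<Longrightarrow> linear (frechet_derivative f (at x))"
  using smooth_on_has_derivative has_derivative_linear by blast

section \<open>Geometry of immersions into the unit sphere\<close>

lemma second_difference:
  fixes \<phi> :: "'a::real_normed_vector \<Rightarrow> real"
  assumes D: "\<And>y. y \<in> ball x \<delta> \<Longrightarrow> (\<phi> has_derivative D y) (at y)"
    and E: "\<And>y. y \<in> ball x \<delta> \<Longrightarrow> ((\<lambda>z. D z v) has_derivative E y) (at y)"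
    and h: "h > 0" "h * (norm v + norm w) < \<delta>"
  shows "\<exists>p\<in>ball x \<delta>. \<phi> (x + h *\<^sub>R v + h *\<^sub>R w) - \<phi> (x + h *\<^sub>R v) - \<phi> (x + h *\<^sub>R w) + \<phi> x = h * h * E p w"
proof -
  have inb: "x + s *\<^sub>R v + t *\<^sub>R w \<in> ball x \<delta>" if "0 \<le> s" "s \<le> h" "0 \<le> t" "t \<le> h" for s t
  proof -
    have "norm (s *\<^sub>R v + t *\<^sub>R w) \<le> s * norm v + t * norm w"
      using that norm_triangle_ineq[of "s *\<^sub>R v" "t *\<^sub>R w"] by simp
    also have "\<dots> \<le> h * norm v + h * norm w"
      using that by (intro add_mono mult_right_mono) auto
    finally have "norm (s *\<^sub>R v + t *\<^sub>R w) < \<delta>"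
      using h by (simp add: algebra_simps)
    moreover have "dist x (x + s *\<^sub>R v + t *\<^sub>R w) = norm (s *\<^sub>R v + t *\<^sub>R w)"
      using norm_minus_cancel[of "s *\<^sub>R v + t *\<^sub>R w"] by (simp add: dist_norm add.commute)
    ultimately show ?thesis by simp
  qed
  have along: "((\<lambda>s. \<phi> (x + s *\<^sub>R v + t *\<^sub>R w)) has_real_derivative D (x + s *\<^sub>R v + t *\<^sub>R w) v) (at s)"
    if "0 \<le> s" "s \<le> h" "0 \<le> t" "t \<le> h" for s t
  proof -
    have "((\<lambda>s. x + s *\<^sub>R v + t *\<^sub>R w) has_derivative (\<lambda>s. s *\<^sub>R v)) (at s)"
      by (auto intro!: derivative_eq_intros)
    from has_derivative_compose[OF this D[OF inb[OF that]]]
    show ?thesis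
      using linear_scale[OF has_derivative_linear[OF D[OF inb[OF that]]]]
      by (simp add: has_field_derivative_def mult.commute[of _ "D _ v"] mult_commute_abs)
  qed
  have along2: "((\<lambda>t. D (x + s *\<^sub>R v + t *\<^sub>R w) v) has_real_derivative E (x + s *\<^sub>R v + t *\<^sub>R w) w) (at t)"
    if "0 \<le> s" "s \<le> h" "0 \<le> t" "t \<le> h" for s t
  proof -
    have "((\<lambda>t. x + s *\<^sub>R v + t *\<^sub>R w) has_derivative (\<lambda>t. t *\<^sub>R w)) (at t)"
      by (auto intro!: derivative_eq_intros)
    from has_derivative_compose[OF this E[OF inb[OF that]]]
    show ?thesis
      using linear_scale[OF has_derivative_linear[OF E[OF inb[OF that]]]]
      by (simp add: has_field_derivative_def mult_commute_abs)
  qed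
  \<comment> \<open>Two mean value theorems follow: along \<open>v\<close> for the increment in
    direction \<open>w\<close>, then along \<open>w\<close> for the derivative in direction
    \<open>v\<close>.\<close>
  define a where "a s = \<phi> (x + s *\<^sub>R v + h *\<^sub>R w) - \<phi> (x + s *\<^sub>R v + 0 *\<^sub>R w)" for s
  have "\<exists>z. 0 < z \<and> z < h \<and> a h - a 0 = (h - 0) * (D (x + z *\<^sub>R v + h *\<^sub>R w) v - D (x + z *\<^sub>R v + 0 *\<^sub>R w) v)"
    unfolding a_def using h(1) by (intro MVT2 DERIV_diff along) auto
  then obtain z where z: "0 < z" "z < h"
    "a h - a 0 = h * (D (x + z *\<^sub>R v + h *\<^sub>R w) v - D (x + z *\<^sub>R v + 0 *\<^sub>R w) v)" by auto
  have "\<exists>y. 0 < y \<and> y < h \<and> D (x + z *\<^sub>R v + h *\<^sub>R w) v - D (x + z *\<^sub>R v + 0 *\<^sub>R w) v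
      = (h - 0) * E (x + z *\<^sub>R v + y *\<^sub>R w) w"
    using h(1) z by (intro MVT2 along2) auto
  then obtain y where y: "0 < y" "y < h" "D (x + z *\<^sub>R v + h *\<^sub>R w) v - D (x + z *\<^sub>R v + 0 *\<^sub>R w) v
      = h * E (x + z *\<^sub>R v + y *\<^sub>R w) w" by auto
  have "\<phi> (x + h *\<^sub>R v + h *\<^sub>R w) - \<phi> (x + h *\<^sub>R v) - \<phi> (x + h *\<^sub>R w) + \<phi> x = a h - a 0"
    by (simp add: a_def)
  also have "\<dots> = h * h * E (x + z *\<^sub>R v + y *\<^sub>R w) w"
    unfolding z(3) y(3) by simp
  finally show ?thesis using inb[of z y] z y by auto
qed

text \<open>The second difference is symmetric in \<open>v\<close> and \<open>w\<close>, but
  \<open>second_difference\<close> evaluates it at one nearby point for each order. Continuity of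
  both mixed derivatives then rules out a positive gap between them at \<open>x\<close>.\<close>

lemma frechet_derivative_symmetric:
  fixes f :: "'a::euclidean_space \<Rightarrow> 'b::euclidean_space"
  assumes S: "open S" "x \<in> S" and f: "smooth_on S f"
  shows "frechet_derivative (\<lambda>y. frechet_derivative f (at y) w) (at x) v
       = frechet_derivative (\<lambda>y. frechet_derivative f (at y) v) (at x) w"
proof (rule euclidean_eqI)
  fix b :: 'b assume "b \<in> Basis"
  define E where "E v y w = frechet_derivative (\<lambda>y. frechet_derivative f (at y) v) (at y) w \<bullet> b" for v y w
  define \<phi> where "\<phi> y = f y \<bullet> b" for y
  have D: "(\<phi> has_derivative (\<lambda>v. frechet_derivative f (at y) v \<bullet> b)) (at y)" if "y \<in> S" for y
    unfolding \<phi>_def by (intro has_derivative_inner_left smooth_on_has_derivative[OF f that])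
  have E: "((\<lambda>y. frechet_derivative f (at y) v \<bullet> b) has_derivative E v y) (at y)" if "y \<in> S" for y v
    unfolding E_def
    by (intro has_derivative_inner_left smooth_on_has_derivative[OF smooth_on_frechet_derivative[OF f] that])
  have cont: "continuous_on S (\<lambda>y. E v y w)" for v w
    unfolding E_def
    by (intro continuous_intros smooth_on_continuous smooth_on_frechet_derivative f)
  show "frechet_derivative (\<lambda>y. frechet_derivative f (at y) w) (at x) v \<bullet> b =
         frechet_derivative (\<lambda>y. frechet_derivative f (at y) v) (at x) w \<bullet> b"
  proof (rule ccontr)
    assume neq: "\<not> ?thesis"
    define e where "e = \<bar>E v x w - E w x v\<bar> / 2"
    have e: "e > 0" using neq by (simp add: e_def E_def)
    obtain d1 where d1: "d1 > 0" "\<And>y. y \<in> S \<Longrightarrow> dist y x < d1 \<Longrightarrow> dist (E v y w) (E v x w) < e"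
      using cont[of v w] S e unfolding continuous_on_iff by blast
    obtain d2 where d2: "d2 > 0" "\<And>y. y \<in> S \<Longrightarrow> dist y x < d2 \<Longrightarrow> dist (E w y v) (E w x v) < e"
      using cont[of w v] S e unfolding continuous_on_iff by blast
    obtain d3 where d3: "d3 > 0" "ball x d3 \<subseteq> S"
      using S open_contains_ball by blast
    define \<delta> where "\<delta> = min d1 (min d2 d3)"
    have \<delta>: "\<delta> > 0" "ball x \<delta> \<subseteq> S" using d1 d2 d3 by (auto simp: \<delta>_def)
    define h where "h = \<delta> / (norm v + norm w + 1)"
    have nz: "norm v + norm w + 1 > 0"
      by (meson add_nonneg_pos add_nonneg_nonneg norm_ge_zero zero_less_one)
    have h: "h > 0" using \<delta> nz by (simp add: h_def)
    have h2: "h * (norm v + norm w) < \<delta>"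
      using \<delta> nz by (simp add: h_def field_simps)
    then have h2': "h * (norm w + norm v) < \<delta>" by (simp add: add.commute)
    obtain p where p: "p \<in> ball x \<delta>"
      "\<phi> (x + h *\<^sub>R v + h *\<^sub>R w) - \<phi> (x + h *\<^sub>R v) - \<phi> (x + h *\<^sub>R w) + \<phi> x = h * h * E v p w"
      using second_difference[of x \<delta> \<phi> "\<lambda>y v. frechet_derivative f (at y) v \<bullet> b" v "E v" h w]
        D E \<delta>(2) h h2 by blast
    obtain q where q: "q \<in> ball x \<delta>"
      "\<phi> (x + h *\<^sub>R w + h *\<^sub>R v) - \<phi> (x + h *\<^sub>R w) - \<phi> (x + h *\<^sub>R v) + \<phi> x = h * h * E w q v"
      using second_difference[of x \<delta> \<phi> "\<lambda>y v. frechet_derivative f (at y) v \<bullet> b" w "E w" h v]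
        D E \<delta>(2) h h2' by blast
    have "x + h *\<^sub>R w + h *\<^sub>R v = x + h *\<^sub>R v + h *\<^sub>R w" by (simp add: algebra_simps)
    then have "h * h * E v p w = h * h * E w q v" using p(2) q(2) by (simp only:)
    then have "E v p w = E w q v" using h by simp
    moreover have "p \<in> S" "q \<in> S" using p(1) q(1) \<delta>(2) by auto
    then have "dist (E v p w) (E v x w) < e" "dist (E w q v) (E w x v) < e"
      using d1(2)[of p] p(1) d2(2)[of q] q(1) by (auto simp: \<delta>_def dist_commute)
    ultimately have "\<bar>E v x w - E w x v\<bar> < e + e" by (simp add: dist_real_def)
    then show False by (simp add: e_def)
  qed
qed

text \<open>The device by which identities valid along a chart, such as orthogonality relations or
  the defining equation, are differentiated.\<close>

lemma has_derivative_const_on_open: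
  assumes "open V" "u \<in> V" "(f has_derivative f') (at u)" "\<And>y. y \<in> V \<Longrightarrow> f y = c"
  shows "f' v = 0"
proof -
  have "(f has_derivative (\<lambda>_. 0)) (at u)"
    by (rule has_derivative_transform_within_open[OF has_derivative_const[of c] assms(1,2)]) (simp add: assms(4))
  from has_derivative_unique[OF assms(3) this] show ?thesis by simp
qed

section \<open>Orthogonal projections and normal spaces\<close>

lemma orth_proj_eqI:
  assumes "subspace S" "w \<in> S" "\<And>s. s \<in> S \<Longrightarrow> (v - w) \<bullet> s = 0"
  shows "orth_proj S v = w"
  unfolding orth_proj_def
proof (rule the_equality)
  show "w \<in> S \<and> (\<forall>s\<in>S. orthogonal (v - w) s)" using assms by (simp add: orthogonal_def)
  fix w' assume w': "w' \<in> S \<and> (\<forall>s\<in>S. orthogonal (v - w') s)"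
  have m: "w' - w \<in> S" using assms w' by (simp add: subspace_diff)
  have "(w' - w) \<bullet> (w' - w) = (v - w) \<bullet> (w' - w) - (v - w') \<bullet> (w' - w)"
    by (simp add: inner_diff_left)
  also have "\<dots> = 0" using assms(3)[OF m] w' m by (simp add: orthogonal_def)
  finally show "w' = w" by simp
qed

lemma orth_proj_in_orth:
  fixes S :: "'a::euclidean_space set"
  assumes "subspace S"
  shows "orth_proj S v \<in> S" "s \<in> S \<Longrightarrow> orth_proj S v \<bullet> s = v \<bullet> s"
proof -
  obtain y z where yz: "y \<in> span S" "\<And>w. w \<in> span S \<Longrightarrow> orthogonal z w" "v = y + z"
    using orthogonal_subspace_decomp_exists by blast
  have "orth_proj S v = y"
    by (rule orth_proj_eqI)
      (use yz assms in \<open>auto simp: iffD2[OF span_eq_iff assms] orthogonal_def\<close>)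
  with yz show "orth_proj S v \<in> S" "s \<in> S \<Longrightarrow> orth_proj S v \<bullet> s = v \<bullet> s"
    using assms by (auto simp: iffD2[OF span_eq_iff assms] orthogonal_def inner_add_left)
qed

lemma linear_orth_proj:
  fixes S :: "'a::euclidean_space set"
  assumes "subspace S"
  shows "linear (orth_proj S)"
proof (rule linearI)
  show "orth_proj S (a + b) = orth_proj S a + orth_proj S b" for a b
    by (rule orth_proj_eqI[OF assms])
      (simp_all add: assms subspace_add orth_proj_in_orth inner_diff_left inner_add_left)
  show "orth_proj S (r *\<^sub>R a) = r *\<^sub>R orth_proj S a" for r a
    by (rule orth_proj_eqI[OF assms])
      (simp_all add: assms subspace_scale orth_proj_in_orth inner_diff_left)
qed

lemma orth_proj_orth_proj:
  fixes S :: "'a::euclidean_space set"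
  assumes "subspace S" "subspace T" "S \<subseteq> T"
  shows "orth_proj S (orth_proj T v) = orth_proj S v"
  by (rule orth_proj_eqI[OF assms(1)])
    (use assms in \<open>auto simp: orth_proj_in_orth inner_diff_left subset_iff\<close>)

lemma orth_proj_id: "subspace S \<Longrightarrow> v \<in> S \<Longrightarrow> orth_proj S v = v"
  by (rule orth_proj_eqI) auto

lemma orth_proj_commute:
  fixes S :: "'a::euclidean_space set"
  assumes "subspace S"
  shows "orth_proj S v \<bullet> w = v \<bullet> orth_proj S w"
  by (metis assms inner_commute orth_proj_in_orth)

lemma subspace_normal_space: "subspace (normal_space F u)"
  unfolding normal_space_def subspace_def by (auto simp: orthogonal_clauses)

lemma subspace_orthogonal_left: "subspace {w. orthogonal w a}"
  unfolding subspace_def by (auto simp: orthogonal_clauses)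

text \<open>Normal vectors are tangent to the sphere, so the intermediate projection has no effect.
  The connection of the sphere thereby disappears from the normal connection and from the second
  fundamental form.\<close>

lemma orth_proj_normal_sphere:
  "orth_proj (normal_space F u) (orth_proj {w. orthogonal w (F u)} X) = orth_proj (normal_space F u) X"
  by (rule orth_proj_orth_proj[OF subspace_normal_space subspace_orthogonal_left])
    (auto simp: normal_space_def)

lemma normal_conn_eq:
  "normal_conn F v \<xi> u = orth_proj (normal_space F u) (frechet_derivative \<xi> (at u) v)"
  by (simp add: normal_conn_def sphere_conn_def orth_proj_normal_sphere)

lemma second_fundamental_form_eq:
  "second_fundamental_form F u v w
    = orth_proj (normal_space F u) (frechet_derivative (\<lambda>y. frechet_derivative F (at y) w) (at u) v)"
  by (simp add: second_fundamental_form_def sphere_conn_def orth_proj_normal_sphere)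

lemma det_differentiable:
  fixes A :: "'a::real_normed_vector \<Rightarrow> real^'n^'n"
  assumes "\<And>i j. (\<lambda>w. A w $ i $ j) differentiable (at u)"
  shows "(\<lambda>w. det (A w)) differentiable (at u)"
proof -
  have "(\<lambda>w. \<Prod>i\<in>UNIV. A w $ i $ p i) differentiable (at u)" for p
  proof -
    have "((\<lambda>w. A w $ i $ p i) has_derivative frechet_derivative (\<lambda>w. A w $ i $ p i) (at u)) (at u)" for i
      using assms frechet_derivative_works by blast
    from has_derivative_prod[where I=UNIV and f="\<lambda>i w. A w $ i $ p i", OF this] show ?thesis
      unfolding differentiable_def by blast
  qed
  then show ?thesis
    unfolding det_def by (intro differentiable_sum differentiable_mult) auto
qed

text \<open>A single parametrization. Minimality and the Wintgen equality are stated chart by chart,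
  so the whole local theory can be developed here.\<close>

locale sphere_immersion =
  fixes V :: "(real^'n::finite) set" and F :: "real^'n \<Rightarrow> real^'m::finite"
    and G :: "real^'n \<Rightarrow> real^'n^'n"
  assumes V: "open V" and F: "smooth_on V F"
    and sphere: "u \<in> V \<Longrightarrow> F u \<bullet> F u = 1"
    and immersion: "u \<in> V \<Longrightarrow> inj (frechet_derivative F (at u))"
    and metric: "u \<in> V \<Longrightarrow>
      frechet_derivative F (at u) v \<bullet> frechet_derivative F (at u) w = v \<bullet> (G u *v w)"
begin

abbreviation "D1 u \<equiv> frechet_derivative F (at u)"
abbreviation "D2 u v w \<equiv> frechet_derivative (\<lambda>y. frechet_derivative F (at y) w) (at u) v"
abbreviation "N u \<equiv> normal_space F u"
abbreviation "II \<equiv> second_fundamental_form F"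
abbreviation "ax i \<equiv> axis i (1::real) :: real^'n"

lemma lin1: "u \<in> V \<Longrightarrow> linear (D1 u)"
  by (rule smooth_on_frechet_linear[OF F])

lemma lin2: "u \<in> V \<Longrightarrow> linear (\<lambda>v. D2 u v w)"
  by (rule smooth_on_frechet_linear[OF smooth_on_frechet_derivative[OF F]])

lemma D2_sym: "u \<in> V \<Longrightarrow> D2 u v w = D2 u w v"
  by (rule frechet_derivative_symmetric[OF V _ F])

lemma lin2': "u \<in> V \<Longrightarrow> linear (D2 u v)"
  using lin2[of u v] by (simp add: D2_sym)

lemma hd1: "u \<in> V \<Longrightarrow> (F has_derivative D1 u) (at u)"
  by (rule smooth_on_has_derivative[OF F])

lemma hd2: "u \<in> V \<Longrightarrow> ((\<lambda>y. D1 y w) has_derivative (\<lambda>v. D2 u v w)) (at u)"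
  by (rule smooth_on_has_derivative[OF smooth_on_frechet_derivative[OF F]])

lemma F_orth: "u \<in> V \<Longrightarrow> D1 u v \<bullet> F u = 0"
  using has_derivative_const_on_open[OF V _ has_derivative_inner[OF hd1 hd1], of u 1 v] sphere
  by (simp add: inner_commute)

text \<open>Orthogonality of position and velocity, differentiated once more. This radial component
  of the second derivative is the source of the constant curvature 1 in the Gauss equation.\<close>

lemma D2_F: "u \<in> V \<Longrightarrow> D2 u v w \<bullet> F u = - (D1 u v \<bullet> D1 u w)"
  using has_derivative_const_on_open[OF V _ has_derivative_inner[OF hd2[of u w] hd1], of 0 v] F_orth
  by (simp add: inner_commute)

lemma II_eq: "II u v w = orth_proj (N u) (D2 u v w)"
  by (rule second_fundamental_form_eq)

lemma II_N: "II u v w \<in> N u"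
  by (simp add: II_eq orth_proj_in_orth subspace_normal_space)

lemma II_inner: "\<xi> \<in> N u \<Longrightarrow> II u v w \<bullet> \<xi> = D2 u v w \<bullet> \<xi>"
  by (simp add: II_eq orth_proj_in_orth subspace_normal_space)

lemma II_sym: "u \<in> V \<Longrightarrow> II u v w = II u w v"
  by (simp add: II_eq D2_sym)

lemma II_lin: "u \<in> V \<Longrightarrow> linear (\<lambda>v. II u v w)"
  unfolding II_eq
  by (rule linear_compose[OF lin2 linear_orth_proj[OF subspace_normal_space], unfolded o_def])

lemma II_lin': "u \<in> V \<Longrightarrow> linear (II u v)"
  using linear_compose[OF lin2' linear_orth_proj[OF subspace_normal_space]]
  by (simp add: II_eq[abs_def] o_def)

lemma N_F: "\<xi> \<in> N u \<Longrightarrow> \<xi> \<bullet> F u = 0"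
  and N_D1: "\<xi> \<in> N u \<Longrightarrow> \<xi> \<bullet> D1 u v = 0"
  by (auto simp: normal_space_def orthogonal_def)

section \<open>Orthonormal tangent frames and traces\<close>

context
  fixes u e
  assumes u: "u \<in> V" and e: "orthonormal_tangent_basis (G u) e"
begin

lemma frame_inner: "D1 u (e a) \<bullet> D1 u (e b) = (if a = b then 1 else 0)"
  using e u by (simp add: metric orthonormal_tangent_basis_def)

text \<open>With the frame as columns of \<open>Q\<close>, orthonormality says that
  \<open>transpose Q ** G u\<close> is a left inverse of \<open>Q\<close>; for square matrices it is
  then a right inverse as well.\<close>

lemma frame_matrix:
  "(\<chi> i j. \<Sum>a\<in>UNIV. e a $ i * e a $ j) ** G u = mat 1"
proof -
  define Q where "Q = (\<chi> i a. e a $ i)"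
  have "(transpose Q ** G u) ** Q = mat 1"
  proof -
    have "((transpose Q ** G u) ** Q) $ a $ b = e a \<bullet> (G u *v e b)" for a b
      by (simp add: Q_def matrix_mul_assoc[symmetric])
        (simp add: matrix_matrix_mult_def transpose_def inner_vec_def matrix_vector_mult_def)
    then show ?thesis
      using e by (simp add: vec_eq_iff mat_def orthonormal_tangent_basis_def)
  qed
  then have "Q ** (transpose Q ** G u) = mat 1"
    by (simp add: matrix_left_right_inverse)
  moreover have "(\<chi> i j. \<Sum>a\<in>UNIV. e a $ i * e a $ j) = Q ** transpose Q"
    by (simp add: Q_def matrix_matrix_mult_def transpose_def)
  ultimately show ?thesis by (simp add: matrix_mul_assoc)
qed

lemma inverse_metric: "matrix_inv (G u) = (\<chi> i j. \<Sum>a\<in>UNIV. e a $ i * e a $ j)"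
proof -
  let ?A = "\<chi> i j. \<Sum>a\<in>UNIV. e a $ i * e a $ j"
  have "G u ** matrix_inv (G u) = mat 1"
    using frame_matrix invertible_left_inverse[of "G u"]
    unfolding invertible_def matrix_inv_def by (metis (mono_tags, lifting) someI_ex)
  then have "?A ** (G u ** matrix_inv (G u)) = ?A" by simp
  then show ?thesis by (simp add: matrix_mul_assoc frame_matrix)
qed

lemma frame_expand: "v = (\<Sum>a\<in>UNIV. (D1 u v \<bullet> D1 u (e a)) *\<^sub>R e a)"
proof -
  have "v = ((\<chi> i j. \<Sum>a\<in>UNIV. e a $ i * e a $ j) ** G u) *v v"
    by (simp add: frame_matrix)
  also have "\<dots> = (\<chi> i j. \<Sum>a\<in>UNIV. e a $ i * e a $ j) *v (G u *v v)"
    by (simp add: matrix_vector_mul_assoc)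
  also have "\<dots> = (\<Sum>a\<in>UNIV. (e a \<bullet> (G u *v v)) *\<^sub>R e a)"
  proof -
    have "(\<Sum>j\<in>UNIV. (\<Sum>a\<in>UNIV. e a $ i * e a $ j) * y $ j) = (\<Sum>a\<in>UNIV. (\<Sum>j\<in>UNIV. e a $ j * y $ j) * e a $ i)"
      for y :: "real^'n" and i
      unfolding sum_distrib_right by (subst sum.swap) (simp add: mult_ac)
    then show ?thesis
      by (subst matrix_vector_mult_def) (simp add: vec_eq_iff inner_vec_def)
  qed
  also have "\<dots> = (\<Sum>a\<in>UNIV. (D1 u v \<bullet> D1 u (e a)) *\<^sub>R e a)"
    by (simp add: metric[OF u, symmetric] inner_commute)
  finally show ?thesis .
qed

lemma frame_parseval_D1: "D1 u v = (\<Sum>a\<in>UNIV. (D1 u v \<bullet> D1 u (e a)) *\<^sub>R D1 u (e a))"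
  by (subst frame_expand[of v]) (simp add: linear_sum[OF lin1[OF u]] linear_scale[OF lin1[OF u]])

text \<open>The definitions contract with the inverse metric, which \<open>inverse_metric\<close>
  writes as a sum of frame squares. This is the passage from coordinate contractions to frame sums,
  for the mean curvature and for both contractions in the scalar curvature.\<close>

lemma trace_eq:
  fixes \<beta> :: "real^'n \<Rightarrow> real^'n \<Rightarrow> 'c::real_vector"
  assumes "\<And>w. linear (\<lambda>v. \<beta> v w)" "\<And>v. linear (\<beta> v)"
  shows "(\<Sum>i\<in>UNIV. \<Sum>j\<in>UNIV. matrix_inv (G u) $ i $ j *\<^sub>R \<beta> (ax i) (ax j)) = (\<Sum>a\<in>UNIV. \<beta> (e a) (e a))"
proof -
  have diag: "\<beta> (e a) (e a) = (\<Sum>i\<in>UNIV. \<Sum>j\<in>UNIV. (e a $ i * e a $ j) *\<^sub>R \<beta> (ax i) (ax j))" for a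
  proof -
    have x: "w = (\<Sum>i\<in>UNIV. (w $ i) *\<^sub>R ax i)" for w :: "real^'n"
      by (simp add: vec_eq_iff axis_def if_distrib cong: if_cong)
    have 1: "\<beta> w z = (\<Sum>i\<in>UNIV. (w $ i) *\<^sub>R \<beta> (ax i) z)" for w z
      by (subst x[of w]) (simp add: linear_sum[OF assms(1)] linear_scale[OF assms(1)])
    have 2: "\<beta> z w = (\<Sum>i\<in>UNIV. (w $ i) *\<^sub>R \<beta> z (ax i))" for w z
      by (subst x[of w]) (simp add: linear_sum[OF assms(2)] linear_scale[OF assms(2)])
    show ?thesis
      by (subst 1, subst 2) (simp add: scaleR_sum_right)
  qed
  have "(\<Sum>i\<in>UNIV. \<Sum>j\<in>UNIV. matrix_inv (G u) $ i $ j *\<^sub>R \<beta> (ax i) (ax j))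
      = (\<Sum>i\<in>UNIV. \<Sum>j\<in>UNIV. \<Sum>a\<in>UNIV. (e a $ i * e a $ j) *\<^sub>R \<beta> (ax i) (ax j))"
    by (simp add: inverse_metric scaleR_sum_left)
  also have "\<dots> = (\<Sum>i\<in>UNIV. \<Sum>a\<in>UNIV. \<Sum>j\<in>UNIV. (e a $ i * e a $ j) *\<^sub>R \<beta> (ax i) (ax j))"
    by (rule sum.cong[OF refl], rule sum.swap)
  also have "\<dots> = (\<Sum>a\<in>UNIV. \<beta> (e a) (e a))"
    unfolding diag by (rule sum.swap)
  finally show ?thesis .
qed

text \<open>The ambient space is the sum of tangent space, radial line and normal space. The
  remainder after removing the first two parts is orthogonal to both, hence normal.\<close>

lemma split_orth:
  "X = (\<Sum>a\<in>UNIV. (X \<bullet> D1 u (e a)) *\<^sub>R D1 u (e a)) + (X \<bullet> F u) *\<^sub>R F u + orth_proj (N u) X"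
proof -
  let ?T = "\<Sum>a\<in>UNIV. (X \<bullet> D1 u (e a)) *\<^sub>R D1 u (e a)"
  define Y where "Y = X - ?T - (X \<bullet> F u) *\<^sub>R F u"
  have TF: "?T \<bullet> F u = 0" by (simp add: inner_sum_left F_orth u)
  have YF: "Y \<bullet> F u = 0" by (simp add: Y_def inner_diff_left TF sphere u)
  have "?T \<bullet> D1 u (e b) = X \<bullet> D1 u (e b)" for b
    by (simp add: inner_sum_left frame_inner if_distrib cong: if_cong)
  then have Ye: "Y \<bullet> D1 u (e b) = 0" for b
    by (simp add: Y_def inner_diff_left F_orth u inner_commute[of "F u"])
  have Yv: "Y \<bullet> D1 u v = 0" for v
    by (subst frame_parseval_D1) (simp add: inner_sum_right Ye)
  have YN: "Y \<in> N u" using YF Yv by (simp add: normal_space_def orthogonal_def)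
  have "orth_proj (N u) X = Y"
  proof (rule orth_proj_eqI[OF subspace_normal_space YN])
    fix s assume s: "s \<in> N u"
    have "X - Y = ?T + (X \<bullet> F u) *\<^sub>R F u" by (simp add: Y_def)
    then show "(X - Y) \<bullet> s = 0"
      using N_F[OF s] N_D1[OF s]
        by (simp add: inner_commute[of _ s]) (simp add: inner_add_right inner_sum_right)
  qed
  then show ?thesis by (simp add: Y_def)
qed

lemma parseval:
  "X \<bullet> Y = (\<Sum>a\<in>UNIV. (X \<bullet> D1 u (e a)) * (Y \<bullet> D1 u (e a))) + (X \<bullet> F u) * (Y \<bullet> F u)
     + orth_proj (N u) X \<bullet> orth_proj (N u) Y"
proof -
  have "X \<bullet> Y = ((\<Sum>a\<in>UNIV. (X \<bullet> D1 u (e a)) *\<^sub>R D1 u (e a)) + (X \<bullet> F u) *\<^sub>R F u + orth_proj (N u) X) \<bullet> Y"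
    by (subst split_orth[of X]) simp
  also have "\<dots> = (\<Sum>a\<in>UNIV. (X \<bullet> D1 u (e a)) * (Y \<bullet> D1 u (e a))) + (X \<bullet> F u) * (Y \<bullet> F u)
     + orth_proj (N u) X \<bullet> Y"
    by (simp add: inner_commute[of _ Y]) (simp add: inner_add_right inner_sum_right)
  also have "orth_proj (N u) X \<bullet> Y = orth_proj (N u) X \<bullet> orth_proj (N u) Y"
    by (metis inner_commute orth_proj_in_orth subspace_normal_space)
  finally show ?thesis .
qed

end

section \<open>Christoffel symbols of the induced metric\<close>

lemma metric_inverse:
  assumes u: "u \<in> V"
  shows "matrix_inv (G u) ** G u = mat 1" "G u ** matrix_inv (G u) = mat 1"
proof -
  have "v = 0" if "G u *v v = 0" for v
  proof -
    have "D1 u v \<bullet> D1 u v = 0" using that by (simp add: metric u)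
    then have "D1 u v = D1 u 0" using linear_0[OF lin1[OF u]] by simp
    then show ?thesis using immersion[OF u] by (meson injD)
  qed
  then have "invertible (G u)"
    by (simp add: invertible_left_inverse matrix_left_invertible_ker)
  then show "matrix_inv (G u) ** G u = mat 1" "G u ** matrix_inv (G u) = mat 1"
    unfolding invertible_def matrix_inv_def by (metis (mono_tags, lifting) someI_ex)+
qed

lemma metric_entry: "u \<in> V \<Longrightarrow> G u $ i $ j = D1 u (ax i) \<bullet> D1 u (ax j)"
  by (simp add: metric matrix_vector_mult_basis column_def inner_axis')

lemma metric_has_derivative:
  assumes u: "u \<in> V"
  shows "((\<lambda>w. G w $ i $ j) has_derivative
    (\<lambda>v. D1 u (ax i) \<bullet> D2 u v (ax j) + D2 u v (ax i) \<bullet> D1 u (ax j))) (at u)"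
  by (rule has_derivative_transform_within_open[OF has_derivative_inner[OF hd2[OF u] hd2[OF u]] V u])
    (simp add: metric_entry)

lemma partial_metric:
  assumes u: "u \<in> V"
  shows "partial k (\<lambda>w. G w $ i $ j) u
    = D1 u (ax i) \<bullet> D2 u (ax k) (ax j) + D2 u (ax k) (ax i) \<bullet> D1 u (ax j)"
  unfolding partial_def frechet_derivative_at[OF metric_has_derivative[OF u], symmetric] ..

text \<open>Among the six terms of the three metric derivatives, four cancel by symmetry of second
  derivatives and two equal terms remain, which absorb the factor 1/2.\<close>

lemma christoffel_eq:
  assumes u: "u \<in> V"
  shows "christoffel G k i j u
    = (\<Sum>l\<in>UNIV. matrix_inv (G u) $ k $ l * (D2 u (ax i) (ax j) \<bullet> D1 u (ax l)))"
proof -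
  have "partial i (\<lambda>w. G w $ j $ l) u + partial j (\<lambda>w. G w $ i $ l) u - partial l (\<lambda>w. G w $ i $ j) u
     = 2 * (D2 u (ax i) (ax j) \<bullet> D1 u (ax l))" for l
    unfolding partial_metric[OF u] D2_sym[OF u, of "ax j" "ax i"] D2_sym[OF u, of "ax l" "ax i"]
      D2_sym[OF u, of "ax l" "ax j"]
    by (simp add: inner_commute)
  then show ?thesis
    by (simp add: christoffel_def sum_distrib_left)
qed

lemma christoffel_lower:
  assumes u: "u \<in> V"
  shows "(\<Sum>k\<in>UNIV. G u $ m $ k * christoffel G k i j u) = D2 u (ax i) (ax j) \<bullet> D1 u (ax m)"
proof -
  have "(\<chi> k. christoffel G k i j u) = matrix_inv (G u) *v (\<chi> l. D2 u (ax i) (ax j) \<bullet> D1 u (ax l))"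
    by (simp add: vec_eq_iff matrix_vector_mult_def christoffel_eq[OF u])
  then have "G u *v (\<chi> k. christoffel G k i j u) = (\<chi> l. D2 u (ax i) (ax j) \<bullet> D1 u (ax l))"
    by (simp add: matrix_vector_mul_assoc metric_inverse[OF u])
  from arg_cong[OF this, of "\<lambda>v. v $ m"] show ?thesis
    by (simp add: matrix_vector_mult_def)
qed

text \<open>Cramer's rule, applied to the linear system of \<open>christoffel_lower\<close>,
  presents the symbol as a quotient of determinants with differentiable entries, so the inverse
  matrix need not be differentiated.\<close>

lemma christoffel_differentiable:
  assumes u: "u \<in> V"
  shows "christoffel G k i j differentiable (at u)"
proof -
  \<comment> \<open>The metric matrix with column \<open>k\<close> replaced by the lowered
    symbols.\<close>
  let ?M = "\<lambda>w. \<chi> a b. if b = k then D2 w (ax i) (ax j) \<bullet> D1 w (ax a) else G w $ a $ b"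
  have nz: "det (G w) \<noteq> 0" if "w \<in> V" for w
    using metric_inverse[OF that] by (metis invertible_def invertible_det_nz)
  have eq: "christoffel G k i j w = det (?M w) / det (G w)" if w: "w \<in> V" for w
  proof -
    have "G w *v (\<chi> k. christoffel G k i j w) = (\<chi> a. D2 w (ax i) (ax j) \<bullet> D1 w (ax a))"
      by (simp add: vec_eq_iff matrix_vector_mult_def christoffel_lower[OF w])
    then have "(\<chi> k. christoffel G k i j w) = (\<chi> k. det (\<chi> a b. if b = k
        then (\<chi> a. D2 w (ax i) (ax j) \<bullet> D1 w (ax a)) $ a else G w $ a $ b) / det (G w))"
      using cramer[OF nz[OF w]] by blast
    from arg_cong[OF this, of "\<lambda>v. v $ k"] show ?thesis by (simp only: vec_lambda_beta)
  qed
  have G: "(\<lambda>w. G w $ a $ b) differentiable (at u)" for a b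
    using metric_has_derivative[OF u] differentiable_def by blast
  have D2d: "(\<lambda>w. D2 w v v') differentiable (at u)" for v v'
    by (intro smooth_on_differentiable[OF _ u] smooth_on_frechet_derivative F)
  have D1d: "(\<lambda>w. D1 w v) differentiable (at u)" for v
    by (intro smooth_on_differentiable[OF _ u] smooth_on_frechet_derivative F)
  have "(\<lambda>w. det (?M w)) differentiable (at u)"
  proof (rule det_differentiable)
    show "(\<lambda>w. ?M w $ a $ b) differentiable (at u)" for a b
      by (cases "b = k") (simp_all add: G D1d D2d)
  qed
  moreover have "(\<lambda>w. det (G w)) differentiable (at u)"
    by (intro det_differentiable G)
  ultimately have "(\<lambda>w. det (?M w) / det (G w)) differentiable (at u)"
    using nz[OF u] by (intro differentiable_divide)
  then show ?thesis
    unfolding differentiable_def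
    using has_derivative_transform_within_open[OF _ V u] eq by (metis (no_types, lifting))
qed

text \<open>Both sides of \<open>christoffel_lower\<close> are differentiated and the equation is
  solved for the term containing the derivative of the symbol. Keeping the index lowered avoids
  derivatives of the inverse metric.\<close>

lemma partial_christoffel_lower:
  assumes u: "u \<in> V"
  shows "(\<Sum>l\<in>UNIV. G u $ m $ l * partial i (christoffel G l j k) u) =
     frechet_derivative (\<lambda>w. D2 w (ax j) (ax k)) (at u) (ax i) \<bullet> D1 u (ax m)
     + D2 u (ax j) (ax k) \<bullet> D2 u (ax i) (ax m)
     - (\<Sum>l\<in>UNIV. (D1 u (ax m) \<bullet> D2 u (ax i) (ax l) + D2 u (ax i) (ax m) \<bullet> D1 u (ax l)) * christoffel G l j k u)"
proof -
  have A: "((\<lambda>w. \<Sum>l\<in>UNIV. G w $ m $ l * christoffel G l j k w) has_derivative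
     (\<lambda>v. \<Sum>l\<in>UNIV. G u $ m $ l * frechet_derivative (christoffel G l j k) (at u) v
       + (D1 u (ax m) \<bullet> D2 u v (ax l) + D2 u v (ax m) \<bullet> D1 u (ax l)) * christoffel G l j k u)) (at u)"
    by (intro has_derivative_sum has_derivative_mult metric_has_derivative[OF u])
      (use christoffel_differentiable[OF u] frechet_derivative_works in blast)
  have "((\<lambda>w. D2 w (ax j) (ax k) \<bullet> D1 w (ax m)) has_derivative
     (\<lambda>v. D2 u (ax j) (ax k) \<bullet> D2 u v (ax m)
        + frechet_derivative (\<lambda>w. D2 w (ax j) (ax k)) (at u) v \<bullet> D1 u (ax m))) (at u)"
    by (intro has_derivative_inner hd2[OF u] smooth_on_has_derivative[OF _ u]
        smooth_on_frechet_derivative F)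
  then have B: "((\<lambda>w. \<Sum>l\<in>UNIV. G w $ m $ l * christoffel G l j k w) has_derivative
     (\<lambda>v. D2 u (ax j) (ax k) \<bullet> D2 u v (ax m)
        + frechet_derivative (\<lambda>w. D2 w (ax j) (ax k)) (at u) v \<bullet> D1 u (ax m))) (at u)"
    by (rule has_derivative_transform_within_open[OF _ V u]) (simp add: christoffel_lower)
  have "(\<Sum>l\<in>UNIV. G u $ m $ l * partial i (christoffel G l j k) u
       + (D1 u (ax m) \<bullet> D2 u (ax i) (ax l) + D2 u (ax i) (ax m) \<bullet> D1 u (ax l)) * christoffel G l j k u)
     = D2 u (ax j) (ax k) \<bullet> D2 u (ax i) (ax m)
        + frechet_derivative (\<lambda>w. D2 w (ax j) (ax k)) (at u) (ax i) \<bullet> D1 u (ax m)"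
    using fun_cong[OF has_derivative_unique[OF A B], of "ax i"] by (simp add: partial_def)
  then show ?thesis by (simp add: sum.distrib algebra_simps)
qed

section \<open>Gauss equation and scalar curvature\<close>

context
  fixes u e
  assumes u: "u \<in> V" and e: "orthonormal_tangent_basis (G u) e"
begin

text \<open>The tangent part of \<open>F\<^sub>j\<^sub>k\<close> is \<open>\<Sum>\<^sub>l \<Gamma>\<^sup>l\<^sub>j\<^sub>k F\<^sub>l\<close>.\<close>

lemma christoffel_tangent:
  "(\<Sum>l\<in>UNIV. christoffel G l j k u * (D1 u (ax l) \<bullet> X))
    = (\<Sum>a\<in>UNIV. (D2 u (ax j) (ax k) \<bullet> D1 u (e a)) * (X \<bullet> D1 u (e a)))"
proof -
  let ?t = "\<chi> l. christoffel G l j k u"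
  have x: "w = (\<Sum>i\<in>UNIV. (w $ i) *\<^sub>R ax i)" for w :: "real^'n"
    by (simp add: vec_eq_iff axis_def if_distrib cong: if_cong)
  have D1x: "D1 u w = (\<Sum>i\<in>UNIV. (w $ i) *\<^sub>R D1 u (ax i))" for w
    by (subst x[of w]) (simp add: linear_sum[OF lin1[OF u]] linear_scale[OF lin1[OF u]])
  have "D1 u (ax m) \<bullet> D1 u ?t = D2 u (ax j) (ax k) \<bullet> D1 u (ax m)" for m
    using christoffel_lower[OF u, of m j k]
    by (subst D1x[of ?t]) (simp add: inner_sum_right metric_entry[OF u] mult.commute)
  then have t: "D1 u ?t \<bullet> D1 u w = D2 u (ax j) (ax k) \<bullet> D1 u w" for w
    by (simp add: D1x[of w] inner_sum_right) (simp add: inner_commute)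
  have "(\<Sum>l\<in>UNIV. christoffel G l j k u * (D1 u (ax l) \<bullet> X)) = D1 u ?t \<bullet> X"
    by (simp add: D1x[of ?t] inner_sum_left)
  also have "\<dots> = (\<Sum>a\<in>UNIV. (D1 u ?t \<bullet> D1 u (e a)) * (D1 u (e a) \<bullet> X))"
    by (subst frame_parseval_D1[OF u e]) (simp add: inner_sum_left)
  finally show ?thesis unfolding t by (simp add: inner_commute)
qed

text \<open>Third derivatives cancel by symmetry, and the terms \<open>?C\<close> cancel the
  quadratic Christoffel terms. What is left of the products of second derivatives, after removal of
  their tangential parts, splits by \<open>parseval\<close> into a radial part, giving the curvature
  of the sphere, and a normal part.\<close>

lemma gauss_equation:
  "(\<Sum>l\<in>UNIV. G u $ m $ l * riemann G l i j k u) =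
     (D1 u (ax j) \<bullet> D1 u (ax k)) * (D1 u (ax i) \<bullet> D1 u (ax m))
     - (D1 u (ax i) \<bullet> D1 u (ax k)) * (D1 u (ax j) \<bullet> D1 u (ax m))
     + II u (ax j) (ax k) \<bullet> II u (ax i) (ax m) - II u (ax i) (ax k) \<bullet> II u (ax j) (ax m)"
proof -
  let ?\<Gamma> = "\<lambda>l j k. christoffel G l j k u"
  let ?S = "\<lambda>i j k. \<Sum>l\<in>UNIV. ?\<Gamma> l j k * (D1 u (ax l) \<bullet> D2 u (ax i) (ax m))"
  let ?C = "\<lambda>i j k. \<Sum>r\<in>UNIV. ?\<Gamma> r j k * (D2 u (ax i) (ax r) \<bullet> D1 u (ax m))"
  have third: "frechet_derivative (\<lambda>w. D2 w (ax j) (ax k)) (at u) (ax i)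
      = frechet_derivative (\<lambda>w. D2 w (ax i) (ax k)) (at u) (ax j)"
    by (rule frechet_derivative_symmetric[OF V u smooth_on_frechet_derivative[OF F]])
  have P: "(\<Sum>l\<in>UNIV. G u $ m $ l * partial i (christoffel G l j k) u) =
     frechet_derivative (\<lambda>w. D2 w (ax j) (ax k)) (at u) (ax i) \<bullet> D1 u (ax m)
     + D2 u (ax j) (ax k) \<bullet> D2 u (ax i) (ax m) - ?C i j k - ?S i j k" for i j
    unfolding partial_christoffel_lower[OF u]
    by (simp add: distrib_right distrib_left sum.distrib inner_commute mult.commute)
  have Q: "(\<Sum>l\<in>UNIV. G u $ m $ l * (\<Sum>r\<in>UNIV. ?\<Gamma> r j k * ?\<Gamma> l i r)) = ?C i j k" for i j
  proof -
    have "(\<Sum>l\<in>UNIV. G u $ m $ l * (\<Sum>r\<in>UNIV. ?\<Gamma> r j k * ?\<Gamma> l i r))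
       = (\<Sum>r\<in>UNIV. \<Sum>l\<in>UNIV. ?\<Gamma> r j k * (G u $ m $ l * ?\<Gamma> l i r))"
      unfolding sum_distrib_left by (subst sum.swap) (simp add: mult_ac)
    also have "\<dots> = ?C i j k"
      by (simp add: sum_distrib_left[symmetric] christoffel_lower[OF u])
    finally show ?thesis .
  qed
  have "(\<Sum>l\<in>UNIV. G u $ m $ l * riemann G l i j k u) =
     (\<Sum>l\<in>UNIV. G u $ m $ l * partial i (christoffel G l j k) u)
     - (\<Sum>l\<in>UNIV. G u $ m $ l * partial j (christoffel G l i k) u)
     + (\<Sum>l\<in>UNIV. G u $ m $ l * (\<Sum>r\<in>UNIV. ?\<Gamma> r j k * ?\<Gamma> l i r))
     - (\<Sum>l\<in>UNIV. G u $ m $ l * (\<Sum>r\<in>UNIV. ?\<Gamma> r i k * ?\<Gamma> l j r))"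
    by (simp add: riemann_def sum_subtractf distrib_left right_diff_distrib sum.distrib)
  also have "\<dots> = D2 u (ax j) (ax k) \<bullet> D2 u (ax i) (ax m) - ?S i j k
      - (D2 u (ax i) (ax k) \<bullet> D2 u (ax j) (ax m) - ?S j i k)"
    unfolding P Q using third by simp
  also have "\<dots> = (D1 u (ax j) \<bullet> D1 u (ax k)) * (D1 u (ax i) \<bullet> D1 u (ax m))
     + II u (ax j) (ax k) \<bullet> II u (ax i) (ax m) -
     ((D1 u (ax i) \<bullet> D1 u (ax k)) * (D1 u (ax j) \<bullet> D1 u (ax m))
      + II u (ax i) (ax k) \<bullet> II u (ax j) (ax m))"
    using parseval[OF u e, of "D2 u (ax j) (ax k)" "D2 u (ax i) (ax m)"]
      parseval[OF u e, of "D2 u (ax i) (ax k)" "D2 u (ax j) (ax m)"]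
    by (simp only: christoffel_tangent D2_F[OF u] II_eq)
  finally show ?thesis by simp
qed

lemma scalar_curvature:
  "(\<Sum>j\<in>UNIV. \<Sum>k\<in>UNIV. matrix_inv (G u) $ j $ k * ricci G j k u) =
    (\<Sum>b\<in>UNIV. \<Sum>a\<in>UNIV. 1 - (if a = b then 1 else 0)
      + II u (e b) (e b) \<bullet> II u (e a) (e a) - II u (e a) (e b) \<bullet> II u (e a) (e b))"
proof -
  \<comment> \<open>The right side of the Gauss equation as a quadrilinear form, so that
    \<open>trace_eq\<close> applies first in the outer and then in the inner pair of
    arguments.\<close>
  define R where "R x y z w = (D1 u y \<bullet> D1 u z) * (D1 u x \<bullet> D1 u w)
     - (D1 u x \<bullet> D1 u z) * (D1 u y \<bullet> D1 u w)
     + II u y z \<bullet> II u x w - II u x z \<bullet> II u y w" for x y z w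
  note lin = linear_add[OF lin1[OF u]] linear_scale[OF lin1[OF u]]
    linear_add[OF II_lin[OF u]] linear_scale[OF II_lin[OF u]]
    linear_add[OF II_lin'[OF u]] linear_scale[OF II_lin'[OF u]]
  have Rlin: "linear (\<lambda>x. R x y z w)" "linear (\<lambda>y. R x y z w)" "linear (\<lambda>z. R x y z w)"
    "linear (\<lambda>w. R x y z w)" for x y z w
    unfolding R_def
    by (rule linearI; simp add: lin inner_add_left inner_add_right algebra_simps)+
  have riem: "riemann G i i j k u = (\<Sum>m\<in>UNIV. matrix_inv (G u) $ i $ m * R (ax i) (ax j) (ax k) (ax m))"
    for i j k
  proof -
    let ?v = "\<chi> l. riemann G l i j k u"
    have "G u *v ?v = (\<chi> m. R (ax i) (ax j) (ax k) (ax m))"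
      by (simp add: vec_eq_iff matrix_vector_mult_def gauss_equation R_def)
    then have "matrix_inv (G u) *v (\<chi> m. R (ax i) (ax j) (ax k) (ax m)) = ?v"
      by (metis matrix_vector_mul_assoc matrix_vector_mul_lid metric_inverse(1) u)
    from arg_cong[OF this, of "\<lambda>v. v $ i"] show ?thesis
      by (simp add: matrix_vector_mult_def)
  qed
  have ric: "ricci G j k u = (\<Sum>a\<in>UNIV. R (e a) (ax j) (ax k) (e a))" for j k
    unfolding ricci_def riem
    using trace_eq[OF u e, of "\<lambda>x w. R x (ax j) (ax k) w"] Rlin by simp
  have "(\<Sum>j\<in>UNIV. \<Sum>k\<in>UNIV. matrix_inv (G u) $ j $ k * ricci G j k u)
     = (\<Sum>b\<in>UNIV. \<Sum>a\<in>UNIV. R (e a) (e b) (e b) (e a))"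
    unfolding ric
    using trace_eq[OF u e, of "\<lambda>y z. \<Sum>a\<in>UNIV. R (e a) y z (e a)"] Rlin
    by (simp add: linear_compose_sum)
  also have "\<dots> = (\<Sum>b\<in>UNIV. \<Sum>a\<in>UNIV. 1 - (if a = b then 1 else 0)
      + II u (e b) (e b) \<bullet> II u (e a) (e a) - II u (e a) (e b) \<bullet> II u (e a) (e b))"
    by (intro sum.cong refl) (simp add: R_def frame_inner[OF u e] II_sym[OF u, of "e b" "e a" for a b])
  finally show ?thesis .
qed

end

text \<open>Ricci equation: with \<open>P\<close> the projection onto the normal spaces,
  \<open>R\<^sup>\<bottom>(v,w) = P [D\<^sub>v P, D\<^sub>w P] P\<close>, and \<open>D\<^sub>v P\<close> maps a normal vector to minus the image of its
  shape operator.\<close>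

context
  fixes u e
  assumes u: "u \<in> V" and e: "orthonormal_tangent_basis (G u) e"
    and smooth_proj: "\<And>\<xi>. smooth_on V (\<lambda>y. orth_proj (N y) \<xi>)"
begin

abbreviation "Q v \<xi> \<equiv> frechet_derivative (\<lambda>y. orth_proj (N y) \<xi>) (at u) v"

lemma proj_has_derivative: "((\<lambda>y. orth_proj (N y) \<xi>) has_derivative (\<lambda>v. Q v \<xi>)) (at u)"
  by (rule smooth_on_has_derivative[OF smooth_proj u])

text \<open>Each projection is self-adjoint, and this passes to the derivative of the
  family.\<close>

lemma Q_commute: "Q v \<xi> \<bullet> \<eta> = \<xi> \<bullet> Q v \<eta>"
proof -
  have "((\<lambda>y. orth_proj (N y) \<xi> \<bullet> \<eta>) has_derivative (\<lambda>v. Q v \<xi> \<bullet> \<eta>)) (at u)"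
    by (intro has_derivative_inner_left proj_has_derivative)
  moreover have "((\<lambda>y. \<xi> \<bullet> orth_proj (N y) \<eta>) has_derivative (\<lambda>v. \<xi> \<bullet> Q v \<eta>)) (at u)"
    by (intro has_derivative_inner_right proj_has_derivative)
  moreover have "(\<lambda>y. orth_proj (N y) \<xi> \<bullet> \<eta>) = (\<lambda>y. \<xi> \<bullet> orth_proj (N y) \<eta>)"
    by (simp add: orth_proj_commute subspace_normal_space)
  ultimately show ?thesis
    by (metis (no_types, lifting) has_derivative_unique)
qed

lemma Q_linear: "linear (Q v)"
proof (rule linearI)
  show "Q v (a + b) = Q v a + Q v b" for a b
    by (rule vector_eq_rdot[THEN iffD1]) (simp add: Q_commute inner_add_left)
  show "Q v (r *\<^sub>R a) = r *\<^sub>R Q v a" for r a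
    by (rule vector_eq_rdot[THEN iffD1]) (simp add: Q_commute)
qed

text \<open>The Leibniz rule for a varying projection applied to a varying vector. A basis expansion
  reduces it to projections of fixed vectors.\<close>

lemma proj_field_has_derivative:
  assumes X: "(X has_derivative X') (at u)"
  shows "((\<lambda>y. orth_proj (N y) (X y)) has_derivative
    (\<lambda>v. orth_proj (N u) (X' v) + Q v (X u))) (at u)"
proof -
  have 1: "orth_proj (N y) Z = (\<Sum>b\<in>Basis. (Z \<bullet> b) *\<^sub>R orth_proj (N y) b)" for y Z
    by (rule linear_basis_expand[OF linear_orth_proj[OF subspace_normal_space]])
  have 2: "Q v Z = (\<Sum>b\<in>Basis. (Z \<bullet> b) *\<^sub>R Q v b)" for v Z
    by (rule linear_basis_expand[OF Q_linear])
  have "((\<lambda>y. \<Sum>b\<in>Basis. (X y \<bullet> b) *\<^sub>R orth_proj (N y) b) has_derivative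
    (\<lambda>v. \<Sum>b\<in>Basis. (X u \<bullet> b) *\<^sub>R Q v b + (X' v \<bullet> b) *\<^sub>R orth_proj (N u) b)) (at u)"
    by (intro has_derivative_sum has_derivative_scaleR has_derivative_inner_left X proj_has_derivative)
  then show ?thesis
    unfolding 1[symmetric] by (simp add: sum.distrib 1[symmetric] 2[symmetric] add.commute)
qed

lemma Q_normal:
  assumes \<xi>: "\<xi> \<in> N u"
  shows "orth_proj (N u) (Q v \<xi>) = 0" "Q v \<xi> \<bullet> F u = 0" "Q v \<xi> \<bullet> D1 u w = - (\<xi> \<bullet> II u v w)"
proof -
  have A: "((\<lambda>y. orth_proj (N y) (orth_proj (N y) \<xi>)) has_derivative
    (\<lambda>v. orth_proj (N u) (Q v \<xi>) + Q v (orth_proj (N u) \<xi>))) (at u)"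
    by (rule proj_field_has_derivative[OF proj_has_derivative])
  \<comment> \<open>Differentiating idempotence of the projections: on a normal vector the term
    \<open>Q v \<xi>\<close> occurs on both sides, and its normal part must vanish.\<close>
  have B: "(\<lambda>y. orth_proj (N y) (orth_proj (N y) \<xi>)) = (\<lambda>y. orth_proj (N y) \<xi>)"
    by (simp add: orth_proj_id orth_proj_in_orth subspace_normal_space)
  from fun_cong[OF has_derivative_unique[OF A[unfolded B] proj_has_derivative[of \<xi>]], of v]
  show "orth_proj (N u) (Q v \<xi>) = 0"
    by (simp add: orth_proj_id[OF subspace_normal_space \<xi>])
  have "((\<lambda>y. orth_proj (N y) \<xi> \<bullet> F y) has_derivative
      (\<lambda>v. orth_proj (N u) \<xi> \<bullet> D1 u v + Q v \<xi> \<bullet> F u)) (at u)"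
    by (intro has_derivative_inner proj_has_derivative hd1[OF u])
  from has_derivative_const_on_open[OF V u this, of 0 v]
  show "Q v \<xi> \<bullet> F u = 0"
    using N_F[OF orth_proj_in_orth(1)[OF subspace_normal_space]]
    by (simp add: orth_proj_id[OF subspace_normal_space \<xi>] N_D1[OF \<xi>])
  have "((\<lambda>y. orth_proj (N y) \<xi> \<bullet> D1 y w) has_derivative
      (\<lambda>v. orth_proj (N u) \<xi> \<bullet> D2 u v w + Q v \<xi> \<bullet> D1 u w)) (at u)"
    by (intro has_derivative_inner proj_has_derivative hd2[OF u])
  from has_derivative_const_on_open[OF V u this, of 0 v]
  show "Q v \<xi> \<bullet> D1 u w = - (\<xi> \<bullet> II u v w)"
    using N_D1[OF orth_proj_in_orth(1)[OF subspace_normal_space]]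
    by (simp add: orth_proj_id[OF subspace_normal_space \<xi>] inner_commute[of \<xi>] II_inner[OF \<xi>])
qed

text \<open>Second derivatives of the projected field are symmetric in \<open>v\<close> and
  \<open>w\<close> and drop out of the commutator. The surviving products of \<open>Q\<close> terms
  are purely tangential by \<open>Q_normal\<close>, so \<open>parseval\<close> reduces them to sums
  over the frame.\<close>

lemma ricci_equation:
  assumes \<xi>: "\<xi> \<in> N u" and \<eta>: "\<eta> \<in> N u"
  shows "normal_curvature F u v w \<xi> \<bullet> \<eta> =
    (\<Sum>a\<in>UNIV. (\<xi> \<bullet> II u w (e a)) * (\<eta> \<bullet> II u v (e a)))
    - (\<Sum>a\<in>UNIV. (\<xi> \<bullet> II u v (e a)) * (\<eta> \<bullet> II u w (e a)))"
proof -
  define X where "X w y = frechet_derivative (\<lambda>y. orth_proj (N y) \<xi>) (at y) w" for w y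
  have X: "(X w has_derivative (\<lambda>v. frechet_derivative (X w) (at u) v)) (at u)" for w
    unfolding X_def by (intro smooth_on_has_derivative[OF _ u] smooth_on_frechet_derivative smooth_proj)
  have nc: "normal_conn F w (\<lambda>y. orth_proj (N y) \<xi>) = (\<lambda>y. orth_proj (N y) (X w y))" for w
    by (simp add: normal_conn_eq[abs_def] X_def)
  have half: "normal_conn F v (normal_conn F w (\<lambda>y. orth_proj (N y) \<xi>)) u \<bullet> \<eta>
      = frechet_derivative (X w) (at u) v \<bullet> \<eta> + Q w \<xi> \<bullet> Q v \<eta>" for v w
  proof -
    have "frechet_derivative (\<lambda>y. orth_proj (N y) (X w y)) (at u) v
      = orth_proj (N u) (frechet_derivative (X w) (at u) v) + Q v (X w u)"
      using fun_cong[OF frechet_derivative_at[OF proj_field_has_derivative[OF X]], of w v] by simp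
    then show ?thesis
      by (simp add: normal_conn_eq[of F v] nc orth_proj_in_orth subspace_normal_space \<eta> inner_add_left)
        (simp add: Q_commute X_def)
  qed
  have sym: "frechet_derivative (X w) (at u) v = frechet_derivative (X v) (at u) w"
    unfolding X_def by (rule frechet_derivative_symmetric[OF V u smooth_proj])
  have "Q w \<xi> \<bullet> Q v \<eta> = (\<Sum>a\<in>UNIV. (\<xi> \<bullet> II u w (e a)) * (\<eta> \<bullet> II u v (e a)))" for v w
    unfolding parseval[OF u e, of "Q w \<xi>" "Q v \<eta>"]
    by (simp only: Q_normal[OF \<xi>] Q_normal[OF \<eta>]) simp
  then show ?thesis
    unfolding normal_curvature_def Let_def inner_diff_left half sym by simp
qed

end

end

section \<open>The Wintgen equality from an adapted frame\<close>

lemma orthonormal_parseval: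
  fixes B :: "'a::euclidean_space set"
  assumes B: "orthonormal_basis_of S B" and x: "x \<in> S"
  shows "(\<Sum>b\<in>B. (x \<bullet> b) * (y \<bullet> b)) = x \<bullet> y"
proof -
  have fin: "finite B"
    using B pairwise_orthogonal_imp_finite by (auto simp: orthonormal_basis_of_def)
  have "x = (\<Sum>b\<in>B. (x \<bullet> b) *\<^sub>R b)"
    using orthonormal_basis_expand[of B x] B x fin by (auto simp: orthonormal_basis_of_def)
  then have "x \<bullet> y = (\<Sum>b\<in>B. (x \<bullet> b) *\<^sub>R b) \<bullet> y" by simp
  also have "\<dots> = (\<Sum>b\<in>B. (x \<bullet> b) * (y \<bullet> b))"
    by (simp add: inner_sum_left inner_commute[of y])
  finally show ?thesis by simp
qed

text \<open>Lagrange's identity for the squared norm of the bivector of \<open>x\<close> and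
  \<open>y\<close>. It is used once in the tangent space and once in the normal space.\<close>

lemma sum_wedge_square:
  fixes x y :: "'i \<Rightarrow> real"
  shows "(\<Sum>i\<in>I. \<Sum>j\<in>I. (x i * y j - y i * x j)\<^sup>2)
    = 2 * ((\<Sum>i\<in>I. x i * x i) * (\<Sum>i\<in>I. y i * y i) - (\<Sum>i\<in>I. x i * y i)\<^sup>2)"
proof -
  have "(\<Sum>i\<in>I. \<Sum>j\<in>I. (x i * y j - y i * x j)\<^sup>2)
    = (\<Sum>i\<in>I. \<Sum>j\<in>I. (x i * x i) * (y j * y j)) + (\<Sum>i\<in>I. \<Sum>j\<in>I. (y i * y i) * (x j * x j))
      - 2 * (\<Sum>i\<in>I. \<Sum>j\<in>I. (x i * y i) * (x j * y j))"
    by (simp add: sum.distrib[symmetric] sum_subtractf[symmetric] sum_distrib_left power2_eq_square algebra_simps)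
  then show ?thesis
    by (simp add: sum_product[symmetric] power2_eq_square)
qed

text \<open>The second fundamental form has \<open>e 1\<close> in its kernel and is trace-free on
  the plane of \<open>e 2\<close> and \<open>e 3\<close>. The conditions \<open>st\<close> say that
  the curvature ellipse of that plane is a circle.\<close>

locale wintgen_frame = sphere_immersion V F G
  for V :: "(real^3) set" and F :: "real^3 \<Rightarrow> real^'m::finite" and G +
  fixes u e \<sigma> \<tau>
  assumes u: "u \<in> V" and e: "orthonormal_tangent_basis (G u) e"
    and smooth_proj: "\<And>\<xi>. smooth_on V (\<lambda>y. orth_proj (N y) \<xi>)"
    and st: "\<sigma> \<bullet> \<tau> = 0" "\<tau> \<bullet> \<tau> = \<sigma> \<bullet> \<sigma>"
    and II1: "\<And>a. II u (e 1) (e a) = 0"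
    and II2: "II u (e 2) (e 2) = \<sigma>" "II u (e 2) (e 3) = \<tau>" "II u (e 3) (e 3) = - \<sigma>"
begin

lemma II_frame: "II u (e a) (e 1) = 0" "II u (e 3) (e 2) = \<tau>"
  using II1 II2 II_sym[OF u] by metis+

lemma minimal: "mean_curvature G F u = 0"
proof -
  have "(\<Sum>i\<in>UNIV. \<Sum>j\<in>UNIV. matrix_inv (G u) $ i $ j *\<^sub>R II u (ax i) (ax j)) = (\<Sum>a\<in>UNIV. II u (e a) (e a))"
    by (rule trace_eq[OF u e II_lin[OF u] II_lin'[OF u]])
  then show ?thesis
    by (simp add: mean_curvature_def mean_curvature_vector_def sum_3 II1 II2)
qed

text \<open>The sphere contributes 6 from the ordered pairs of distinct frame vectors, the trace
  term vanishes, and the squared norm of the second fundamental form is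
  \<open>4 * (\<sigma> \<bullet> \<sigma>)\<close>.\<close>

lemma scalar: "normalized_scalar_curvature G u = 1 - 4 * (\<sigma> \<bullet> \<sigma>) / 6"
  unfolding normalized_scalar_curvature_def scalar_curvature[OF u e]
  by (simp add: sum_3 II1 II2 II_frame st)

lemma II_component:
  "II u v (e 1) = 0"
  "II u v (e 2) = (D1 u v \<bullet> D1 u (e 2)) *\<^sub>R \<sigma> + (D1 u v \<bullet> D1 u (e 3)) *\<^sub>R \<tau>"
  "II u v (e 3) = (D1 u v \<bullet> D1 u (e 2)) *\<^sub>R \<tau> - (D1 u v \<bullet> D1 u (e 3)) *\<^sub>R \<sigma>"
proof -
  have "II u v w = (\<Sum>a\<in>UNIV. (D1 u v \<bullet> D1 u (e a)) *\<^sub>R II u (e a) w)" for w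
    by (subst frame_expand[OF u e, of v]) (simp add: linear_sum[OF II_lin[OF u]] linear_scale[OF II_lin[OF u]])
  then show "II u v (e 1) = 0"
    "II u v (e 2) = (D1 u v \<bullet> D1 u (e 2)) *\<^sub>R \<sigma> + (D1 u v \<bullet> D1 u (e 3)) *\<^sub>R \<tau>"
    "II u v (e 3) = (D1 u v \<bullet> D1 u (e 2)) *\<^sub>R \<tau> - (D1 u v \<bullet> D1 u (e 3)) *\<^sub>R \<sigma>"
    by (simp_all add: sum_3 II1 II2 II_frame)
qed

text \<open>The normal curvature is decomposable: a multiple of the bivector of \<open>e 2\<close>,
  \<open>e 3\<close> tensored with the bivector of \<sigma> and \<tau>.\<close>

lemma normal_curvature_frame:
  assumes "\<xi> \<in> N u" "\<eta> \<in> N u"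
  shows "normal_curvature F u v w \<xi> \<bullet> \<eta> =
    2 * ((D1 u w \<bullet> D1 u (e 2)) * (D1 u v \<bullet> D1 u (e 3)) - (D1 u w \<bullet> D1 u (e 3)) * (D1 u v \<bullet> D1 u (e 2)))
      * ((\<sigma> \<bullet> \<xi>) * (\<tau> \<bullet> \<eta>) - (\<tau> \<bullet> \<xi>) * (\<sigma> \<bullet> \<eta>))"
  unfolding ricci_equation[OF u e smooth_proj assms] sum_3 II_component
  by (simp add: inner_add_right inner_diff_right inner_commute[of \<xi>] inner_commute[of \<eta>]) (simp add: algebra_simps)

text \<open>The fourfold sum factors into two bivector norms, 2 and
  \<open>2 * (\<sigma> \<bullet> \<sigma>)\<^sup>2\<close>, with the factor 4 from squaring the
  coefficient. Neither norm depends on the bases, so the bases picked by choice can be unrelated to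
  the adapted frame.\<close>

lemma normal_norm: "normal_curvature_norm G F u = 4 * (\<sigma> \<bullet> \<sigma>)"
proof -
  define e' where "e' = (SOME e. orthonormal_tangent_basis (G u) e)"
  define B where "B = (SOME B. orthonormal_basis_of (N u) B)"
  have e': "orthonormal_tangent_basis (G u) e'"
    unfolding e'_def by (rule someI[of _ e]) (rule e)
  have "\<exists>B. orthonormal_basis_of (N u) B"
    using orthonormal_basis_subspace[OF subspace_normal_space[of F u]]
    by (metis orthonormal_basis_of_def)
  then have B: "orthonormal_basis_of (N u) B" unfolding B_def by (rule someI_ex)
  have BN: "b \<in> N u" if "b \<in> B" for b
    using B that span_base by (auto simp: orthonormal_basis_of_def)
  have \<sigma>: "\<sigma> \<in> N u" "\<tau> \<in> N u" using II2 II_N by metis+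
  have sB: "(\<Sum>a\<in>B. \<Sum>b\<in>B. ((\<sigma> \<bullet> a) * (\<tau> \<bullet> b) - (\<tau> \<bullet> a) * (\<sigma> \<bullet> b))\<^sup>2) = 2 * (\<sigma> \<bullet> \<sigma>)\<^sup>2"
    unfolding sum_wedge_square orthonormal_parseval[OF B \<sigma>(1)] orthonormal_parseval[OF B \<sigma>(2)]
    by (simp add: st power2_eq_square)
  have pars: "(\<Sum>i\<in>UNIV. (D1 u (e' i) \<bullet> D1 u v) * (D1 u (e' i) \<bullet> D1 u w)) = D1 u v \<bullet> D1 u w" for v w
  proof -
    have "orth_proj (N u) (D1 u v) = 0"
      by (rule orth_proj_eqI[OF subspace_normal_space subspace_0[OF subspace_normal_space]])
        (simp add: inner_commute N_D1)
    then show ?thesis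
      using parseval[OF u e', of "D1 u v" "D1 u w"] F_orth[OF u]
      by (simp add: inner_commute)
  qed
  have se: "(\<Sum>i\<in>UNIV. \<Sum>j\<in>UNIV. ((D1 u (e' i) \<bullet> D1 u (e 2)) * (D1 u (e' j) \<bullet> D1 u (e 3))
      - (D1 u (e' i) \<bullet> D1 u (e 3)) * (D1 u (e' j) \<bullet> D1 u (e 2)))\<^sup>2) = 2"
    unfolding sum_wedge_square pars frame_inner[OF u e] by simp
  have "(\<Sum>i\<in>UNIV. \<Sum>j\<in>UNIV. \<Sum>a\<in>B. \<Sum>b\<in>B. (normal_curvature F u (e' i) (e' j) a \<bullet> b)\<^sup>2)
    = (\<Sum>i\<in>UNIV. \<Sum>j\<in>UNIV. \<Sum>a\<in>B. \<Sum>b\<in>B. 4 * (((D1 u (e' i) \<bullet> D1 u (e 2)) * (D1 u (e' j) \<bullet> D1 u (e 3))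
      - (D1 u (e' i) \<bullet> D1 u (e 3)) * (D1 u (e' j) \<bullet> D1 u (e 2)))\<^sup>2 *
       ((\<sigma> \<bullet> a) * (\<tau> \<bullet> b) - (\<tau> \<bullet> a) * (\<sigma> \<bullet> b))\<^sup>2))"
    by (intro sum.cong refl) (simp add: normal_curvature_frame BN power2_eq_square algebra_simps)
  also have "\<dots> = 4 * (2 * (2 * (\<sigma> \<bullet> \<sigma>)\<^sup>2))"
    by (simp only: sum_distrib_left[symmetric] sB sum_distrib_right[symmetric] se)
  also have "\<dots> = (4 * (\<sigma> \<bullet> \<sigma>))\<^sup>2" by (simp add: power_mult_distrib)
  finally have "(\<Sum>i\<in>UNIV. \<Sum>j\<in>UNIV. \<Sum>a\<in>B. \<Sum>b\<in>B. (normal_curvature F u (e' i) (e' j) a \<bullet> b)\<^sup>2)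
    = (4 * (\<sigma> \<bullet> \<sigma>))\<^sup>2" .
  then show ?thesis
    unfolding normal_curvature_norm_def Let_def e'_def[symmetric] B_def[symmetric]
    by (simp add: real_sqrt_mult)
qed

lemma wintgen:
  "normalized_scalar_curvature G u = 1 + (mean_curvature G F u)\<^sup>2 - normalized_normal_curvature G F u"
  by (simp add: scalar minimal normalized_normal_curvature_def normal_norm)

end

section \<open>The link of the Fermat cone\<close>

text \<open>The complex bilinear product rather than the Hermitian one: derivatives of polynomials
  are bilinear in it. The Hermitian product is \<open>cdot a (cvec b)\<close>, whose real part is
  the euclidean inner product.\<close>

definition cdot :: "complex^'k::finite \<Rightarrow> complex^'k \<Rightarrow> complex" where
  "cdot a b = (\<Sum>i\<in>UNIV. a $ i * b $ i)"

definition cvec :: "complex^'k::finite \<Rightarrow> complex^'k" where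
  "cvec a = (\<chi> i. cnj (a $ i))"

lemma cdot_lin:
  "cdot (a + b) c = cdot a c + cdot b c" "cdot (a - b) c = cdot a c - cdot b c"
  "cdot (k *s a) c = k * cdot a c" "cdot a (k *s c) = k * cdot a c"
  "cdot (r *\<^sub>R a) c = r *\<^sub>R cdot a c" "cdot 0 c = 0"
  by (simp_all add: cdot_def distrib_right left_diff_distrib sum.distrib sum_subtractf sum_distrib_left
      mult.assoc mult.left_commute scaleR_right.sum)

lemma inner_cvec: "a \<bullet> b = Re (cdot a (cvec b))"
  by (simp add: inner_vec_def cdot_def cvec_def inner_complex_def)

lemma cdot_commute: "cdot a b = cdot b a"
  by (simp add: cdot_def mult.commute)

lemma cvec_cvec [simp]: "cvec (cvec a) = a"
  by (simp add: cvec_def vec_eq_iff)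

lemma cvec_smult: "cvec (k *s a) = cnj k *s cvec a"
  by (simp add: cvec_def vec_eq_iff)

lemma cdot_cvec_cvec: "cdot (cvec a) (cvec b) = cnj (cdot a b)"
  by (simp add: cdot_def cvec_def cnj_sum)

lemma cdot_self: "cdot a (cvec a) = of_real (a \<bullet> a)"
  by (simp add: complex_eq_iff inner_cvec) (simp add: cdot_def cvec_def algebra_simps)

lemma inner_smult_i: "(\<i> *s a) \<bullet> (\<i> *s b) = a \<bullet> b" "(\<i> *s a) \<bullet> a = 0" "a \<bullet> (\<i> *s a) = 0"
  "(\<i> *s a) \<bullet> b = - (a \<bullet> (\<i> *s b))"
  unfolding inner_cvec cvec_smult cdot_lin by (simp_all add: cdot_self)

text \<open>\<open>J\<close> identifies the complex 3-space isometrically with the hyperplane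
  orthogonal to \<nu>; its adjoint \<open>K\<close> serves as the coordinate map back.\<close>

locale fermat =
  fixes d :: nat and J :: "complex^3 \<Rightarrow> real^7" and \<nu> :: "real^7"
  assumes d: "d \<ge> 2" and linJ: "linear J" and normJ: "norm (J z) = norm z"
    and rangeJ: "range J = {v. v \<bullet> \<nu> = 0}" and \<nu>: "\<nu> \<bullet> \<nu> = 1"
begin

definition cone :: "(complex^3) set" where "cone = {z. (\<Sum>i\<in>UNIV. z $ i ^ d) = 0}"

definition link :: "(real^7) set" where "link = J ` (cone \<inter> {z. z \<bullet> z = 1})"

abbreviation "K \<equiv> adjoint J"

text \<open>The complex gradient of the Fermat polynomial without the factor \<open>d\<close>; its
  conjugate is a Hermitian normal of the cone.\<close>

definition q :: "complex^3 \<Rightarrow> complex^3" where "q z = (\<chi> i. z $ i ^ (d - 1))"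

lemma J_inner: "J a \<bullet> J b = a \<bullet> b"
  by (simp add: dot_norm normJ linear_add[OF linJ, symmetric])

lemma linK: "linear K"
  by (rule adjoint_linear[OF linJ])

lemma KJ [simp]: "K (J z) = z"
  by (rule vector_eq_rdot[THEN iffD1]) (simp add: adjoint_clauses[OF linJ] J_inner)

lemma J_\<nu> [simp]: "J z \<bullet> \<nu> = 0"
  using rangeJ by blast

lemma JK: "v \<bullet> \<nu> = 0 \<Longrightarrow> J (K v) = v"
  using rangeJ by (metis (mono_tags, lifting) KJ mem_Collect_eq rangeE)

lemma K_\<nu>: "K \<nu> = 0"
  by (rule vector_eq_rdot[THEN iffD1]) (simp add: adjoint_clauses[OF linJ] inner_commute[of \<nu>])

lemma JK_split: "v = J (K v) + (v \<bullet> \<nu>) *\<^sub>R \<nu>"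
proof -
  have "J (K (v - (v \<bullet> \<nu>) *\<^sub>R \<nu>)) = v - (v \<bullet> \<nu>) *\<^sub>R \<nu>"
    by (rule JK) (simp add: inner_diff_left \<nu>)
  moreover have "K (v - (v \<bullet> \<nu>) *\<^sub>R \<nu>) = K v"
    by (simp add: linear_diff[OF linK] linear_scale[OF linK] K_\<nu>)
  ultimately show ?thesis by (metis diff_add_cancel)
qed

lemma cdot_q: "cdot z (q z) = (\<Sum>i\<in>UNIV. z $ i ^ d)"
  using d by (simp add: cdot_def q_def power_eq_if)

lemma q_nonzero: "z \<noteq> 0 \<Longrightarrow> q z \<noteq> 0"
  by (auto simp: vec_eq_iff q_def)

text \<open>The tangent space of the link: the kernel of the differential of the polynomial, with
  the radial direction removed.\<close>

definition T :: "complex^3 \<Rightarrow> (complex^3) set" where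
  "T z = {X. X \<bullet> z = 0 \<and> cdot X (q z) = 0}"

lemma T_subspace: "subspace (T z)"
  by (auto simp: subspace_def T_def cdot_lin inner_add_left)

text \<open>The space is the orthogonal complement in real dimension 6 of \<open>z\<close>, the
  Hermitian normal and \<open>\<i>\<close> times that normal. These are nonzero and mutually
  orthogonal, the first against the others by the equation of the cone.\<close>

lemma T_dim:
  assumes z: "z \<in> cone" "z \<bullet> z = 1"
  shows "dim (T z) = 3"
proof -
  let ?n = "cvec (q z)"
  let ?B = "{z, ?n, \<i> *s ?n}"
  have zq: "cdot z (q z) = 0" using z by (simp add: cdot_q cone_def)
  have o: "z \<bullet> ?n = 0" "z \<bullet> (\<i> *s ?n) = 0" "?n \<bullet> (\<i> *s ?n) = 0"
    unfolding inner_cvec cvec_smult cdot_lin cvec_cvec zq by (simp_all add: cdot_commute[of _ "q z"] cdot_self)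
  have z0: "z \<noteq> 0" using z by auto
  have nz: "z \<noteq> 0" "?n \<noteq> 0" "\<i> *s ?n \<noteq> 0"
    using z0 q_nonzero[OF z0] by (auto simp: cvec_def vec_eq_iff)
  have pw: "pairwise orthogonal ?B"
    using o by (auto simp: pairwise_def orthogonal_def inner_commute)
  have dist: "z \<noteq> ?n" "z \<noteq> \<i> *s ?n" "?n \<noteq> \<i> *s ?n"
    using o nz by (metis inner_eq_zero_iff)+
  have "independent ?B"
    by (rule pairwise_orthogonal_independent[OF pw]) (use nz in auto)
  then have "dim (span ?B) = 3"
    using dist by (simp add: dim_eq_card_independent)
  moreover have "T z = {y \<in> UNIV. \<forall>x\<in>span ?B. orthogonal x y}"
  proof -
    have "X \<bullet> ?n = Re (cdot X (q z))" "X \<bullet> (\<i> *s ?n) = Im (cdot X (q z))" for X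
      unfolding inner_cvec cvec_smult cvec_cvec cdot_lin by simp_all
    then have "X \<in> T z \<longleftrightarrow> (\<forall>x\<in>?B. orthogonal X x)" for X
      by (auto simp: T_def orthogonal_def complex_eq_iff)
    moreover have "(\<forall>x\<in>span ?B. orthogonal x X) \<longleftrightarrow> (\<forall>x\<in>?B. orthogonal X x)" for X
      using span_base[of _ ?B] orthogonal_to_span[of _ ?B X] by (meson orthogonal_commute)
    ultimately show ?thesis by blast
  qed
  ultimately show ?thesis
    using dim_subspace_orthogonal_to_vectors[of "span ?B" UNIV] by simp
qed

text \<open>The volume form \<open>\<alpha> \<and> \<Omega>\<close> of the link: contact form times transverse Kaehler form.\<close>

definition vol :: "complex^3 \<Rightarrow> complex^3 \<Rightarrow> complex^3 \<Rightarrow> complex^3 \<Rightarrow> real" where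
  "vol z X Y W = ((\<i> *s z) \<bullet> X) * ((\<i> *s Y) \<bullet> W) + ((\<i> *s z) \<bullet> Y) * ((\<i> *s W) \<bullet> X)
     + ((\<i> *s z) \<bullet> W) * ((\<i> *s X) \<bullet> Y)"

text \<open>\<open>vol z\<close> is trilinear and alternating, so a change of the three arguments by
  a matrix multiplies it by the determinant.\<close>

lemma vol_linear:
  fixes D :: "real^3 \<Rightarrow> complex^3" and B :: "real^3^3"
  assumes D: "linear D"
  shows "vol z (D (B *v axis 1 1)) (D (B *v axis 2 1)) (D (B *v axis 3 1))
    = det B * vol z (D (axis 1 1)) (D (axis 2 1)) (D (axis 3 1))"
proof -
  have B: "D (B *v axis j 1) = (B $ 1 $ j) *\<^sub>R D (axis 1 1) + (B $ 2 $ j) *\<^sub>R D (axis 2 1)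
     + (B $ 3 $ j) *\<^sub>R D (axis 3 1)" for j
  proof -
    have "B *v axis j 1 = (B $ 1 $ j) *\<^sub>R axis 1 1 + (B $ 2 $ j) *\<^sub>R axis 2 1 + (B $ 3 $ j) *\<^sub>R axis 3 1"
      by (simp add: matrix_vector_mult_basis column_def vec_eq_iff forall_3) (simp add: axis_def)
    then show ?thesis by (simp add: linear_add[OF D] linear_scale[OF D])
  qed
  define X where "X = D (axis 1 1)"
  define Y where "Y = D (axis 2 1)"
  define W where "W = D (axis 3 1)"
  define \<Omega> where "\<Omega> a b = (\<i> *s a) \<bullet> (b :: complex^3)" for a b
  have si: "\<i> *s (a + b) = \<i> *s a + \<i> *s b" "\<i> *s (r *\<^sub>R a) = r *\<^sub>R (\<i> *s a)" for a b :: "complex^3" and r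
    by (simp_all add: vec_eq_iff distrib_left)
  have \<Omega>: "\<Omega> (a + b) c = \<Omega> a c + \<Omega> b c" "\<Omega> c (a + b) = \<Omega> c a + \<Omega> c b"
    "\<Omega> (r *\<^sub>R a) c = r * \<Omega> a c" "\<Omega> c (r *\<^sub>R a) = r * \<Omega> c a" "\<Omega> a a = 0" for a b c r
    by (simp_all add: \<Omega>_def si inner_add_left inner_add_right inner_smult_i(2))
  have anti: "\<Omega> Y X = - \<Omega> X Y" "\<Omega> W X = - \<Omega> X W" "\<Omega> W Y = - \<Omega> Y W"
    unfolding \<Omega>_def by (metis inner_commute inner_smult_i(4))+
  show ?thesis
    unfolding vol_def B X_def[symmetric] Y_def[symmetric] W_def[symmetric] \<Omega>_def[symmetric] det_3
    unfolding \<Omega> anti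
    by (simp add: algebra_simps)
qed

lemma vol_frame:
  assumes "z \<bullet> z = 1" "w \<bullet> w = 1" "z \<bullet> w = 0" "(\<i> *s z) \<bullet> w = 0"
  shows "vol z (\<i> *s z) w (\<i> *s w) = 1"
  using assms by (simp add: vol_def inner_smult_i)

end

section \<open>Normal bundle and second fundamental form of the link\<close>

locale fermat_immersion = fermat d J \<nu> + sphere_immersion V F G
  for d J \<nu> V and F :: "real^3 \<Rightarrow> real^7" and G +
  assumes FM: "u \<in> V \<Longrightarrow> F u \<in> link"
begin

abbreviation "\<Phi> u \<equiv> K (F u)"

lemma \<Phi>_cone: "u \<in> V \<Longrightarrow> \<Phi> u \<in> cone" and \<Phi>_unit: "u \<in> V \<Longrightarrow> \<Phi> u \<bullet> \<Phi> u = 1"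
  and F_\<nu>: "u \<in> V \<Longrightarrow> F u \<bullet> \<nu> = 0"
  using FM[of u] by (auto simp: link_def)

lemma J\<Phi>: "u \<in> V \<Longrightarrow> J (\<Phi> u) = F u"
  by (simp add: JK F_\<nu>)

lemma D1_\<nu>: "u \<in> V \<Longrightarrow> D1 u v \<bullet> \<nu> = 0"
  by (rule has_derivative_const_on_open[OF V _ has_derivative_inner_left[OF hd1] F_\<nu>])

lemma D2_\<nu>: "u \<in> V \<Longrightarrow> D2 u v w \<bullet> \<nu> = 0"
  by (rule has_derivative_const_on_open[OF V _ has_derivative_inner_left[OF hd2] D1_\<nu>])

abbreviation "X u v \<equiv> K (D1 u v)"

lemma linX: "u \<in> V \<Longrightarrow> linear (X u)"
  using linear_compose[OF lin1 linK] by (simp add: o_def)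

lemma \<Phi>_has_derivative: "u \<in> V \<Longrightarrow> ((\<lambda>u. \<Phi> u $ i) has_derivative (\<lambda>v. X u v $ i)) (at u)"
  using bounded_linear.has_derivative[OF bounded_linear_compose[OF bounded_linear_vec_nth[of i]
        linear_conv_bounded_linear[THEN iffD1, OF linK]] hd1[of u]] .

lemma X_has_derivative:
  "u \<in> V \<Longrightarrow> ((\<lambda>y. X y w $ i) has_derivative (\<lambda>v. K (D2 u v w) $ i)) (at u)"
  using bounded_linear.has_derivative[OF bounded_linear_compose[OF bounded_linear_vec_nth[of i]
        linear_conv_bounded_linear[THEN iffD1, OF linK]] hd2[of u w]] .

lemma X_T: "u \<in> V \<Longrightarrow> X u v \<in> T (\<Phi> u)"
proof -
  assume u: "u \<in> V"
  have "X u v \<bullet> \<Phi> u = 0"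
    using F_orth[OF u, of v] J\<Phi>[OF u] JK[OF D1_\<nu>[OF u, of v]] J_inner by metis
  moreover have "((\<lambda>u. \<Sum>i\<in>UNIV. \<Phi> u $ i ^ d) has_derivative
      (\<lambda>v. \<Sum>i\<in>UNIV. of_nat d * X u v $ i * \<Phi> u $ i ^ (d - 1))) (at u)"
    by (intro has_derivative_sum has_derivative_power \<Phi>_has_derivative u)
  from has_derivative_const_on_open[OF V u this, of 0 v]
  have "of_nat d * cdot (X u v) (q (\<Phi> u)) = 0"
    using \<Phi>_cone by (simp add: cone_def cdot_def q_def sum_distrib_left mult_ac)
  then have "cdot (X u v) (q (\<Phi> u)) = 0" using d by simp
  ultimately show ?thesis by (simp add: T_def)
qed

text \<open>Tangency to the cone is differentiated again: the component along the gradient is minus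
  the Hessian of the polynomial up to the factor \<open>d\<close>. This is where complex bilinearity
  of the second fundamental form originates.\<close>

lemma D2_cdot:
  assumes u: "u \<in> V"
  shows "cdot (K (D2 u v w)) (q (\<Phi> u)) =
    - (of_nat (d - 1) * (\<Sum>i\<in>UNIV. \<Phi> u $ i ^ (d - 2) * (X u v $ i * X u w $ i)))"
proof -
  have "((\<lambda>y. \<Sum>i\<in>UNIV. X y w $ i * \<Phi> y $ i ^ (d - 1)) has_derivative
      (\<lambda>v. \<Sum>i\<in>UNIV. X u w $ i * (of_nat (d - 1) * X u v $ i * \<Phi> u $ i ^ (d - 1 - 1))
         + K (D2 u v w) $ i * \<Phi> u $ i ^ (d - 1))) (at u)"
    by (intro has_derivative_sum has_derivative_power has_derivative_mult \<Phi>_has_derivative X_has_derivative u)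
  from has_derivative_const_on_open[OF V u this, of 0 v]
  have "(\<Sum>i\<in>UNIV. X u w $ i * (of_nat (d - 1) * X u v $ i * \<Phi> u $ i ^ (d - 1 - 1))
         + K (D2 u v w) $ i * \<Phi> u $ i ^ (d - 1)) = 0"
    using X_T by (simp add: T_def cdot_def q_def)
  moreover have "d - 1 - 1 = d - 2" by simp
  ultimately show ?thesis
    by (simp add: cdot_def q_def sum.distrib sum_distrib_left mult_ac add_eq_0_iff2)
qed

text \<open>An injective linear map from dimension 3 into a space of dimension 3. Every vector of
  \<open>T\<close> can therefore be realised in the chart, in particular those of the Hopf
  frame.\<close>

lemma range_X: "u \<in> V \<Longrightarrow> range (X u) = T (\<Phi> u)"
proof (rule subspace_dim_equal)
  assume u: "u \<in> V"
  show "subspace (range (X u))" using linX[OF u] by (simp add: linear_subspace_image)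
  show "range (X u) \<subseteq> T (\<Phi> u)" using X_T[OF u] by blast
  have "inj (X u)"
  proof (rule injI)
    fix v w assume "X u v = X u w"
    from arg_cong[OF this, of J] have "D1 u v = D1 u w" by (simp add: JK D1_\<nu>[OF u])
    then show "v = w" using immersion[OF u] by (simp add: inj_eq)
  qed
  then have "dim (range (X u)) = 3"
    using dim_image_eq[OF linX[OF u], of UNIV] by simp
  then show "dim (T (\<Phi> u)) \<le> dim (range (X u))"
    using T_dim[OF \<Phi>_cone[OF u] \<Phi>_unit[OF u]] by simp
qed (rule T_subspace)

definition P :: "real^3 \<Rightarrow> real^7 \<Rightarrow> real^7" where
  "P u \<xi> = J ((cdot (K \<xi>) (q (\<Phi> u)) / cdot (q (\<Phi> u)) (cvec (q (\<Phi> u)))) *s cvec (q (\<Phi> u))) + (\<xi> \<bullet> \<nu>) *\<^sub>R \<nu>"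

lemma q_cdot_nonzero: "u \<in> V \<Longrightarrow> cdot (q (\<Phi> u)) (cvec (q (\<Phi> u))) \<noteq> 0"
  using q_nonzero[of "\<Phi> u"] \<Phi>_unit[of u] by (simp add: cdot_self) (metis inner_zero_left zero_neq_one)

text \<open>The normal space is spanned by \<nu> and the complex line of the Hermitian normal.
  Subtracting \<open>P u \<xi>\<close> leaves a vector annihilated by the gradient, hence a sum of a
  tangent vector and a radial one.\<close>

lemma orth_proj_normal:
  assumes u: "u \<in> V"
  shows "orth_proj (N u) \<xi> = P u \<xi>"
proof (rule orth_proj_eqI[OF subspace_normal_space])
  let ?z = "\<Phi> u" and ?q = "q (\<Phi> u)"
  have zq: "cdot ?z ?q = 0" using \<Phi>_cone[OF u] by (simp add: cdot_q cone_def)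
  have "P u \<xi> \<bullet> J Y = 0" if "cdot Y ?q = 0" for Y
    using that by (simp add: P_def inner_add_left J_inner inner_commute[of \<nu>] inner_cvec cdot_lin
        cdot_cvec_cvec cdot_commute[of "q _"])
  from this[of ?z] this[of "X u _"] show "P u \<xi> \<in> N u"
    using zq X_T[OF u] unfolding normal_space_def orthogonal_def
    by (simp add: J\<Phi>[OF u] JK[OF D1_\<nu>[OF u]] T_def)
  fix s assume s: "s \<in> N u"
  define Y where "Y = K \<xi> - (cdot (K \<xi>) ?q / cdot ?q (cvec ?q)) *s cvec ?q"
  have d1: "\<xi> - P u \<xi> = J Y"
    by (subst JK_split[of \<xi>]) (simp add: P_def Y_def linear_diff[OF linJ])
  have "cdot Y ?q = 0"
    using q_cdot_nonzero[OF u] by (simp add: Y_def cdot_lin cdot_commute[of "cvec _"])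
  then have "Y - (Y \<bullet> ?z) *\<^sub>R ?z \<in> T ?z"
    by (simp add: T_def cdot_lin zq inner_diff_left \<Phi>_unit[OF u])
  then obtain v where v: "Y - (Y \<bullet> ?z) *\<^sub>R ?z = X u v"
    using range_X[OF u] by (metis rangeE)
  then have "Y = X u v + (Y \<bullet> ?z) *\<^sub>R ?z" by (metis diff_add_cancel)
  then have "J Y = D1 u v + (Y \<bullet> ?z) *\<^sub>R F u"
    by (metis J\<Phi>[OF u] JK[OF D1_\<nu>[OF u]] linear_add[OF linJ] linear_scale[OF linJ])
  then show "(\<xi> - P u \<xi>) \<bullet> s = 0"
    using N_F[OF s] N_D1[OF s] by (simp add: d1 inner_commute[of _ s] inner_add_right)
qed

lemma smooth_\<Phi>: "smooth_on V (\<lambda>u. \<Phi> u $ i)"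
  by (intro smooth_on_linear[OF bounded_linear_compose[OF bounded_linear_vec_nth]] V F)
    (simp add: linear_conv_bounded_linear[symmetric] linK)

lemma smooth_q: "smooth_on V (\<lambda>u. q (\<Phi> u) $ i)"
  unfolding q_def vec_lambda_beta
  by (rule smooth_on_holomorphic_compose[OF V open_UNIV _ _ smooth_\<Phi>]) (auto intro!: holomorphic_intros)

text \<open>Discharges the smoothness assumption of the Ricci equation. The closed formula involves
  powers, conjugation and the inverse of the nowhere zero squared length of the gradient.\<close>

lemma smooth_proj: "smooth_on V (\<lambda>u. orth_proj (N u) \<xi>)"
proof (rule smooth_on_cong[OF V])
  have vec: "v = (\<Sum>i\<in>UNIV. axis i (v $ i))" for v :: "complex^3"
    by (simp add: vec_eq_iff axis_def if_distrib cong: if_cong)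
  have P: "P u \<xi> = (\<Sum>i\<in>UNIV. J (axis i (cdot (K \<xi>) (q (\<Phi> u)) * inverse (cdot (q (\<Phi> u)) (cvec (q (\<Phi> u))))
      * cnj (q (\<Phi> u) $ i)))) + (\<xi> \<bullet> \<nu>) *\<^sub>R \<nu>" for u
    unfolding P_def
    by (subst vec) (simp add: linear_sum[OF linJ] cvec_def divide_inverse)
  have Jax: "bounded_linear (\<lambda>c. J (axis i c))" for i
  proof -
    have "linear (axis i :: complex \<Rightarrow> complex^3)"
      by (rule linearI) (simp_all add: axis_def vec_eq_iff)
    from linear_compose[OF this linJ] show ?thesis
      by (simp add: linear_conv_bounded_linear[symmetric] o_def)
  qed
  have c: "smooth_on V (\<lambda>u. cnj (q (\<Phi> u) $ i))" for i
    by (rule smooth_on_linear[OF bounded_linear_cnj V smooth_q])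
  have qq: "smooth_on V (\<lambda>u. cdot (q (\<Phi> u)) (cvec (q (\<Phi> u))))"
    unfolding cdot_def cvec_def vec_lambda_beta
    by (intro smooth_on_sum V smooth_on_bilinear[OF bounded_bilinear_mult] smooth_q c)
  have inv: "smooth_on V (\<lambda>u. inverse (cdot (q (\<Phi> u)) (cvec (q (\<Phi> u)))))"
    by (rule smooth_on_holomorphic_compose[OF V _ _ _ qq, of "- {0}"])
      (auto intro!: holomorphic_intros simp: q_cdot_nonzero)
  have kq: "smooth_on V (\<lambda>u. cdot (K \<xi>) (q (\<Phi> u)))"
    unfolding cdot_def
    by (intro smooth_on_sum V smooth_on_bilinear[OF bounded_bilinear_mult] smooth_q smooth_on_const)
  show "smooth_on V (\<lambda>u. P u \<xi>)"
    unfolding P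
    by (intro smooth_on_add smooth_on_sum V smooth_on_const smooth_on_linear[OF Jax]
        smooth_on_bilinear[OF bounded_bilinear_mult] kq inv c)
qed (simp add: orth_proj_normal)

lemma II_formula:
  assumes u: "u \<in> V"
  shows "II u v w = J ((- (of_nat (d - 1) * (\<Sum>i\<in>UNIV. \<Phi> u $ i ^ (d - 2) * (X u v $ i * X u w $ i)))
     / cdot (q (\<Phi> u)) (cvec (q (\<Phi> u)))) *s cvec (q (\<Phi> u)))"
  by (simp add: II_eq orth_proj_normal[OF u] P_def D2_\<nu>[OF u] D2_cdot[OF u])

text \<open>Multiplication by \<open>\<i>\<close> maps the position vector to a tangent vector and
  preserves the orthogonal complement of that vector in the tangent space.\<close>

lemma hopf_frame_exists:
  assumes u: "u \<in> V"
  obtains e w where "orthonormal_tangent_basis (G u) e" "X u (e 1) = \<i> *s \<Phi> u" "X u (e 2) = w"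
    "X u (e 3) = \<i> *s w" "w \<bullet> w = 1" "\<Phi> u \<bullet> w = 0" "(\<i> *s \<Phi> u) \<bullet> w = 0"
proof -
  let ?z = "\<Phi> u"
  have zq: "cdot ?z (q ?z) = 0" using \<Phi>_cone[OF u] by (simp add: cdot_q cone_def)
  have iz: "\<i> *s ?z \<in> T ?z" by (simp add: T_def cdot_lin zq inner_smult_i)
  have izn: "(\<i> *s ?z) \<bullet> (\<i> *s ?z) = 1" by (simp add: inner_smult_i \<Phi>_unit[OF u])
  \<comment> \<open>Removing one direction from a three-dimensional space leaves dimension at least
    2, so a unit vector \<open>w\<close> can be chosen.\<close>
  let ?S = "{y \<in> T ?z. \<forall>x\<in>span {\<i> *s ?z}. orthogonal x y}"
  have "dim ?S + dim (span {\<i> *s ?z}) = 3"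
    using dim_subspace_orthogonal_to_vectors[OF subspace_span T_subspace, of "{\<i> *s ?z}" ?z]
      span_minimal[OF _ T_subspace, of "{\<i> *s ?z}" ?z] iz T_dim[OF \<Phi>_cone[OF u] \<Phi>_unit[OF u]] by simp
  moreover have "dim (span {\<i> *s ?z}) \<le> 1"
    using dim_le_card'[of "{\<i> *s ?z}"] by simp
  ultimately have "dim ?S \<noteq> 0" by linarith
  then have "\<not> ?S \<subseteq> {0}" unfolding dim_eq_0 .
  then obtain w0 where w0: "w0 \<in> ?S" "w0 \<noteq> 0" by blast
  define w where "w = w0 /\<^sub>R norm w0"
  have wT: "w \<in> T ?z" using w0 by (auto simp: w_def intro: subspace_scale[OF T_subspace])
  have ww: "w \<bullet> w = 1" using w0(2) by (simp add: w_def dot_square_norm power2_eq_square)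
  have zw: "?z \<bullet> w = 0" using wT by (simp add: T_def inner_commute)
  have izw: "(\<i> *s ?z) \<bullet> w = 0"
    using w0(1) span_base[of "\<i> *s ?z" "{\<i> *s ?z}"] by (auto simp: w_def orthogonal_def)
  have iw: "\<i> *s w \<in> T ?z"
  proof -
    have "(\<i> *s w) \<bullet> ?z = 0"
      unfolding inner_smult_i(4)[of w ?z] inner_commute[of w "\<i> *s ?z"] izw by simp
    then show ?thesis using wT by (simp add: T_def cdot_lin)
  qed
  obtain a where a: "X u a = \<i> *s ?z" using iz unfolding range_X[OF u, symmetric] by force
  obtain b where b: "X u b = w" using wT unfolding range_X[OF u, symmetric] by force
  obtain c where c: "X u c = \<i> *s w" using iw unfolding range_X[OF u, symmetric] by force
  define e :: "3 \<Rightarrow> real^3" where "e i = (if i = 1 then a else if i = 2 then b else c)" for i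
  have e: "e 1 = a" "e 2 = b" "e 3 = c" by (simp_all add: e_def)
  have X_inner: "v \<bullet> (G u *v v') = X u v \<bullet> X u v'" for v v'
    using metric[OF u, of v v'] J_inner[of "X u v" "X u v'"] by (simp add: JK D1_\<nu>[OF u])
  have zero: "(\<i> *s ?z) \<bullet> (\<i> *s w) = 0" "w \<bullet> (\<i> *s w) = 0" "(\<i> *s w) \<bullet> w = 0" "(\<i> *s w) \<bullet> (\<i> *s w) = 1"
    using zw ww by (simp_all add: inner_smult_i)
  have "orthonormal_tangent_basis (G u) e"
    unfolding orthonormal_tangent_basis_def X_inner forall_3 e a b c
    using zero izn ww izw by (simp add: inner_commute)
  then show thesis
    by (rule that[of e w]) (simp_all only: e a b c ww zw izw)
qed

lemma minimal_wintgen: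
  assumes u: "u \<in> V"
  shows "mean_curvature G F u = 0"
    "normalized_scalar_curvature G u = 1 + (mean_curvature G F u)\<^sup>2 - normalized_normal_curvature G F u"
proof -
  obtain e w where e: "orthonormal_tangent_basis (G u) e" "X u (e 1) = \<i> *s \<Phi> u" "X u (e 2) = w"
    "X u (e 3) = \<i> *s w" "w \<bullet> w = 1" "\<Phi> u \<bullet> w = 0" "(\<i> *s \<Phi> u) \<bullet> w = 0"
    using hopf_frame_exists[OF u] by metis
  let ?h = "\<lambda>Y Z. - (of_nat (d - 1) * (\<Sum>i\<in>UNIV. \<Phi> u $ i ^ (d - 2) * (Y $ i * Z $ i))) / cdot (q (\<Phi> u)) (cvec (q (\<Phi> u)))"
  let ?n = "cvec (q (\<Phi> u))"
  define c where "c = ?h w w"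
  define \<sigma> where "\<sigma> = J (c *s ?n)"
  define \<tau> where "\<tau> = J ((\<i> * c) *s ?n)"
  \<comment> \<open>Euler's relation: the Hessian applied to the position vector is a multiple of
    the gradient, which annihilates tangent vectors.\<close>
  have h1: "?h (\<i> *s \<Phi> u) (X u v) = 0" for v
  proof -
    have "(\<Sum>i\<in>UNIV. \<Phi> u $ i ^ (d - 2) * ((\<i> *s \<Phi> u) $ i * X u v $ i)) = \<i> * cdot (X u v) (q (\<Phi> u))"
    proof -
      have "Suc (d - 2) = d - 1" using d by simp
      then have "\<Phi> u $ i ^ (d - 1) = \<Phi> u $ i * \<Phi> u $ i ^ (d - 2)" for i
        by (metis power_Suc)
      then show ?thesis
        by (simp add: cdot_def q_def sum_distrib_left mult_ac)
    qed
    then show ?thesis using X_T[OF u] by (simp add: T_def)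
  qed
  \<comment> \<open>Complex bilinearity: each factor \<open>\<i>\<close> in an argument comes out of
    the form.\<close>
  have h2: "?h w (\<i> *s w) = \<i> * c" "?h (\<i> *s w) (\<i> *s w) = - c"
    by (simp_all add: c_def sum_distrib_left sum_negf[symmetric] mult_ac sum_divide_distrib)
  have st: "\<sigma> \<bullet> \<tau> = 0" "\<tau> \<bullet> \<tau> = \<sigma> \<bullet> \<sigma>"
  proof -
    have "(\<i> * c) *s ?n = \<i> *s (c *s ?n)" by (simp add: vector_smult_assoc)
    then show "\<sigma> \<bullet> \<tau> = 0" "\<tau> \<bullet> \<tau> = \<sigma> \<bullet> \<sigma>"
      unfolding \<sigma>_def \<tau>_def J_inner by (simp_all only: inner_smult_i(1,3))
  qed
  interpret wintgen_frame V F G u e \<sigma> \<tau>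
  proof unfold_locales
    show "II u (e 1) (e a) = 0" for a
      unfolding II_formula[OF u] e(2) h1 by (simp add: linear_0[OF linJ])
    show "II u (e 2) (e 2) = \<sigma>" "II u (e 2) (e 3) = \<tau>"
      unfolding II_formula[OF u] e(3,4) h2 \<sigma>_def \<tau>_def c_def by simp_all
    have "(- c) *s ?n = - (c *s ?n)" by (simp add: vec_eq_iff)
    then have "- \<sigma> = J ((- c) *s ?n)"
      using linear_neg[OF linJ, of "c *s ?n"] by (simp only: \<sigma>_def)
    then show "II u (e 3) (e 3) = - \<sigma>"
      unfolding II_formula[OF u] e(4) h2 by simp
  qed (use u e smooth_proj st in auto)
  show "mean_curvature G F u = 0"
    "normalized_scalar_curvature G u = 1 + (mean_curvature G F u)\<^sup>2 - normalized_normal_curvature G F u"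
    by (rule minimal, rule wintgen)
qed

text \<open>The form is 1 on the Hopf frame and changes by a determinant on passing to coordinate
  vectors, so a zero there would propagate to the frame.\<close>

lemma vol_nonzero:
  assumes u: "u \<in> V"
  shows "vol (\<Phi> u) (X u (axis 1 1)) (X u (axis 2 1)) (X u (axis 3 1)) \<noteq> 0"
proof -
  obtain e w where e: "orthonormal_tangent_basis (G u) e" "X u (e 1) = \<i> *s \<Phi> u" "X u (e 2) = w"
    "X u (e 3) = \<i> *s w" "w \<bullet> w = 1" "\<Phi> u \<bullet> w = 0" "(\<i> *s \<Phi> u) \<bullet> w = 0"
    using hopf_frame_exists[OF u] by metis
  define B :: "real^3^3" where "B = (\<chi> i j. e j $ i)"
  have B: "B *v axis j 1 = e j" for j
    by (simp add: B_def matrix_vector_mult_basis column_def vec_eq_iff)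
  show ?thesis
    using vol_linear[OF linX[OF u], of "\<Phi> u" B] vol_frame[OF \<Phi>_unit[OF u] e(5-7)]
    unfolding B e(2-4) by auto
qed

end

section \<open>The link as an oriented Riemannian manifold\<close>

lemma smooth_on_vec:
  fixes f :: "'a::euclidean_space \<Rightarrow> ('b::euclidean_space)^'k::finite"
  assumes S: "open S" and f: "\<And>i. smooth_on S (\<lambda>x. f x $ i)"
  shows "smooth_on S f"
proof (rule smooth_on_cong[OF S])
  have "bounded_linear (axis i :: 'b \<Rightarrow> 'b^'k)" for i
    by (simp add: linear_conv_bounded_linear[symmetric]) (rule linearI; simp add: axis_def vec_eq_iff)
  then show "smooth_on S (\<lambda>x. \<Sum>i\<in>UNIV. axis i (f x $ i))"
    by (intro smooth_on_sum S smooth_on_linear[of "axis _"] f)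
  show "(\<Sum>i\<in>UNIV. axis i (f x $ i)) = f x" for x
    by (simp add: vec_eq_iff axis_def if_distrib cong: if_cong)
qed

lemma second_countable_euclidean: "second_countable (euclidean :: 'a::euclidean_space topology)"
proof -
  obtain B :: "'a set set" where B: "countable B" "\<And>C. C \<in> B \<Longrightarrow> open C"
    "\<And>S. open S \<Longrightarrow> \<exists>U. U \<subseteq> B \<and> S = \<Union>U"
    by (rule univ_second_countable) blast
  have "\<exists>V\<in>B. x \<in> V \<and> V \<subseteq> U" if U: "open U" "x \<in> U" for U x
    using B(3)[OF U(1)] U(2) by blast
  then show ?thesis
    unfolding second_countable_def open_openin[symmetric] using B(1,2) by blast
qed

definition gram :: "(real^'n::finite \<Rightarrow> 'b::euclidean_space) \<Rightarrow> real^'n \<Rightarrow> real^'n^'n" where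
  "gram x u = (\<chi> i j. partial i x u \<bullet> partial j x u)"

lemma gram_inner:
  assumes "linear (frechet_derivative x (at u))"
  shows "frechet_derivative x (at u) v \<bullet> frechet_derivative x (at u) w = v \<bullet> (gram x u *v w)"
proof -
  have v: "v = (\<Sum>i\<in>UNIV. (v $ i) *\<^sub>R axis i 1)" for v :: "real^'a"
    by (simp add: vec_eq_iff axis_def if_distrib cong: if_cong)
  have D: "frechet_derivative x (at u) v = (\<Sum>i\<in>UNIV. (v $ i) *\<^sub>R partial i x u)" for v
    by (subst v[of v]) (simp add: linear_sum[OF assms] linear_scale[OF assms] partial_def)
  show ?thesis
    unfolding D inner_sum_left inner_sum_right
    by (subst sum.swap) (simp add: inner_vec_def matrix_vector_mult_def gram_def sum_distrib_left mult_ac)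
qed

lemma gram_congruence:
  fixes J :: "real^'n^'n"
  assumes "\<And>v w. v \<bullet> (A *v w) = (J *v v) \<bullet> (B *v (J *v w))"
  shows "A = transpose J ** B ** J"
proof -
  have tr: "a \<bullet> (transpose J *v y) = (J *v a) \<bullet> y" for a y
    by (metis dot_lmul_matrix inner_commute transpose_matrix_vector)
  have "axis i 1 \<bullet> (A *v axis j 1) = axis i 1 \<bullet> ((transpose J ** B ** J) *v axis j 1)" for i j :: 'n
    unfolding assms
    by (simp only: matrix_vector_mul_assoc[symmetric] tr)
  then show ?thesis
    by (simp add: matrix_vector_mult_basis column_def inner_axis' vec_eq_iff)
qed

section \<open>Atlas, orientation and induced metric\<close>

context fermat
begin

text \<open>The inverse is required to extend smoothly to an open set of the ambient space.
  Transition maps then become compositions \<open>L \<circ> x\<close> of smooth maps between open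
  sets, and the immersion property follows from \<open>L (x u) = u\<close>.\<close>

definition pre_chart :: "(real^3) set \<Rightarrow> (real^3 \<Rightarrow> real^7) \<Rightarrow> bool" where
  "pre_chart V x \<longleftrightarrow> open V \<and> smooth_on V x \<and> x ` V \<subseteq> link \<and> openin (top_of_set link) (x ` V) \<and>
     (\<exists>W L. open W \<and> x ` V \<subseteq> W \<and> smooth_on W L \<and> (\<forall>u\<in>V. L (x u) = u))"

definition vol_at :: "(real^3 \<Rightarrow> real^7) \<Rightarrow> real^3 \<Rightarrow> real" where
  "vol_at x u = vol (K (x u)) (K (partial 1 x u)) (K (partial 2 x u)) (K (partial 3 x u))"

definition atlas :: "(real^7, 3) param set" where
  "atlas = {(V, x). pre_chart V x \<and> (\<forall>u\<in>V. vol_at x u > 0)}"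

lemma link_unit: "p \<in> link \<Longrightarrow> p \<bullet> p = 1"
  by (auto simp: link_def J_inner)

lemma pre_chart_immersion:
  assumes x: "pre_chart V x"
  shows "fermat_immersion d J \<nu> V x (gram x)"
proof -
  obtain W L where W: "open V" "smooth_on V x" "x ` V \<subseteq> link" "open W" "x ` V \<subseteq> W" "smooth_on W L"
    "\<And>u. u \<in> V \<Longrightarrow> L (x u) = u"
    using x unfolding pre_chart_def by blast
  show ?thesis
  proof unfold_locales
    fix u v w assume u: "u \<in> V"
    have D: "(x has_derivative frechet_derivative x (at u)) (at u)"
      by (rule smooth_on_has_derivative[OF W(2) u])
    have "(L has_derivative frechet_derivative L (at (x u))) (at (x u))"
      using u W(5) by (intro smooth_on_has_derivative[OF W(6)]) auto
    from has_derivative_compose[OF D this]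
    have "((\<lambda>u. u) has_derivative (\<lambda>v. frechet_derivative L (at (x u)) (frechet_derivative x (at u) v))) (at u)"
      by (rule has_derivative_transform_within_open[OF _ W(1) u]) (simp add: W(7))
    from has_derivative_unique[OF this has_derivative_ident]
    show "inj (frechet_derivative x (at u))"
      by (metis injI)
    show "frechet_derivative x (at u) v \<bullet> frechet_derivative x (at u) w = v \<bullet> (gram x u *v w)"
      by (rule gram_inner[OF smooth_on_frechet_linear[OF W(2) u]])
  qed (use W link_unit in auto)
qed

text \<open>The image of \<open>y\<close> is relatively open in the link, so the domain is a
  preimage of an open set; on it the transition map coincides with the smooth left inverse of
  \<open>y\<close> applied to \<open>x\<close>.\<close>

lemma transition:
  assumes x: "pre_chart V x" and y: "pre_chart W y"
  defines "\<tau> \<equiv> trans_map (V, x) (W, y)"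
  shows "open (trans_dom (V, x) (W, y))" "smooth_on (trans_dom (V, x) (W, y)) \<tau>"
    "u \<in> trans_dom (V, x) (W, y) \<Longrightarrow> \<tau> u \<in> W \<and> y (\<tau> u) = x u"
proof -
  let ?D = "trans_dom (V, x) (W, y)"
  obtain S L where S: "open W" "openin (top_of_set link) (y ` W)" "open S" "y ` W \<subseteq> S" "smooth_on S L"
    "\<And>u. u \<in> W \<Longrightarrow> L (y u) = u"
    using y unfolding pre_chart_def by blast
  have V: "open V" "smooth_on V x" "x ` V \<subseteq> link" using x unfolding pre_chart_def by blast+
  obtain O' where O': "open O'" "y ` W = link \<inter> O'"
    using S(2) by (auto simp: openin_open)
  have "?D = V \<inter> x -` O'"
    using V(3) O'(2) by (auto simp: trans_dom_def)
  then show oD: "open ?D"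
    using continuous_open_preimage[OF smooth_on_continuous[OF V(2)] V(1) O'(1)] by simp
  have DV: "?D \<subseteq> V" "x u \<in> y ` W" if "u \<in> ?D" for u using that by (auto simp: trans_dom_def)
  show t: "u \<in> ?D \<Longrightarrow> \<tau> u \<in> W \<and> y (\<tau> u) = x u" for u
    using DV(2)[of u] by (simp add: \<tau>_def trans_map_def inv_into_into f_inv_into_f)
  have eq: "L (x u) = \<tau> u" if "u \<in> ?D" for u
    using t[OF that] S(6)[of "\<tau> u"] by simp
  have "?D \<subseteq> V" by (auto simp: trans_dom_def)
  show "smooth_on ?D \<tau>"
  proof (rule smooth_on_cong[OF oD eq])
    show "smooth_on ?D (\<lambda>u. L (x u))"
      by (rule smooth_on_compose[OF oD S(3) _ S(5) smooth_on_subset[OF V(2) \<open>?D \<subseteq> V\<close>]])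
        (use S(4) DV(2) in auto)
  qed
qed

lemma transition_derivative:
  assumes x: "pre_chart V x" and y: "pre_chart W y" and u: "u \<in> trans_dom (V, x) (W, y)"
  defines "\<tau> \<equiv> trans_map (V, x) (W, y)"
  shows "frechet_derivative x (at u) v = frechet_derivative y (at (\<tau> u)) (jacobian \<tau> (at u) *v v)"
proof -
  note t = transition[OF x y, folded \<tau>_def]
  have "smooth_on W y" using y unfolding pre_chart_def by blast
  then have Dy: "(y has_derivative frechet_derivative y (at (\<tau> u))) (at (\<tau> u))"
    using t(3)[OF u] by (intro smooth_on_has_derivative) auto
  have "(\<tau> has_derivative (\<lambda>h. jacobian \<tau> (at u) *v h)) (at u)"
    using smooth_on_differentiable[OF t(2) u] by (simp add: jacobian_works)
  from has_derivative_compose[OF this Dy]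
  have "(x has_derivative (\<lambda>v. frechet_derivative y (at (\<tau> u)) (jacobian \<tau> (at u) *v v))) (at u)"
    by (rule has_derivative_transform_within_open[OF _ t(1) u]) (simp add: t(3))
  from frechet_derivative_at[OF this] show ?thesis by metis
qed

lemma atlas_pre_chart: "(V, x) \<in> atlas \<Longrightarrow> pre_chart V x"
  by (simp add: atlas_def)

text \<open>Two charts see the same 3-form, so their values differ by the Jacobian determinant; both
  values are positive by the choice of \<open>atlas\<close>.\<close>

lemma oriented: "oriented_atlas atlas"
proof -
  have "det (jacobian (trans_map (V, x) (W, y)) (at u)) > 0"
    if "(V, x) \<in> atlas" "(W, y) \<in> atlas" "u \<in> trans_dom (V, x) (W, y)" for V x W y u
  proof -
    define \<tau> where "\<tau> = trans_map (V, x) (W, y)"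
    note xy = atlas_pre_chart[OF that(1)] atlas_pre_chart[OF that(2)]
    have t: "\<tau> u \<in> W" "y (\<tau> u) = x u" using transition(3)[OF xy that(3)] by (auto simp: \<tau>_def)
    interpret y: fermat_immersion d J \<nu> W y "gram y" by (rule pre_chart_immersion[OF xy(2)])
    have "vol_at x u = det (jacobian \<tau> (at u)) * vol_at y (\<tau> u)"
      using vol_linear[OF y.linX[OF t(1)], of "K (x u)" "jacobian \<tau> (at u)"]
        transition_derivative[OF xy that(3), folded \<tau>_def]
      by (simp add: vol_at_def partial_def t(2))
    moreover have "vol_at x u > 0" "vol_at y (\<tau> u) > 0"
      using that t(1) by (auto simp: atlas_def trans_dom_def)
    ultimately show ?thesis by (simp add: \<tau>_def zero_less_mult_iff)
  qed
  then show ?thesis by (auto simp: oriented_atlas_def)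
qed

lemma metric: "riemannian_metric atlas (\<lambda>p. gram (snd p))"
proof -
  have 0: "smooth_on V (gram x)" if "pre_chart V x" for V x
  proof -
    interpret x: fermat_immersion d J \<nu> V x "gram x" by (rule pre_chart_immersion[OF that(1)])
    show "smooth_on V (gram x)"
      by (intro smooth_on_vec x.V)
        (simp add: gram_def partial_def smooth_on_bilinear[OF bounded_bilinear_inner]
          smooth_on_frechet_derivative x.F x.V)
  qed
  have 1: "transpose (gram x u) = gram x u" "v \<noteq> 0 \<Longrightarrow> v \<bullet> (gram x u *v v) > 0"
    if "pre_chart V x" "u \<in> V" for V x u v
  proof -
    interpret x: fermat_immersion d J \<nu> V x "gram x" by (rule pre_chart_immersion[OF that(1)])
    show "transpose (gram x u) = gram x u"
      by (simp add: gram_def transpose_def inner_commute)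
    assume "v \<noteq> 0"
    then have "x.D1 u v \<noteq> x.D1 u 0"
      using x.immersion[OF that(2)] by (simp add: inj_eq)
    then have "x.D1 u v \<noteq> 0" by (simp add: linear_0[OF x.lin1[OF that(2)]])
    then show "v \<bullet> (gram x u *v v) > 0" by (simp add: x.metric[OF that(2), symmetric])
  qed
  have 2: "gram x u = transpose (jacobian (trans_map (V, x) (W, y)) (at u)) **
      gram y (trans_map (V, x) (W, y) u) ** jacobian (trans_map (V, x) (W, y)) (at u)"
    if "pre_chart V x" "pre_chart W y" "u \<in> trans_dom (V, x) (W, y)" for V x W y u
  proof (rule gram_congruence)
    interpret x: fermat_immersion d J \<nu> V x "gram x" by (rule pre_chart_immersion[OF that(1)])
    interpret y: fermat_immersion d J \<nu> W y "gram y" by (rule pre_chart_immersion[OF that(2)])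
    have "u \<in> V" using that by (auto simp: trans_dom_def)
    then show "v \<bullet> (gram x u *v w) = (jacobian (trans_map (V, x) (W, y)) (at u) *v v) \<bullet>
        (gram y (trans_map (V, x) (W, y) u) *v (jacobian (trans_map (V, x) (W, y)) (at u) *v w))" for v w
      using transition(3)[OF that] transition_derivative[OF that]
      by (simp add: x.metric[symmetric] y.metric[symmetric])
  qed
  show ?thesis
    unfolding riemannian_metric_def Let_def
  proof (intro conjI ballI)
    fix p assume p: "p \<in> atlas"
    then have pc: "pre_chart (fst p) (snd p)" by (simp add: atlas_pre_chart)
    show "smooth_on (fst p) (gram (snd p))" by (rule 0[OF pc])
    show "transpose (gram (snd p) u) = gram (snd p) u" "\<forall>v. v \<noteq> 0 \<longrightarrow> 0 < v \<bullet> (gram (snd p) u *v v)"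
      if "u \<in> fst p" for u
      using 1[OF pc that] by blast+
    show "gram (snd p) u = transpose (jacobian (trans_map p q) (at u)) **
        gram (snd q) (trans_map p q u) ** jacobian (trans_map p q) (at u)"
      if "q \<in> atlas" "u \<in> trans_dom p q" for q u
      using 2[OF pc, of "fst q" "snd q" u] that atlas_pre_chart[of "fst q" "snd q"] by simp
  qed
qed

lemma isometric_minimal_wintgen:
  "isometric_immersion_unit_sphere atlas (\<lambda>p. gram (snd p)) (\<lambda>p. p)"
  "minimal_immersion atlas (\<lambda>p. gram (snd p)) (\<lambda>p. p)"
  "wintgen_ideal atlas (\<lambda>p. gram (snd p)) (\<lambda>p. p)"
proof -
  have o: "(\<lambda>p. p) \<circ> x = x" for x :: "real^3 \<Rightarrow> real^7" by (simp add: fun_eq_iff)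
  have "smooth_on V x \<and> (\<forall>u\<in>V. x u \<in> sphere 0 1 \<and> inj (frechet_derivative x (at u)) \<and>
     (\<forall>v w. frechet_derivative x (at u) v \<bullet> frechet_derivative x (at u) w = v \<bullet> (gram x u *v w)) \<and>
     mean_curvature (gram x) x u = 0 \<and>
     normalized_scalar_curvature (gram x) u = 1 + (mean_curvature (gram x) x u)\<^sup>2
       - normalized_normal_curvature (gram x) x u)"
    if "(V, x) \<in> atlas" for V x
  proof -
    interpret x: fermat_immersion d J \<nu> V x "gram x"
      by (rule pre_chart_immersion[OF atlas_pre_chart[OF that]])
    show ?thesis
      using x.F x.sphere x.immersion x.metric x.minimal_wintgen by (auto simp: norm_eq_1)
  qed
  then show "isometric_immersion_unit_sphere atlas (\<lambda>p. gram (snd p)) (\<lambda>p. p)"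
    "minimal_immersion atlas (\<lambda>p. gram (snd p)) (\<lambda>p. p)"
    "wintgen_ideal atlas (\<lambda>p. gram (snd p)) (\<lambda>p. p)"
    unfolding isometric_immersion_unit_sphere_def minimal_immersion_def wintgen_ideal_def o
    by fastforce+
qed

lemma pre_chart_homeomorphic:
  assumes x: "pre_chart V x"
  shows "homeomorphic_map (top_of_set V) (top_of_set (x ` V)) x"
proof -
  obtain W L where W: "open V" "smooth_on V x" "open W" "x ` V \<subseteq> W" "smooth_on W L"
    "\<And>u. u \<in> V \<Longrightarrow> L (x u) = u"
    using x unfolding pre_chart_def by blast
  have "homeomorphic_maps (top_of_set V) (top_of_set (x ` V)) x L"
    unfolding homeomorphic_maps_def
    using smooth_on_continuous[OF W(2)] continuous_on_subset[OF smooth_on_continuous[OF W(5)] W(4)] W(6)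
    by (auto simp: continuous_map_in_subtopology)
  then show ?thesis using homeomorphic_map_maps by blast
qed

lemma link_compact: "compact link"
proof -
  have "continuous_on UNIV (\<lambda>z::complex^3. \<Sum>i\<in>UNIV. z $ i ^ d)"
    by (intro continuous_intros)
  then have "closed ((\<lambda>z::complex^3. \<Sum>i\<in>UNIV. z $ i ^ d) -` {0})"
    by (intro closed_vimage) (auto simp: continuous_on_eq_continuous_at)
  moreover have "cone = (\<lambda>z::complex^3. \<Sum>i\<in>UNIV. z $ i ^ d) -` {0}" by (auto simp: cone_def)
  ultimately have "closed cone" by simp
  moreover have "{z::complex^3. z \<bullet> z = 1} = sphere 0 1"
    by (auto simp: norm_eq_1)
  ultimately have "compact (cone \<inter> {z. z \<bullet> z = 1})"
    by (simp add: closed_Int_compact)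
  then show ?thesis
    unfolding link_def
    by (intro compact_continuous_image linear_continuous_on) (simp_all add: linear_conv_bounded_linear[symmetric] linJ)
qed

lemma cone_sum: "z \<in> cone \<longleftrightarrow> z $ 1 ^ d + z $ 2 ^ d + z $ 3 ^ d = 0"
  by (simp add: cone_def sum_3)

end

section \<open>Connectedness of the link\<close>

lemma complex_root_exists: "d > 0 \<Longrightarrow> \<exists>c::complex. c ^ d = b"
  by (rule exists_complex_root[of d b]) auto

text \<open>Lifts the segment from \<open>a ^ d\<close> to \<open>b\<close> through the
  \<open>d\<close>-th power map, starting at \<open>a\<close>. A segment that avoids 0 is lifted
  with \<open>Ln\<close> of the ratio to its start; one that starts at 0 or reaches it is lifted
  along rays with real roots.\<close>

lemma complex_root_path:
  assumes d: "d > 0"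
  obtains g where "continuous_on {0..1} g" "g 0 = a"
    "\<And>s. s \<in> {0..1} \<Longrightarrow> g s ^ d = (1 - complex_of_real s) * a ^ d + complex_of_real s * b"
proof -
  have rt: "complex_of_real (root d r) ^ d = of_real r" if "r \<ge> 0" for r
    using that d by (simp add: of_real_power[symmetric] del: of_real_power)
  consider "a = 0" | "a \<noteq> 0" "b / a ^ d \<notin> \<real>\<^sub>\<le>\<^sub>0" | "a \<noteq> 0" "b / a ^ d \<in> \<real>\<^sub>\<le>\<^sub>0" by blast
  then show thesis
  proof cases
    case 1
    obtain c where c: "c ^ d = b" using complex_root_exists[OF d] by blast
    show thesis
      by (rule that[of "\<lambda>s. c * of_real (root d s)"])
        (use 1 c rt d in \<open>auto intro!: continuous_intros simp: power_mult_distrib\<close>)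
  next
    case 2
    define w where "w s = (1 - complex_of_real s) + complex_of_real s * (b / a ^ d)" for s
    have w: "w s \<notin> \<real>\<^sub>\<le>\<^sub>0" if "s \<in> {0..1}" for s
    proof
      assume "w s \<in> \<real>\<^sub>\<le>\<^sub>0"
      then obtain r where r: "r \<le> 0" "w s = of_real r" by (auto elim: nonpos_Reals_cases)
      have "s \<noteq> 0" using r by (auto simp: w_def)
      then have "b / a ^ d = of_real ((r - (1 - s)) / s)"
        using r(2) by (simp add: w_def field_simps)
      moreover have "(r - (1 - s)) / s \<le> 0" using that r(1) by (simp add: divide_nonpos_nonneg)
      ultimately show False using 2(2) by (simp only: nonpos_Reals_of_real_iff) simp
    qed
    have nz: "w s \<noteq> 0" if "s \<in> {0..1}" for s using w[OF that] by auto
    show thesis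
    proof (rule that[of "\<lambda>s. a * exp (Ln (w s) / of_nat d)"])
      show "continuous_on {0..1} (\<lambda>s. a * exp (Ln (w s) / of_nat d))"
        using w unfolding w_def by (intro continuous_intros) (auto simp: d)
      show "a * exp (Ln (w 0) / of_nat d) = a" by (simp add: w_def)
      show "(a * exp (Ln (w s) / of_nat d)) ^ d = (1 - complex_of_real s) * a ^ d + complex_of_real s * b"
        if "s \<in> {0..1}" for s
      proof -
        have "exp (Ln (w s) / of_nat d) ^ d = w s"
          using d nz[OF that] by (simp add: exp_of_nat_mult[symmetric])
        then show ?thesis using 2(1) by (simp add: power_mult_distrib w_def field_simps)
      qed
    qed
  next
    case 3
    obtain \<beta> where \<beta>: "\<beta> \<le> 0" "b / a ^ d = of_real \<beta>" using 3(2) by (auto elim: nonpos_Reals_cases)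
    obtain k where k: "k ^ d = (-1::complex)" using complex_root_exists[OF d] by blast
    define w where "w s = 1 - s + s * \<beta>" for s
    \<comment> \<open>For each \<open>s\<close> at least one of the two roots is zero: the path
      comes in on the ray of \<open>a\<close> and, once \<open>w s\<close> is negative, goes out on
      the ray of \<open>a * k\<close>.\<close>
    define g where "g s = a * (of_real (root d (max 0 (w s))) + k * of_real (root d (max 0 (- w s))))" for s
    have pw: "(of_real (root d (max 0 r)) + k * of_real (root d (max 0 (- r)))) ^ d = complex_of_real r" for r
      using rt[of r] rt[of "-r"] k d by (cases "r \<ge> 0") (auto simp: power_mult_distrib max_def)
    show thesis
    proof (rule that[of g])
      show "continuous_on {0..1} g"
        unfolding g_def w_def by (intro continuous_intros)
      show "g 0 = a" using d by (simp add: g_def w_def)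
      show "g s ^ d = (1 - complex_of_real s) * a ^ d + complex_of_real s * b" if "s \<in> {0..1}" for s
      proof -
        have "g s ^ d = a ^ d * of_real (w s)"
          by (simp add: g_def power_mult_distrib pw)
        also have "\<dots> = a ^ d * (1 - of_real s + of_real s * (b / a ^ d))" by (simp add: w_def \<beta>(2))
        also have "\<dots> = (1 - of_real s) * a ^ d + of_real s * (a ^ d * (b / a ^ d))"
          by (simp only: algebra_simps)
        finally show ?thesis using 3(1) by simp
      qed
    qed
  qed
qed

context fermat
begin

lemma path_cone:
  assumes "continuous_on {0..1} g1" "continuous_on {0..1} g2" "continuous_on {0..1} g3"
    "\<And>s. s \<in> {0..1} \<Longrightarrow> g1 s ^ d + g2 s ^ d + g3 s ^ d = 0"
    "\<And>s. s \<in> {0..1} \<Longrightarrow> g1 s \<noteq> 0 \<or> g2 s \<noteq> 0 \<or> g3 s \<noteq> 0"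
  shows "path_component (cone - {0}) (vector [g1 0, g2 0, g3 0]) (vector [g1 (1::real), g2 1, g3 1])"
proof -
  let ?g = "\<lambda>s. vector [g1 s, g2 s, g3 s] :: complex^3"
  have v: "(vector [a, b, c] :: complex^3) = (\<chi> i. if i = 1 then a else if i = 2 then b else c)" for a b c :: complex
    by (simp add: vec_eq_iff forall_3)
  have "continuous_on {0..1} ?g"
    unfolding v
  proof (intro continuous_on_vec_lambda)
    show "continuous_on {0..1} (\<lambda>s. if i = 1 then g1 s else if i = 2 then g2 s else g3 s)" for i :: 3
      by (cases "i = 1"; cases "i = 2") (simp_all add: assms)
  qed
  moreover have "?g ` {0..1} \<subseteq> cone - {0}"
    using assms(4,5) by (auto simp: cone_sum vec_eq_iff forall_3)
  ultimately show ?thesis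
    unfolding path_component_def path_def path_image_def
    by (intro exI[of _ ?g]) (simp add: pathstart_def pathfinish_def)
qed

text \<open>The punctured cone is path connected to one base point, and the link is its continuous
  image under normalisation.\<close>

lemma connected_link: "connected link"
proof -
  let ?C = "cone - {0}"
  have d0: "d > 0" using d by simp
  have root: "complex_of_real (root d r) ^ d = of_real r" if "r \<ge> 0" for r
    using that d0 by (simp add: of_real_power[symmetric] del: of_real_power)
  obtain k where k: "k ^ d = (-1::complex)" using complex_root_exists[OF d0] by blast
  have vec: "z = vector [z $ 1, z $ 2, z $ 3]" for z :: "complex^3"
    by (simp add: vec_eq_iff forall_3)
  \<comment> \<open>The points with first coordinate 0 are reached from the base point by trading
    the third coordinate against the first while the second stays 1.\<close>
  have C: "path_component ?C (vector [0, 1, e]) (vector [k, 1, 0])" if e: "e ^ d = -1" for e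
  proof -
    have "path_component ?C (vector [k * of_real (root d 0), 1, e * of_real (root d (1 - 0))])
      (vector [k * of_real (root d 1), 1, e * of_real (root d (1 - 1))])"
      by (rule path_cone[of "\<lambda>s. k * of_real (root d s)" "\<lambda>s. 1" "\<lambda>s. e * of_real (root d (1 - s))"])
        (use e k root in \<open>auto intro!: continuous_intros simp: power_mult_distrib\<close>)
    then show ?thesis using d0 by simp
  qed
  have B: "path_component ?C (vector [0, a, b]) (vector [k, 1, 0])" if ab: "a ^ d + b ^ d = 0" "a \<noteq> 0" for a b
  proof -
    let ?c = "\<lambda>s. exp (of_real s * Ln (1 / a))"
    have "path_component ?C (vector [0, ?c 0 * a, ?c 0 * b]) (vector [0, ?c 1 * a, ?c 1 * b])"
      by (rule path_cone[of "\<lambda>s. 0" "\<lambda>s. ?c s * a" "\<lambda>s. ?c s * b"])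
        (use ab d0 in \<open>auto intro!: continuous_intros simp: power_mult_distrib distrib_left[symmetric] power_0_left\<close>)
    then have "path_component ?C (vector [0, a, b]) (vector [0, 1, b / a])"
      using ab(2) by simp
    moreover have "(b / a) ^ d = -1"
      using ab by (simp add: power_divide add_eq_0_iff divide_eq_eq)
    ultimately show ?thesis using C path_component_trans by blast
  qed
  have A: "path_component ?C z (vector [k, 1, 0])" if z: "z \<in> ?C" for z
  proof (cases "z $ 1 = 0")
    case True
    then have "z $ 2 ^ d + z $ 3 ^ d = 0" using z d0 by (simp add: cone_sum power_0_left)
    moreover have "z $ 2 \<noteq> 0"
      using z True calculation d0 by (auto simp: vec_eq_iff forall_3 power_0_left)
    ultimately show ?thesis using B[of "z $ 2" "z $ 3"] vec[of z] True by metis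
  next
    case False
    obtain g2 where g2: "continuous_on {0..1} g2" "g2 0 = z $ 2"
      "\<And>s. s \<in> {0..1} \<Longrightarrow> g2 s ^ d = (1 - complex_of_real s) * (z $ 2) ^ d + complex_of_real s * 1"
      by (rule complex_root_path[OF d0]) blast
    obtain g3 where g3: "continuous_on {0..1} g3" "g3 0 = z $ 3"
      "\<And>s. s \<in> {0..1} \<Longrightarrow> g3 s ^ d = (1 - complex_of_real s) * (z $ 3) ^ d + complex_of_real s * -1"
      by (rule complex_root_path[OF d0]) blast
    \<comment> \<open>The three \<open>d\<close>-th powers move linearly from those of
      \<open>z\<close> to \<open>0, 1, -1\<close>, so their sum stays \<open>1 - s\<close> times the
      sum at the start, which is zero.\<close>
    let ?g1 = "\<lambda>s. z $ 1 * of_real (root d (1 - s))"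
    have sum0: "z $ 1 ^ d + z $ 2 ^ d + z $ 3 ^ d = 0" using z by (simp add: cone_sum)
    have "path_component ?C (vector [?g1 0, g2 0, g3 0]) (vector [?g1 1, g2 1, g3 1])"
    proof (rule path_cone[OF _ g2(1) g3(1)])
      show "continuous_on {0..1} ?g1" by (intro continuous_intros)
      fix s :: real assume s: "s \<in> {0..1}"
      have "?g1 s ^ d + g2 s ^ d + g3 s ^ d
        = (1 - complex_of_real s) * (z $ 1 ^ d + z $ 2 ^ d + z $ 3 ^ d)"
      proof -
        have "complex_of_real (root d (1 - s)) ^ d = 1 - complex_of_real s" using s root[of "1 - s"] by simp
        then show ?thesis by (simp only: g2(3)[OF s] g3(3)[OF s] power_mult_distrib) (simp add: algebra_simps)
      qed
      then show "?g1 s ^ d + g2 s ^ d + g3 s ^ d = 0" by (simp add: sum0)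
      show "?g1 s \<noteq> 0 \<or> g2 s \<noteq> 0 \<or> g3 s \<noteq> 0"
        using g2(3)[OF s] False d0 by (cases "s = 1") (auto simp: real_root_eq_0_iff power_0_left)
    qed
    moreover have "vector [?g1 0, g2 0, g3 0] = z" using vec[of z] d0 by (simp add: g2 g3)
    ultimately have "path_component ?C z (vector [0, g2 1, g3 1])" by simp
    moreover have "g2 1 ^ d = 1" "g3 1 ^ d = -1" using g2(3)[of 1] g3(3)[of 1] by auto
    then have "g2 1 ^ d + g3 1 ^ d = 0" "g2 1 \<noteq> 0" using d0 by (auto simp: power_0_left)
    ultimately show ?thesis using B path_component_trans by blast
  qed
  have "path_connected ?C"
    unfolding path_connected_component
    by (meson A path_component_sym path_component_trans)
  then have con: "connected ?C" by (rule path_connected_imp_connected)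
  have sc: "r *\<^sub>R z \<in> cone" if "z \<in> cone" for z r
    using that by (simp add: cone_sum scaleR_conv_of_real[where 'a=complex] power_mult_distrib distrib_left[symmetric])
  have "link = (\<lambda>z. J (z /\<^sub>R norm z)) ` ?C"
  proof (intro subset_antisym subsetI)
    fix p assume "p \<in> link"
    then obtain z where z: "p = J z" "z \<in> cone" "z \<bullet> z = 1" by (auto simp: link_def)
    then have "norm z = 1" by (simp add: norm_eq_1)
    then show "p \<in> (\<lambda>z. J (z /\<^sub>R norm z)) ` ?C"
      using z by (intro image_eqI[of _ _ z]) auto
  next
    fix p assume "p \<in> (\<lambda>z. J (z /\<^sub>R norm z)) ` ?C"
    then obtain z where "p = J (z /\<^sub>R norm z)" "z \<in> cone" "z \<noteq> 0" by auto
    then show "p \<in> link"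
      unfolding link_def using sc[of z "inverse (norm z)"]
      by (intro image_eqI[of _ _ "z /\<^sub>R norm z"]) (simp_all add: norm_eq_1[symmetric])
  qed
  then have "connected link \<longleftrightarrow> connected ((\<lambda>z. J (z /\<^sub>R norm z)) ` ?C)" by simp
  moreover have "continuous_on ?C (\<lambda>z. J (z /\<^sub>R norm z))"
    by (intro linear_continuous_on_compose[OF _ linJ] continuous_intros) auto
  then have "connected ((\<lambda>z. J (z /\<^sub>R norm z)) ` ?C)" by (rule connected_continuous_image[OF _ con])
  ultimately show ?thesis by blast
qed

lemma link_nonempty: "link \<noteq> {}"
proof -
  have d0: "d > 0" using d by simp
  obtain k where k: "k ^ d = (-1::complex)" using complex_root_exists[OF d0] by blast
  define z :: "complex^3" where "z = vector [k, 1, 0]"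
  have z: "z \<noteq> 0" "z \<in> cone" using k d0 by (auto simp: z_def vec_eq_iff forall_3 cone_sum)
  have "(z /\<^sub>R norm z) \<in> cone"
    using z(2) by (simp add: cone_sum scaleR_conv_of_real[where 'a=complex] power_mult_distrib distrib_left[symmetric])
  then have "J (z /\<^sub>R norm z) \<in> link"
    unfolding link_def using z(1) by (intro imageI) (simp add: norm_eq_1[symmetric])
  then show ?thesis by blast
qed

section \<open>Existence of charts\<close>

lemma pre_chart_subset:
  assumes x: "pre_chart V x" and V': "open V'" "V' \<subseteq> V"
  shows "pre_chart V' x"
proof -
  have "openin (top_of_set V) V'" using V' by (simp add: open_subset)
  then have "openin (top_of_set (x ` V)) (x ` V')"
    using homeomorphic_map_openness_eq[OF pre_chart_homeomorphic[OF x]] V'(2) by auto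
  then have "openin (top_of_set link) (x ` V')"
    using x openin_trans[of "x ` V" "x ` V'" link] unfolding pre_chart_def by blast
  moreover obtain W L where "smooth_on V x" "x ` V \<subseteq> link" "open W" "x ` V \<subseteq> W" "smooth_on W L"
    "\<And>u. u \<in> V \<Longrightarrow> L (x u) = u"
    using x unfolding pre_chart_def by blast
  ultimately show ?thesis
    unfolding pre_chart_def
    using V' smooth_on_subset[of V x V'] by (intro conjI exI[of _ W] exI[of _ L]) (auto simp: image_subset_iff subset_iff)
qed

text \<open>The link is locally a circle bundle over an affine piece of the Fermat curve. The
  coordinates are the ratio of coordinates \<open>l\<close> and \<open>i\<close>, giving two reals,
  and the phase of coordinate \<open>i\<close>; the remaining ratio is a branch of a
  \<open>d\<close>-th root and the modulus is fixed by the unit norm.\<close>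

lemma chart_at:
  assumes p: "p \<in> link"
  obtains V x where "pre_chart V x" "p \<in> x ` V"
proof -
  have d0: "d > 0" using d by simp
  obtain z0 where z0: "p = J z0" "z0 \<in> cone" "z0 \<bullet> z0 = 1" using p by (auto simp: link_def)
  have "z0 \<noteq> 0" using z0 by auto
  \<comment> \<open>The equation of the cone forbids exactly one nonzero coordinate.\<close>
  then have "\<exists>i j l. i \<noteq> j \<and> i \<noteq> l \<and> j \<noteq> l \<and> z0 $ i \<noteq> 0 \<and> z0 $ j \<noteq> 0"
  proof -
    have s: "z0 $ 1 ^ d + z0 $ 2 ^ d + z0 $ 3 ^ d = 0" using z0(2) by (simp add: cone_sum)
    have t: "z0 $ 1 \<noteq> 0 \<or> z0 $ 2 \<noteq> 0 \<or> z0 $ 3 \<noteq> 0" using \<open>z0 \<noteq> 0\<close> by (simp add: vec_eq_iff forall_3)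
    have distinct: "(1::3) \<noteq> 2" "(1::3) \<noteq> 3" "(2::3) \<noteq> 3" by simp_all
    show ?thesis
    proof (cases "z0 $ 1 = 0")
      case True
      then have "z0 $ 2 \<noteq> 0" "z0 $ 3 \<noteq> 0" using s t d0 by (auto simp: power_0_left)
      then show ?thesis using distinct by metis
    next
      case False
      then have "z0 $ 2 \<noteq> 0 \<or> z0 $ 3 \<noteq> 0" using s d0 by (auto simp: power_0_left)
      then show ?thesis using distinct False by metis
    qed
  qed
  then obtain i j l where ijl: "i \<noteq> j" "i \<noteq> l" "j \<noteq> l" and nzi: "z0 $ i \<noteq> 0" and nzj: "z0 $ j \<noteq> 0"
    by blast
  have ex: "m = i \<or> m = j \<or> m = l" for m
    using exhaust_3[of i] exhaust_3[of j] exhaust_3[of l] exhaust_3[of m] ijl by auto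
  then have U: "(UNIV :: 3 set) = {i, j, l}" by auto
  have sumU: "(\<Sum>m\<in>UNIV. f m) = f i + f j + f l" for f :: "3 \<Rightarrow> 'q::comm_monoid_add"
    unfolding U using ijl by (simp add: add.assoc)
  have cone_iff: "z \<in> cone \<longleftrightarrow> z $ i ^ d + z $ j ^ d + z $ l ^ d = 0" for z
    by (simp add: cone_def sumU)
  have norm_iff: "z \<bullet> z = (norm (z $ i))\<^sup>2 + (norm (z $ j))\<^sup>2 + (norm (z $ l))\<^sup>2" for z :: "complex^3"
    by (simp add: inner_vec_def sumU power2_norm_eq_inner)
  define \<eta> where "\<eta> = z0 $ j / z0 $ i"
  have \<eta>: "\<eta> \<noteq> 0" using nzi nzj by (simp add: \<eta>_def)
  define a where "a = z0 $ i / of_real (norm (z0 $ i))"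
  \<comment> \<open>Normalised so that \<open>E\<close> equals 1 at the base point, where the root
    branch \<open>h\<close> takes the value \<eta>.\<close>
  define E where "E w = - (1 + w ^ d) / \<eta> ^ d" for w :: complex
  define \<zeta> where "\<zeta> u = Complex (u $ 1) (u $ 2)" for u :: "real^3"
  \<comment> \<open>Positive real part keeps \<open>E\<close> off the cut of \<open>Ln\<close>; the
    bound on the phase makes \<open>Ln\<close> invert \<open>exp\<close> there.\<close>
  define V where "V = {u. 0 < Re (E (\<zeta> u)) \<and> \<bar>u $ 3\<bar> < pi}"
  define h where "h u = \<eta> * exp (Ln (E (\<zeta> u)) / of_nat d)" for u
  \<comment> \<open>The squared norm of the vector with entries 1, \<open>h u\<close> and
    \<open>\<zeta> u\<close>, kept complex so that the factor \<open>exp (- Ln (S u) / 2)\<close> is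
    smooth by holomorphic composition; \<open>s\<close> is the same number as a real.\<close>
  define S where "S u = 1 + \<zeta> u * cnj (\<zeta> u) + h u * cnj (h u)" for u
  define s where "s u = 1 + (norm (\<zeta> u))\<^sup>2 + (norm (h u))\<^sup>2" for u
  define c where "c u = a * exp (\<i> * of_real (u $ 3) - Ln (S u) / 2)" for u :: "real^3"
  define Z where "Z u = (\<chi> m. c u * (if m = i then 1 else if m = j then h u else \<zeta> u))" for u
  define x where "x u = J (Z u)" for u
  define W where "W = {v. K v $ i / z0 $ i \<notin> \<real>\<^sub>\<le>\<^sub>0}"
  define L :: "real^7 \<Rightarrow> real^3" where "L v = (\<chi> m. if m = 1 then Re (K v $ l * inverse (K v $ i))
     else if m = 2 then Im (K v $ l * inverse (K v $ i)) else Im (Ln (K v $ i / z0 $ i)))" for v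
  define \<kappa> where "\<kappa> v = K v $ j * inverse (K v $ i) / \<eta>" for v
  \<comment> \<open>Singles out the right root: \<open>E\<close> has argument below
    \<open>pi / 2\<close> in modulus, so its principal \<open>d\<close>-th root has argument below
    \<open>pi / (2 * d)\<close>.\<close>
  define Y where "Y = {w. w \<notin> \<real>\<^sub>\<le>\<^sub>0 \<and> \<bar>Im (Ln w)\<bar> < pi / (2 * d)}"
  have Zc: "Z u $ i = c u" "Z u $ j = c u * h u" "Z u $ l = c u * \<zeta> u" for u
    using ijl by (auto simp: Z_def)
  have Ss: "S u = of_real (s u)" for u
    by (simp add: S_def s_def complex_norm_square[symmetric])
  have s1: "s u \<ge> 1" for u by (simp add: s_def)
  have LnS: "Ln (S u) = of_real (ln (s u))" for u
    using s1[of u] by (simp add: Ss Ln_of_real)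
  have c_eq: "c u = a * exp (\<i> * of_real (u $ 3)) * of_real (exp (- ln (s u) / 2))" for u
  proof -
    have "c u = a * exp (\<i> * of_real (u $ 3) + of_real (- ln (s u) / 2))"
      by (simp add: c_def LnS)
    then show ?thesis by (simp only: exp_add exp_of_real mult.assoc)
  qed
  have na: "norm a = 1" using nzi by (simp add: a_def norm_divide)
  have nc: "(norm (c u))\<^sup>2 * s u = 1" for u
  proof -
    have "(norm (c u))\<^sup>2 = (exp (- ln (s u) / 2))\<^sup>2"
      by (simp add: c_eq norm_mult na norm_exp_eq_Re)
    also have "\<dots> = exp (- ln (s u))" by (simp add: exp_double[symmetric])
    also have "\<dots> = 1 / s u" using s1[of u] by (simp add: exp_minus divide_inverse)
    finally show ?thesis using s1[of u] by simp
  qed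
  have V: "open V"
  proof -
    have "continuous_on UNIV (\<lambda>u. Re (E (\<zeta> u)))" "continuous_on UNIV (\<lambda>u::real^3. \<bar>u $ 3\<bar>)"
      unfolding E_def \<zeta>_def Complex_eq by (intro continuous_intros; simp add: \<eta>)+
    then show ?thesis unfolding V_def
      by (intro open_Collect_conj open_Collect_less continuous_on_const)
  qed
  have Enz: "E (\<zeta> u) \<noteq> 0" "E (\<zeta> u) \<notin> \<real>\<^sub>\<le>\<^sub>0" if "u \<in> V" for u
    using that by (auto simp: V_def complex_nonpos_Reals_iff)
  have hd: "h u ^ d = - (1 + \<zeta> u ^ d)" if "u \<in> V" for u
  proof -
    have "exp (Ln (E (\<zeta> u)) / of_nat d) ^ d = E (\<zeta> u)"
      using d0 Enz[OF that] by (simp add: exp_of_nat_mult[symmetric])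
    then show ?thesis using \<eta> by (simp add: h_def power_mult_distrib E_def)
  qed
  have Zlink: "x u \<in> link" if "u \<in> V" for u
  proof -
    have "Z u $ i ^ d + Z u $ j ^ d + Z u $ l ^ d = c u ^ d * (1 + h u ^ d + \<zeta> u ^ d)"
      by (simp add: Zc power_mult_distrib algebra_simps)
    then have "Z u \<in> cone" by (simp add: cone_iff hd[OF that])
    moreover have "Z u \<bullet> Z u = (norm (c u))\<^sup>2 * s u"
      by (simp add: norm_iff Zc s_def norm_mult power_mult_distrib algebra_simps)
    ultimately show ?thesis by (simp add: x_def link_def nc)
  qed
  have sm\<zeta>: "smooth_on V \<zeta>"
    unfolding \<zeta>_def[abs_def] Complex_eq
    by (intro smooth_on_add smooth_on_bilinear[OF bounded_bilinear_mult] smooth_on_const V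
        smooth_on_linear[OF bounded_linear_of_real] smooth_on_linear[OF bounded_linear_vec_nth] smooth_on_id)
  have Ehol: "E holomorphic_on T" for T
    unfolding E_def using \<eta> by (intro holomorphic_intros) auto
  have "open (E -` (- \<real>\<^sub>\<le>\<^sub>0))"
    using holomorphic_on_imp_continuous_on[OF Ehol] by (intro open_vimage) (auto simp: open_Compl)
  then have Eopen: "open {w. E w \<notin> \<real>\<^sub>\<le>\<^sub>0}" by (simp add: vimage_def)
  have smh: "smooth_on V h"
    unfolding h_def[abs_def]
    by (rule smooth_on_holomorphic_compose[OF V, of "{w. E w \<notin> \<real>\<^sub>\<le>\<^sub>0}" \<zeta> "\<lambda>w. \<eta> * exp (Ln (E w) / of_nat d)"])
      (use Enz sm\<zeta> d0 Eopen Ehol in \<open>auto intro!: holomorphic_intros\<close>)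
  have smS: "smooth_on V S"
    unfolding S_def[abs_def]
    by (intro smooth_on_add smooth_on_bilinear[OF bounded_bilinear_mult] smooth_on_const V
        smooth_on_linear[OF bounded_linear_cnj] sm\<zeta> smh)
  have smLnS: "smooth_on V (\<lambda>u. Ln (S u))"
    by (rule smooth_on_holomorphic_compose[OF V _ _ _ smS, of "- \<real>\<^sub>\<le>\<^sub>0"])
      (use less_le_trans[OF zero_less_one s1] in \<open>auto intro!: holomorphic_intros simp: Ss open_Compl not_le\<close>)
  have smc: "smooth_on V c"
  proof -
    have "smooth_on V (\<lambda>u. \<i> * of_real (u $ 3) + (- 1 / 2) * Ln (S u))"
      by (intro smooth_on_add smooth_on_bilinear[OF bounded_bilinear_mult] smooth_on_const V smLnS
        smooth_on_linear[OF bounded_linear_of_real] smooth_on_linear[OF bounded_linear_vec_nth] smooth_on_id)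
    from smooth_on_holomorphic_compose[OF V open_UNIV _ _ this, of "\<lambda>w. a * exp w"]
    show ?thesis by (simp add: c_def[abs_def] holomorphic_intros)
  qed
  have smx: "smooth_on V x"
    unfolding x_def[abs_def]
  proof (rule smooth_on_linear[of J V Z, OF _ V smooth_on_vec[OF V]])
    show "bounded_linear J" by (simp add: linear_conv_bounded_linear[symmetric] linJ)
    show "smooth_on V (\<lambda>u. Z u $ m)" for m
      using ex[of m] Zc smc smooth_on_bilinear[OF bounded_bilinear_mult V smc smh]
        smooth_on_bilinear[OF bounded_bilinear_mult V smc sm\<zeta>] by auto
  qed
  have blK: "bounded_linear K" by (simp add: linear_conv_bounded_linear[symmetric] linK)
  have Kc: "continuous_on T (\<lambda>v. K v $ m)" for m T
    by (intro continuous_intros linear_continuous_on blK)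
  have W: "open W"
  proof -
    have "W = (\<lambda>v. K v $ i / z0 $ i) -` (- \<real>\<^sub>\<le>\<^sub>0)" by (auto simp: W_def)
    moreover have "continuous_on UNIV (\<lambda>v. K v $ i / z0 $ i)" by (intro continuous_intros Kc) (use nzi in auto)
    ultimately show ?thesis by (simp add: open_vimage open_Compl)
  qed
  have Wi: "K v $ i \<noteq> 0" if "v \<in> W" for v using that by (auto simp: W_def)
  have smK: "smooth_on W (\<lambda>v. K v $ m)" for m
    by (intro smooth_on_linear[OF bounded_linear_vec_nth W] smooth_on_linear[OF blK W smooth_on_id[OF W]])
  have smq: "smooth_on W (\<lambda>v. K v $ m * inverse (K v $ i))" for m
    by (intro smooth_on_bilinear[OF bounded_bilinear_mult W] smK
        smooth_on_holomorphic_compose[OF W _ _ _ smK, of "- {0}"])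
      (use Wi in \<open>auto intro!: holomorphic_intros\<close>)
  have smL: "smooth_on W L"
  proof (rule smooth_on_vec[OF W])
    have "smooth_on W (\<lambda>v. Ln (K v $ i * (1 / z0 $ i)))"
      by (rule smooth_on_holomorphic_compose[OF W _ _ _ smooth_on_bilinear[OF bounded_bilinear_mult W smK smooth_on_const], of "- \<real>\<^sub>\<le>\<^sub>0"])
        (auto intro!: holomorphic_intros simp: W_def open_Compl)
    then have "smooth_on W (\<lambda>v. Ln (K v $ i / z0 $ i))" by simp
    note sm = smooth_on_linear[OF bounded_linear_Re W smq] smooth_on_linear[OF bounded_linear_Im W smq]
      smooth_on_linear[OF bounded_linear_Im W this]
    show "smooth_on W (\<lambda>v. L v $ m)" for m
      unfolding L_def vec_lambda_beta
      by (cases "m = 1"; cases "m = 2") (simp_all only: if_True if_False simp_thms sm)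
  qed
  have cz: "c u / z0 $ i = exp (\<i> * of_real (u $ 3) + of_real (- ln (s u) / 2 - ln (norm (z0 $ i))))" for u
  proof -
    have "a / z0 $ i = of_real (exp (- ln (norm (z0 $ i))))"
      using nzi by (simp add: a_def exp_minus divide_inverse)
    moreover have "c u / z0 $ i = (a / z0 $ i) * (exp (\<i> * of_real (u $ 3)) * of_real (exp (- ln (s u) / 2)))"
      by (simp add: c_eq)
    ultimately show ?thesis
      by (simp only: exp_of_real[symmetric] exp_add[symmetric]) (simp add: algebra_simps)
  qed
  have Lnc: "Ln (c u / z0 $ i) = \<i> * of_real (u $ 3) + of_real (- ln (s u) / 2 - ln (norm (z0 $ i)))"
    if "u \<in> V" for u
    unfolding cz using that by (intro Ln_exp) (auto simp: V_def)
  have cnz: "c u \<noteq> 0" for u using nc[of u] by auto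
  have xW: "x u \<in> W" if "u \<in> V" for u
  proof -
    have "Im (Ln (c u / z0 $ i)) \<noteq> pi" using that by (auto simp: Lnc V_def)
    moreover have "c u / z0 $ i \<noteq> 0" using cnz nzi by simp
    ultimately have "c u / z0 $ i \<notin> \<real>\<^sub>\<le>\<^sub>0"
      using Im_Ln_eq_pi[of "c u / z0 $ i"] by (auto simp: complex_nonpos_Reals_iff complex_eq_iff order_le_less)
    then show ?thesis by (simp add: W_def x_def Zc)
  qed
  have Lx: "L (x u) = u" if "u \<in> V" for u
  proof -
    have "c u * \<zeta> u * inverse (c u) = \<zeta> u" using cnz[of u] by simp
    moreover have "Im (Ln (c u / z0 $ i)) = u $ 3" by (simp only: Lnc[OF that]) simp
    ultimately show ?thesis
      by (simp only: vec_eq_iff forall_3 L_def x_def Zc KJ vec_lambda_beta) (simp add: \<zeta>_def)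
  qed
  have \<kappa>x: "\<kappa> (x u) \<in> Y" if "u \<in> V" for u
  proof -
    have k: "\<kappa> (x u) = exp (Ln (E (\<zeta> u)) / of_nat d)"
      using cnz[of u] \<eta> by (simp add: \<kappa>_def x_def Zc h_def)
    have im: "\<bar>Im (Ln (E (\<zeta> u)))\<bar> < pi / 2" using that by (intro Re_Ln_pos_lt_imp) (simp add: V_def)
    then have b: "\<bar>Im (Ln (E (\<zeta> u)) / of_nat d)\<bar> < pi / (2 * d)"
      using d0 by (simp add: Im_divide_of_nat field_simps)
    also have "pi / (2 * d) < pi" using d0 by (simp add: field_simps)
    finally have b2: "\<bar>Im (Ln (E (\<zeta> u)) / of_nat d)\<bar> < pi" .
    then have Lnk: "Ln (\<kappa> (x u)) = Ln (E (\<zeta> u)) / of_nat d"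
      unfolding k by (intro Ln_exp) linarith+
    then have "Im (Ln (\<kappa> (x u))) \<noteq> pi"
      using b2 abs_ge_self[of "Im (Ln (E (\<zeta> u)) / of_nat d)"] unfolding Lnk by linarith
    moreover have "\<kappa> (x u) \<noteq> 0" by (simp add: k)
    ultimately have "\<kappa> (x u) \<notin> \<real>\<^sub>\<le>\<^sub>0"
      using Im_Ln_eq_pi[of "\<kappa> (x u)"] by (auto simp: complex_nonpos_Reals_iff complex_eq_iff order_le_less)
    then show ?thesis using b by (simp add: Y_def Lnk)
  qed
  \<comment> \<open>The reverse inclusion for openness: a point of the link whose coordinates lie in
    \<open>V\<close> and whose ratio lies on the right branch is recovered from its
    coordinates.\<close>
  have xL: "x (L v) = v" if v: "v \<in> link" "v \<in> W" "L v \<in> V" "\<kappa> v \<in> Y" for v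
  proof -
    define z where "z = K v"
    define u where "u = L v"
    have vz: "v = J z" "z \<in> cone" "z \<bullet> z = 1" using v(1) by (auto simp: link_def z_def)
    have zi: "z $ i \<noteq> 0" using Wi[OF v(2)] by (simp add: z_def)
    have \<zeta>u: "\<zeta> u = z $ l / z $ i"
      by (simp add: u_def \<zeta>_def L_def z_def complex_eq_iff divide_inverse)
    have u3: "u $ 3 = Im (Ln (z $ i / z0 $ i))" by (simp add: u_def L_def z_def)
    have kz: "\<kappa> v = z $ j / z $ i / \<eta>" by (simp add: \<kappa>_def z_def divide_inverse)
    have k: "\<kappa> v \<notin> \<real>\<^sub>\<le>\<^sub>0" "\<bar>Im (Ln (\<kappa> v))\<bar> < pi / (2 * d)" using v(4) by (auto simp: Y_def)
    have knz: "\<kappa> v \<noteq> 0" using k(1) by auto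
    have zj: "z $ j ^ d = - (z $ i ^ d + z $ l ^ d)"
      using vz(2) by (simp add: cone_iff eq_neg_iff_add_eq_0 algebra_simps)
    have "- (1 + (z $ l / z $ i) ^ d) = z $ j ^ d / z $ i ^ d"
      unfolding zj power_divide using zi by (simp add: divide_simps)
    then have "E (\<zeta> u) = \<kappa> v ^ d"
      by (simp add: E_def \<zeta>u kz power_divide power_mult_distrib)
    also have "\<dots> = exp (of_nat d * Ln (\<kappa> v))" using knz by (simp add: exp_of_nat_mult)
    finally have Ee: "E (\<zeta> u) = exp (of_nat d * Ln (\<kappa> v))" .
    have "\<bar>Im (of_nat d * Ln (\<kappa> v))\<bar> < pi"
    proof -
      have "\<bar>Im (of_nat d * Ln (\<kappa> v))\<bar> = d * \<bar>Im (Ln (\<kappa> v))\<bar>" by (simp add: abs_mult)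
      also have "\<dots> < d * (pi / (2 * d))" using k(2) d0 by (intro mult_strict_left_mono) auto
      also have "\<dots> < pi" using d0 by (simp add: field_simps)
      finally show ?thesis .
    qed
    then have "Ln (E (\<zeta> u)) = of_nat d * Ln (\<kappa> v)" unfolding Ee by (intro Ln_exp) linarith+
    then have hu: "h u = z $ j / z $ i"
      using d0 knz \<eta> by (simp add: h_def) (simp add: kz)
    have su: "s u = 1 / (norm (z $ i))\<^sup>2"
      using zi vz(3) by (simp add: s_def \<zeta>u hu norm_divide power_divide norm_iff field_simps)
    have "exp (- ln (s u) / 2) = norm (z $ i)"
      using zi by (simp add: su ln_div ln_realpow)
    moreover have "z $ i / z0 $ i = of_real (norm (z $ i) / norm (z0 $ i)) * exp (\<i> * of_real (u $ 3))"
    proof -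
      have nz: "z $ i / z0 $ i \<noteq> 0" using zi nzi by simp
      have "z $ i / z0 $ i = exp (Ln (z $ i / z0 $ i))" using nz by simp
      also have "Ln (z $ i / z0 $ i) = of_real (ln (norm (z $ i / z0 $ i))) + \<i> * of_real (u $ 3)"
        using nz by (simp add: complex_eq_iff u3)
      also have "exp \<dots> = of_real (norm (z $ i / z0 $ i)) * exp (\<i> * of_real (u $ 3))"
        using nz by (simp add: exp_add exp_of_real)
      finally show ?thesis by (simp add: norm_divide)
    qed
    ultimately have "c u = z $ i"
      using nzi by (simp add: c_eq a_def field_simps)
    then have "Z u $ m = z $ m" for m
      using ex[of m] zi by (auto simp: Zc hu \<zeta>u)
    then have "Z u = z" by (simp add: vec_eq_iff)
    then show ?thesis unfolding x_def u_def[symmetric] using vz(1) by simp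
  qed
  have Yopen: "open Y"
  proof -
    have "Y = (- \<real>\<^sub>\<le>\<^sub>0) \<inter> (\<lambda>w. Im (Ln w)) -` {- (pi / (2 * d))<..<pi / (2 * d)}" by (auto simp: Y_def)
    moreover have "continuous_on (- \<real>\<^sub>\<le>\<^sub>0) (\<lambda>w. Im (Ln w))" by (intro continuous_intros) auto
    ultimately show ?thesis
      by (metis closed_nonpos_Reals_complex continuous_open_preimage open_Compl open_greaterThanLessThan)
  qed
  define O' where "O' = (W \<inter> L -` V) \<inter> (W \<inter> \<kappa> -` Y)"
  have "open (W \<inter> L -` V)"
    by (rule continuous_open_preimage[OF smooth_on_continuous[OF smL] W V])
  moreover have "continuous_on W \<kappa>"
    unfolding \<kappa>_def[abs_def] by (intro continuous_intros Kc) (use Wi \<eta> in auto)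
  then have "open (W \<inter> \<kappa> -` Y)" by (rule continuous_open_preimage[OF _ W Yopen])
  ultimately have O': "open O'" by (simp add: O'_def open_Int)
  have xV: "x ` V = link \<inter> O'"
  proof
    show "x ` V \<subseteq> link \<inter> O'" using Zlink xW Lx \<kappa>x by (auto simp: O'_def)
    show "link \<inter> O' \<subseteq> x ` V"
      using xL by (auto simp: O'_def) (metis imageI)
  qed
  have "pre_chart V x"
    unfolding pre_chart_def
  proof (intro conjI exI[of _ W] exI[of _ L])
    show "x ` V \<subseteq> link" using Zlink by blast
    show "openin (top_of_set link) (x ` V)" unfolding xV using O' by (simp add: openin_open_Int)
  qed (use V smx W xW smL Lx in auto)
  moreover have "p \<in> link \<inter> O'"
  proof -
    have s0: "z0 $ j ^ d = - (z0 $ i ^ d + z0 $ l ^ d)"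
      using z0(2) by (simp add: cone_iff eq_neg_iff_add_eq_0 algebra_simps)
    have \<zeta>p: "\<zeta> (L p) = z0 $ l / z0 $ i" by (simp add: \<zeta>_def L_def z0(1) complex_eq_iff divide_inverse)
    have "- (1 + (z0 $ l / z0 $ i) ^ d) = \<eta> ^ d"
      unfolding \<eta>_def s0 power_divide using nzi by (simp add: divide_simps)
    then have "E (\<zeta> (L p)) = 1"
      using \<eta> by (simp add: E_def \<zeta>p)
    moreover have "L p $ 3 = 0" using nzi by (simp add: L_def z0(1))
    moreover have "\<kappa> p = 1" using nzi nzj by (simp add: \<kappa>_def \<eta>_def z0(1) divide_inverse)
    ultimately show ?thesis
      using p nzi d0 by (simp add: O'_def W_def V_def Y_def z0(1))
  qed
  ultimately show thesis using that xV by metis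
qed

lemma vol_minus: "vol z X Y (- W) = - vol z X Y W"
proof -
  have "\<i> *s - W = - (\<i> *s W)" by (simp add: vec_eq_iff)
  then show ?thesis by (simp add: vol_def)
qed

lemma vol_at_continuous:
  assumes x: "pre_chart V x"
  shows "continuous_on V (vol_at x)"
proof -
  have x': "smooth_on V x" using x by (simp add: pre_chart_def)
  have K: "continuous_on V (\<lambda>u. K (f u))" if "continuous_on V f" for f :: "real^3 \<Rightarrow> real^7"
    by (rule linear_continuous_on_compose[OF that linK])
  have i: "continuous_on V (\<lambda>u. \<i> *s f u)" if "continuous_on V f" for f :: "real^3 \<Rightarrow> complex^3"
    by (rule linear_continuous_on_compose[OF that]) (rule linearI; simp add: vec_eq_iff distrib_left)
  have D: "continuous_on V (\<lambda>u. partial j x u)" for j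
    unfolding partial_def by (intro smooth_on_continuous smooth_on_frechet_derivative x')
  show ?thesis
    unfolding vol_at_def[abs_def] vol_def
    by (intro continuous_intros i K D smooth_on_continuous x')
qed

text \<open>On a ball the nowhere zero function \<open>vol_at x\<close> has constant sign, by
  connectedness. If it is negative, a reflection of the parameters reverses it.\<close>

lemma oriented_chart_at:
  assumes p: "p \<in> link"
  shows "\<exists>(V, x)\<in>atlas. p \<in> x ` V"
proof -
  obtain V0 x u0 where V0: "pre_chart V0 x" "u0 \<in> V0" "p = x u0" using chart_at[OF p] by blast
  have "open V0" using V0(1) by (simp add: pre_chart_def)
  then obtain r where r: "r > 0" "ball u0 r \<subseteq> V0" using V0(2) open_contains_ball by blast
  define V where "V = ball u0 r"
  have pV: "pre_chart V x" unfolding V_def by (rule pre_chart_subset[OF V0(1) open_ball r(2)])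
  interpret x: fermat_immersion d J \<nu> V x "gram x" by (rule pre_chart_immersion[OF pV])
  have uV: "u0 \<in> V" using r by (simp add: V_def)
  have nz: "vol_at x u \<noteq> 0" if "u \<in> V" for u
    using x.vol_nonzero[OF that] by (simp add: vol_at_def partial_def)
  have "connected (vol_at x ` V)"
    by (rule connected_continuous_image[OF vol_at_continuous[OF pV]]) (simp add: V_def)
  then have sign: "(\<forall>u\<in>V. vol_at x u > 0) \<or> (\<forall>u\<in>V. vol_at x u < 0)"
    using nz unfolding connected_iff_interval
    by (smt (verit) image_iff)
  then show ?thesis
  proof
    assume "\<forall>u\<in>V. vol_at x u > 0"
    then have "(V, x) \<in> atlas" using pV by (simp add: atlas_def)
    then show ?thesis using uV V0(3) by blast
  next
    assume neg: "\<forall>u\<in>V. vol_at x u < 0"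
    define R :: "real^3 \<Rightarrow> real^3" where "R u = (\<chi> i. if i = 3 then - u $ 3 else u $ i)" for u
    have RR: "R (R u) = u" for u by (simp add: R_def vec_eq_iff)
    have linR: "linear R" by (rule linearI) (simp_all add: R_def vec_eq_iff)
    have blR: "bounded_linear R" using linR by (simp add: linear_conv_bounded_linear)
    define V' where "V' = R -` V"
    define y where "y u = x (R u)" for u
    have V': "open V'"
      unfolding V'_def using x.V blR
      by (intro open_vimage) (simp_all add: linear_continuous_on)
    have yV: "y ` V' = x ` V"
    proof -
      have "R ` V' = V"
        unfolding V'_def by (rule surj_image_vimage_eq[OF surjI[of R R, OF RR]])
      then have "x ` V = x ` R ` V'" by simp
      then show ?thesis unfolding image_image y_def by simp
    qed
    obtain W L where W: "open W" "x ` V \<subseteq> W" "smooth_on W L" "\<And>u. u \<in> V \<Longrightarrow> L (x u) = u"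
      using pV unfolding pre_chart_def by blast
    have smy: "smooth_on V' y"
      unfolding y_def[abs_def]
      by (rule smooth_on_compose[OF V' x.V _ x.F smooth_on_linear[OF blR V' smooth_on_id[OF V']]])
        (simp add: V'_def)
    have "pre_chart V' y"
      unfolding pre_chart_def yV
    proof (intro conjI exI[of _ W] exI[of _ "\<lambda>v. R (L v)"])
      show "smooth_on W (\<lambda>v. R (L v))" by (rule smooth_on_linear[OF blR W(1,3)])
      show "\<forall>u\<in>V'. R (L (y u)) = u" by (simp add: V'_def y_def W(4) RR)
    qed (use pV V' smy W in \<open>auto simp: pre_chart_def\<close>)
    moreover have "vol_at y u > 0" if "u \<in> V'" for u
    proof -
      have Ru: "R u \<in> V" using that by (simp add: V'_def)
      have "(R has_derivative R) (at u)" by (rule bounded_linear_imp_has_derivative[OF blR])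
      from has_derivative_compose[OF this x.hd1[OF Ru]]
      have "frechet_derivative y (at u) v = frechet_derivative x (at (R u)) (R v)" for v
        unfolding y_def[abs_def] by (metis frechet_derivative_at)
      moreover have "R (axis 1 1) = axis 1 1" "R (axis 2 1) = axis 2 1" "R (axis 3 1) = - axis 3 1"
        by (simp_all add: R_def vec_eq_iff forall_3 axis_def)
      ultimately have "vol_at y u = - vol_at x (R u)"
        by (simp add: vol_at_def partial_def y_def linear_neg[OF x.lin1[OF Ru]] linear_neg[OF linK] vol_minus)
      then show ?thesis using neg Ru by simp
    qed
    ultimately have "(V', y) \<in> atlas" by (simp add: atlas_def)
    moreover have "p \<in> y ` V'" using uV V0(3) yV by blast
    ultimately show ?thesis by blast
  qed
qed

lemma link_manifold: "riemannian_manifold (top_of_set link) atlas (\<lambda>p. gram (snd p))"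
proof -
  have C: "open V \<and> openin (top_of_set link) (x ` V) \<and>
    homeomorphic_map (top_of_set V) (subtopology (top_of_set link) (x ` V)) x"
    and sub: "x ` V \<subseteq> link"
    if "(V, x) \<in> atlas" for V x
  proof -
    note p = atlas_pre_chart[OF that]
    have "open V" "openin (top_of_set link) (x ` V)" and s: "x ` V \<subseteq> link"
      using p unfolding pre_chart_def by blast+
    then show "open V \<and> openin (top_of_set link) (x ` V) \<and>
        homeomorphic_map (top_of_set V) (subtopology (top_of_set link) (x ` V)) x"
      using pre_chart_homeomorphic[OF p] by (simp add: subtopology_subtopology Int_absorb1)
    show "x ` V \<subseteq> link" by (rule s)
  qed
  show ?thesis
    unfolding riemannian_manifold_def smooth_manifold_def
  proof (intro conjI)
    show "second_countable (top_of_set link)"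
      by (intro second_countable_subtopology second_countable_euclidean)
    show "Hausdorff_space (top_of_set link)"
      by (simp add: Hausdorff_space_subtopology)
    show "topspace (top_of_set link) \<noteq> {}" using link_nonempty by simp
    show "\<forall>(V, x)\<in>atlas. open V \<and> openin (top_of_set link) (x ` V) \<and>
        homeomorphic_map (top_of_set V) (subtopology (top_of_set link) (x ` V)) x"
      using C by blast
    show "(\<Union>(V, x)\<in>atlas. x ` V) = topspace (top_of_set link)"
    proof
      show "(\<Union>(V, x)\<in>atlas. x ` V) \<subseteq> topspace (top_of_set link)" using sub by auto
      show "topspace (top_of_set link) \<subseteq> (\<Union>(V, x)\<in>atlas. x ` V)" using oriented_chart_at by (force split: prod.splits)
    qed
    show "\<forall>p\<in>atlas. \<forall>q\<in>atlas. smooth_on (trans_dom p q) (trans_map p q)"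
    proof (intro ballI)
      fix p q assume "p \<in> atlas" "q \<in> atlas"
      then show "smooth_on (trans_dom p q) (trans_map p q)"
        using transition(2)[OF atlas_pre_chart atlas_pre_chart, of "fst p" "snd p" "fst q" "snd q"] by simp
    qed
  qed (rule metric)
qed

end

section \<open>The first Betti number of the link\<close>

declare One_nat_def [simp del]

section \<open>From degrees to a lower bound for the first Betti number\<close>

lemma hom_finprod:
  assumes G: "comm_group G" and H: "comm_group H" and h: "h \<in> hom G H" and f: "f \<in> A \<rightarrow> carrier G"
  shows "h (finprod G f A) = finprod H (\<lambda>x. h (f x)) A"
proof -
  interpret G: comm_group G by (rule G)
  interpret H: comm_group H by (rule H)
  show ?thesis
    using f
  proof (induction A rule: infinite_finite_induct)
    case (insert x A)
    then have hf: "(\<lambda>x. h (f x)) \<in> A \<rightarrow> carrier H" "h (f x) \<in> carrier H"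
      using hom_carrier[OF h] by auto
    then show ?case
      using insert h by (auto simp: hom_def)
  qed (use hom_one[OF h] in auto)
qed

text \<open>The group is infinite cyclic; \<open>ord\<close> takes the value 0 on elements of
  infinite order.\<close>

lemma sphere_homology_generator:
  obtains a where "a \<in> carrier (reduced_homology_group (int p) (nsphere p))"
    "group.ord (reduced_homology_group (int p) (nsphere p)) a = 0"
proof -
  let ?G = "reduced_homology_group (int p) (nsphere p)"
  interpret group ?G by simp
  obtain a where a: "a \<in> carrier ?G" and aeq: "subgroup_generated ?G {a} = ?G"
    using cyclic_reduced_homology_group_nsphere[of p p] by (auto simp: cyclic_group_def)
  have "ord a = 0"
    by (simp add: a aeq iso_finite[OF reduced_homology_group_nsphere(1)] flip: infinite_cyclic_subgroup_order)
  then show thesis using that a by blast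
qed

lemma circle_homology_generator:
  obtains a where "a \<in> carrier (homology_group 1 (nsphere 1))"
    "\<And>n::int. a [^]\<^bsub>homology_group 1 (nsphere 1)\<^esub> n = \<one>\<^bsub>homology_group 1 (nsphere 1)\<^esub> \<Longrightarrow> n = 0"
    "\<And>f. hom_induced 1 (nsphere 1) {} (nsphere 1) {} f a
       = a [^]\<^bsub>homology_group 1 (nsphere 1)\<^esub> Brouwer_degree2 1 f"
proof -
  let ?G = "reduced_homology_group (int 1) (nsphere 1)"
  interpret group ?G by simp
  obtain a where a: "a \<in> carrier ?G" and o: "ord a = 0"
    by (rule sphere_homology_generator)
  have eq: "?G = homology_group 1 (nsphere 1)"
    by (simp add: un_reduced_homology_group)
  have "n = 0" if "a [^]\<^bsub>?G\<^esub> n = \<one>\<^bsub>?G\<^esub>" for n :: int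
    using that int_pow_eq_id[OF a, of n] o by simp
  moreover have "hom_induced 1 (nsphere 1) {} (nsphere 1) {} f a = a [^]\<^bsub>?G\<^esub> Brouwer_degree2 1 f" for f
    using Brouwer_degree2[OF a, of f] by simp
  ultimately show thesis using that[of a] a unfolding eq by blast
qed

text \<open>The maps \<open>f i\<close> induce homomorphisms to the homology of the circle, and on
  the classes carried by the loops \<gamma> they take values given by the identity matrix. Applying
  the \<open>i\<close>-th one to a relation isolates its \<open>i\<close>-th coefficient.\<close>

lemma betti_number_ge:
  fixes X :: "'a topology"
  assumes \<gamma>: "\<And>j. j < N \<Longrightarrow> continuous_map (nsphere 1) X (\<gamma> j)"
    and f: "\<And>i. i < N \<Longrightarrow> continuous_map X (nsphere 1) (f i)"
    and deg: "\<And>i j. i < N \<Longrightarrow> j < N \<Longrightarrow> Brouwer_degree2 1 (f i \<circ> \<gamma> j) = (if i = j then 1 else 0)"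
  shows "enat N \<le> betti_number 1 X"
proof -
  let ?G = "homology_group 1 X" and ?H = "homology_group 1 (nsphere 1)"
  interpret G: comm_group ?G by (rule abelian_homology_group)
  interpret H: comm_group ?H by (rule abelian_homology_group)
  obtain a where a: "a \<in> carrier ?H" "\<And>n::int. a [^]\<^bsub>?H\<^esub> n = \<one>\<^bsub>?H\<^esub> \<Longrightarrow> n = 0"
    "\<And>f. hom_induced 1 (nsphere 1) {} (nsphere 1) {} f a = a [^]\<^bsub>?H\<^esub> Brouwer_degree2 1 f"
    by (rule circle_homology_generator) blast
  define s where "s j = hom_induced 1 (nsphere 1) {} X {} (\<gamma> j) a" for j
  define \<phi> where "\<phi> i = hom_induced 1 X {} (nsphere 1) {} (f i)" for i
  have s: "s j \<in> carrier ?G" for j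
    using hom_carrier[OF hom_induced_empty_hom] a(1) unfolding s_def by blast
  have \<phi>: "\<phi> i \<in> hom ?G ?H" for i
    unfolding \<phi>_def by (rule hom_induced_empty_hom)
  have \<phi>s: "\<phi> i (s j) = a [^]\<^bsub>?H\<^esub> (if i = j then 1 else 0 :: int)" if "i < N" "j < N" for i j
    using hom_induced_compose_empty[OF \<gamma>[OF that(2)] f[OF that(1)], of 1] a(3)[of "f i \<circ> \<gamma> j"] deg[OF that]
    by (simp add: s_def \<phi>_def)
  \<comment> \<open>\<open>Z_independent\<close> indexes coefficients by group elements, so distinct
    loops must give distinct classes.\<close>
  have inj: "inj_on s {..<N}"
  proof (rule inj_onI)
    fix i j assume ij: "i \<in> {..<N}" "j \<in> {..<N}" "s i = s j"
    show "i = j"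
    proof (rule ccontr)
      assume "i \<noteq> j"
      then have "a [^]\<^bsub>?H\<^esub> (1::int) = \<one>\<^bsub>?H\<^esub>"
        using \<phi>s[of i i] \<phi>s[of i j] ij by simp
      then show False using a(2)[of 1] by simp
    qed
  qed
  have "Z_independent ?G (s ` {..<N})"
    unfolding Z_independent_def
  proof (intro conjI allI impI ballI)
    show "s ` {..<N} \<subseteq> carrier ?G" using s by blast
    fix c :: "_ \<Rightarrow> int" and x
    assume prod: "finprod ?G (\<lambda>s. s [^]\<^bsub>?G\<^esub> c s) (s ` {..<N}) = \<one>\<^bsub>?G\<^esub>" and x: "x \<in> s ` {..<N}"
    obtain i where i: "i < N" "x = s i" using x by auto
    have "\<one>\<^bsub>?H\<^esub> = \<phi> i (finprod ?G (\<lambda>s. s [^]\<^bsub>?G\<^esub> c s) (s ` {..<N}))"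
      unfolding prod using hom_one[OF \<phi>] by simp
    also have "\<dots> = finprod ?H (\<lambda>y. \<phi> i (y [^]\<^bsub>?G\<^esub> c y)) (s ` {..<N})"
      by (rule hom_finprod[OF G.comm_group_axioms H.comm_group_axioms \<phi>]) (use s in auto)
    also have "\<dots> = finprod ?H (\<lambda>y. if s i = y then a [^]\<^bsub>?H\<^esub> c y else \<one>\<^bsub>?H\<^esub>) (s ` {..<N})"
    proof (rule H.finprod_cong'[OF refl])
      show "(\<lambda>y. if s i = y then a [^]\<^bsub>?H\<^esub> c y else \<one>\<^bsub>?H\<^esub>) \<in> s ` {..<N} \<rightarrow> carrier ?H"
        using a(1) by auto
      fix y assume "y \<in> s ` {..<N}"
      then obtain j where j: "j < N" "y = s j" by auto
      have "\<phi> i (y [^]\<^bsub>?G\<^esub> c y) = \<phi> i (s j) [^]\<^bsub>?H\<^esub> c y"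
        unfolding j(2) by (rule hom_int_pow[OF \<phi> s]) simp_all
      then show "\<phi> i (y [^]\<^bsub>?G\<^esub> c y) = (if s i = y then a [^]\<^bsub>?H\<^esub> c y else \<one>\<^bsub>?H\<^esub>)"
        using \<phi>s[OF i(1) j(1)] inj_onD[OF inj, of i j] i(1) j a(1) by auto
    qed
    also have "\<dots> = a [^]\<^bsub>?H\<^esub> c (s i)"
      by (rule H.finprod_singleton) (use i a(1) in auto)
    finally show "c x = 0" using a(2)[of "c x"] i(2) by simp
  qed
  then have "s ` {..<N} \<in> {S. finite S \<and> Z_independent (homology_group (int 1) X) S}" by simp
  then have "enat (card (s ` {..<N})) \<le> betti_number 1 X"
    unfolding betti_number_def by (rule SUP_upper)
  then show ?thesis using card_image[OF inj] by simp
qed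

section \<open>Degrees of maps of the circle\<close>

definition circle_map :: "complex \<Rightarrow> nat \<Rightarrow> real" where
  "circle_map w n = (if n = 0 then Re w / norm w else if n = 1 then Im w / norm w else 0)"

text \<open>Points of \<open>nsphere 1\<close> are real sequences supported on the indices 0 and 1.
  This map identifies them with unit complex numbers, and \<open>circle_map\<close> is the radial
  retraction back.\<close>

definition circle_point :: "(nat \<Rightarrow> real) \<Rightarrow> complex" where
  "circle_point x = Complex (x 0) (x 1)"

lemma sum_atMost_1: "(\<Sum>i\<le>(1::nat). f i) = f 0 + f 1"
  by (simp add: One_nat_def)

lemma topspace_circle: "x \<in> topspace (nsphere 1) \<longleftrightarrow> (x 0)\<^sup>2 + (x 1)\<^sup>2 = 1 \<and> (\<forall>i>1. x i = 0)"
  by (simp add: nsphere sum_atMost_1)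

lemma norm_circle_point: "x \<in> topspace (nsphere 1) \<Longrightarrow> norm (circle_point x) = 1"
  by (simp add: topspace_circle circle_point_def cmod_def)

lemma circle_map_point:
  assumes "x \<in> topspace (nsphere 1)"
  shows "circle_map (circle_point x) = x"
proof
  fix n
  have "x n = 0" if "n \<noteq> 0" "n \<noteq> 1" using assms that unfolding topspace_circle by simp
  then show "circle_map (circle_point x) n = x n"
    using norm_circle_point[OF assms] by (auto simp: circle_map_def circle_point_def)
qed

lemma continuous_circle_map:
  assumes g: "continuous_map X euclidean g" and nz: "\<And>x. x \<in> topspace X \<Longrightarrow> g x \<noteq> 0"
  shows "continuous_map X (nsphere 1) (\<lambda>x. circle_map (g x))"
proof -
  have part: "continuous_map X euclidean (\<lambda>x. P (g x) / norm (g x))"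
    if "continuous_on UNIV P" for P :: "complex \<Rightarrow> real"
  proof -
    have "continuous_map X (top_of_set (- {0})) g"
      using g nz by (auto simp: continuous_map_in_subtopology)
    moreover have "continuous_map (top_of_set (- {0})) euclidean (\<lambda>w. P w / norm w)"
      using continuous_on_subset[OF that] by (auto intro!: continuous_intros)
    ultimately show ?thesis using continuous_map_compose[of X _ g euclidean "\<lambda>w. P w / norm w"] by (simp add: o_def)
  qed
  have "continuous_map X (powertop_real UNIV) (\<lambda>x. circle_map (g x))"
    unfolding continuous_map_componentwise_UNIV
  proof
    fix n
    show "continuous_map X euclideanreal (\<lambda>x. circle_map (g x) n)"
      using part[OF continuous_on_Re[OF continuous_on_id]] part[OF continuous_on_Im[OF continuous_on_id]]
      by (cases "n = 0"; cases "n = 1") (auto simp: circle_map_def intro: continuous_intros)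
  qed
  moreover have "circle_map (g x) \<in> {x. (\<Sum>i\<le>1. (x i)\<^sup>2) = 1 \<and> (\<forall>i>1. x i = 0)}" if "x \<in> topspace X" for x
    using nz[OF that] by (simp add: sum_atMost_1 circle_map_def power_divide add_divide_distrib[symmetric] cmod_power2[symmetric])
  ultimately show ?thesis
    unfolding nsphere continuous_map_in_subtopology by auto
qed

lemma continuous_circle_point: "continuous_map (nsphere 1) euclidean circle_point"
proof -
  have "continuous_map (nsphere 1) euclidean (\<lambda>x. complex_of_real (x i))" for i
    using continuous_map_compose[OF continuous_map_nsphere_projection[of 1 i], of euclidean complex_of_real]
    by (simp add: o_def continuous_intros)
  then have "continuous_map (nsphere 1) euclidean (\<lambda>x. complex_of_real (x 0) + complex_of_real (x 1) * \<i>)"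
  proof (intro continuous_map_add)
    show "continuous_map (nsphere 1) euclidean (\<lambda>x. complex_of_real (x 1) * \<i>)"
      using continuous_map_compose[OF continuous_map_nsphere_projection[of 1 1], of euclidean "\<lambda>r. complex_of_real r * \<i>"]
      by (simp add: o_def continuous_intros)
  qed
  then show ?thesis by (simp add: circle_point_def[abs_def] Complex_eq mult.commute)
qed

text \<open>The straight homotopy avoids 0, so it can be normalised to a homotopy in the
  circle.\<close>

lemma degree_segment_homotopy:
  assumes g: "continuous_map (nsphere 1) euclidean g" and h: "continuous_map (nsphere 1) euclidean h"
    and seg: "\<And>x t. x \<in> topspace (nsphere 1) \<Longrightarrow> 0 \<le> t \<Longrightarrow> t \<le> 1
      \<Longrightarrow> complex_of_real (1 - t) * g x + complex_of_real t * h x \<noteq> 0"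
  shows "Brouwer_degree2 1 (\<lambda>x. circle_map (g x)) = Brouwer_degree2 1 (\<lambda>x. circle_map (h x))"
proof (rule Brouwer_degree2_homotopic)
  let ?P = "prod_topology (top_of_set {0..1::real}) (nsphere 1)"
  let ?k = "\<lambda>y. complex_of_real (1 - fst y) * g (snd y) + complex_of_real (fst y) * h (snd y)"
  have f: "continuous_map ?P euclidean (\<lambda>y. complex_of_real (P (fst y)))" if "continuous_on UNIV P" for P
  proof -
    have "continuous_map ?P (top_of_set {0..1}) fst" by (rule continuous_map_fst)
    moreover have "continuous_map (top_of_set {0..1}) euclidean (\<lambda>t. complex_of_real (P t))"
      using continuous_on_subset[OF that] by (auto intro!: continuous_intros)
    ultimately show ?thesis using continuous_map_compose[of ?P _ fst euclidean "\<lambda>t. complex_of_real (P t)"] by (simp add: o_def)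
  qed
  have s: "continuous_map ?P euclidean (\<lambda>y. g' (snd y))" if "continuous_map (nsphere 1) euclidean g'" for g' :: "_ \<Rightarrow> complex"
    using continuous_map_compose[OF continuous_map_snd that] by (simp add: o_def)
  have m: "continuous_map ?P euclidean (\<lambda>y. u y * v y)"
    if "continuous_map ?P euclidean u" "continuous_map ?P euclidean v" for u v :: "_ \<Rightarrow> complex"
  proof -
    have "continuous_map ?P (prod_topology euclidean euclidean) (\<lambda>y. (u y, v y))"
      unfolding continuous_map_pairwise o_def using that by simp
    then have A: "continuous_map ?P euclidean (\<lambda>y. (u y, v y))"
      by (simp only: prod_topology_euclidean)
    have B: "continuous_map euclidean euclidean (\<lambda>w :: complex \<times> complex. fst w * snd w)"
      by (simp add: continuous_intros)
    show ?thesis using continuous_map_compose[OF A B] by (simp add: o_def)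
  qed
  have "continuous_map ?P euclidean ?k"
    using f[of "\<lambda>t. 1 - t"] f[of "\<lambda>t. t"]
    by (intro continuous_map_add m s g h) (simp_all add: continuous_intros)
  then have "continuous_map ?P (nsphere 1) (\<lambda>y. circle_map (?k y))"
    by (rule continuous_circle_map) (use seg in \<open>auto simp: topspace_prod_topology\<close>)
  then show "homotopic_with (\<lambda>x. True) (nsphere 1) (nsphere 1) (\<lambda>x. circle_map (g x)) (\<lambda>x. circle_map (h x))"
    unfolding homotopic_with_def by (intro exI[of _ "\<lambda>y. circle_map (?k y)"]) simp
qed

text \<open>\<open>g\<close> sends the open upper and lower arcs to the corresponding half planes,
  so only its real signs at the two remaining points matter. It is joined by segments avoiding 0 to
  the identity of the circle or to the constant 1.\<close>

lemma half_plane_degree: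
  assumes g: "continuous_map (nsphere 1) euclidean g"
    and sign: "\<And>x. x \<in> topspace (nsphere 1) \<Longrightarrow> x 1 \<noteq> 0 \<Longrightarrow> Im (g x) * x 1 > 0"
    and pos: "\<And>x. x \<in> topspace (nsphere 1) \<Longrightarrow> x 1 = 0 \<Longrightarrow> x 0 = 1 \<Longrightarrow> Re (g x) > 0"
    and neg: "\<And>x. x \<in> topspace (nsphere 1) \<Longrightarrow> x 1 = 0 \<Longrightarrow> x 0 = -1 \<Longrightarrow> if e then Re (g x) < 0 else Re (g x) > 0"
  shows "Brouwer_degree2 1 (\<lambda>x. circle_map (g x)) = (if e then 1 else 0)"
proof -
  have pm: "x 0 = 1 \<or> x 0 = -1" if "x \<in> topspace (nsphere 1)" "x 1 = 0" for x
    using that by (simp add: topspace_circle power2_eq_1_iff)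
  show ?thesis
  proof (cases e)
    case True
    have "Brouwer_degree2 1 (\<lambda>x. circle_map (g x)) = Brouwer_degree2 1 (\<lambda>x. circle_map (circle_point x))"
    proof (rule degree_segment_homotopy[OF g continuous_circle_point])
      fix x t assume x: "x \<in> topspace (nsphere 1)" and t: "0 \<le> t" "t \<le> (1::real)"
      let ?w = "complex_of_real (1 - t) * g x + complex_of_real t * circle_point x"
      have re: "Re ?w = (1 - t) * Re (g x) + t * x 0" and im: "Im ?w = (1 - t) * Im (g x) + t * x 1"
        by (simp_all add: circle_point_def)
      have cv: "(1 - t) * a + t * b > 0" if "a > 0" "b > 0" for a b :: real
        using that t by (cases "t = 1") (auto intro!: add_pos_nonneg mult_pos_pos)
      have "Im ?w * x 1 > 0" if "x 1 \<noteq> 0"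
      proof -
        have "x 1 * x 1 > 0" using that by (metis not_real_square_gt_zero)
        from cv[OF sign[OF x that] this] show ?thesis by (simp only: im) (simp add: algebra_simps)
      qed
      moreover have "Re ?w > 0" if "x 1 = 0" "x 0 = 1"
        using cv[OF pos[OF x that], of 1] that by (simp only: re)
      moreover have "Re ?w < 0" if "x 1 = 0" "x 0 = -1"
        using cv[of "- Re (g x)" 1] neg[OF x that] True that by (simp only: re) simp
      ultimately show "?w \<noteq> 0"
        using pm[OF x] by (metis less_irrefl mult_zero_left zero_complex.simps)
    qed
    also have "\<dots> = Brouwer_degree2 1 id"
      by (rule Brouwer_degree2_eq) (simp add: circle_map_point)
    finally show ?thesis using True by simp
  next
    case False
    have "Brouwer_degree2 1 (\<lambda>x. circle_map (g x)) = Brouwer_degree2 1 (\<lambda>x. circle_map 1)"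
    proof (rule degree_segment_homotopy[OF g])
      fix x t assume x: "x \<in> topspace (nsphere 1)" and t: "0 \<le> t" "t \<le> (1::real)"
      let ?w = "complex_of_real (1 - t) * g x + complex_of_real t * 1"
      have re: "Re ?w = (1 - t) * Re (g x) + t" and im: "Im ?w = (1 - t) * Im (g x)" by simp_all
      show "?w \<noteq> 0"
      proof (cases "x 1 = 0")
        case x1: True
        have "Re (g x) > 0" using pm[OF x x1] pos[OF x x1] neg[OF x x1] False by auto
        then have "Re ?w > 0" unfolding re using t by (cases "t = 1") (auto intro!: add_pos_nonneg mult_pos_pos)
        then show ?thesis by (metis less_irrefl zero_complex.simps(1))
      next
        case x1: False
        then have "Im (g x) \<noteq> 0" using sign[OF x x1] by auto
        then have "Im ?w \<noteq> 0 \<or> t = 1" unfolding im by simp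
        then show ?thesis by (metis re im zero_complex.simps diff_self mult_zero_left add_0 zero_neq_one)
      qed
    qed simp
    then show ?thesis using False by (simp add: Brouwer_degree2_const)
  qed
qed

section \<open>Maps to the circle that separate the tori\<close>

lemma cis_pi_div_power:
  assumes "n > 0"
  shows "cis (pi / n) ^ n = -1" "cis (- (pi / n)) ^ n = -1"
proof -
  have "real n * (pi / n) = pi" "real n * - (pi / n) = - pi" using assms by simp_all
  then show "cis (pi / n) ^ n = -1" "cis (- (pi / n)) ^ n = -1"
    by (simp_all only: Complex.DeMoivre) (simp_all add: complex_eq_iff)
qed

text \<open>A nonzero multiple of the angle \<open>2 * pi / k\<close> modulo a full turn is farther
  than \<open>pi / k\<close> from 0. The reflection of \<open>m\<close> to \<open>k - m\<close>
  brings the angle into the range where cosine decreases.\<close>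

lemma cos_lt_cos_pi_div:
  assumes "0 < m" "m < k"
  shows "cos (2 * pi * real m / real k) < cos (pi / real k)"
proof -
  have half: "cos (2 * pi * real m / real k) < cos (pi / real k)" if "0 < m" "2 * m \<le> k" for m
  proof (rule cos_monotone_0_pi)
    show "0 \<le> pi / real k" by simp
    have "2 * real m \<le> real k" using that by linarith
    then show "2 * pi * real m / real k \<le> pi" using that by (simp add: field_simps)
    have "real m \<ge> 1" using that by simp
    then show "pi / real k < 2 * pi * real m / real k" using that by (simp add: divide_strict_right_mono)
  qed
  show ?thesis
  proof (cases "2 * m \<le> k")
    case False
    have "2 * pi * real (k - m) / real k = 2 * pi - 2 * pi * real m / real k"
      using assms by (simp add: of_nat_diff field_simps)
    then have "cos (2 * pi * real (k - m) / real k) = cos (2 * pi * real m / real k)"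
      by (simp add: cos_diff)
    then show ?thesis using half[of "k - m"] assms False by simp
  qed (use half assms in blast)
qed

locale even_fermat = fermat d J \<nu> for d J \<nu> +
  fixes k :: nat
  assumes k: "k \<ge> 2" "d = 2 * k"
begin

definition tau :: "nat \<Rightarrow> complex" where "tau j = cis (pi * (2 * j + 1) / k)"

definition height :: "complex^3 \<Rightarrow> real" where "height z = Im (cnj (z $ 2) * z $ 3)"

text \<open>Where \<open>z $ 2\<close> and \<open>z $ 3\<close> are real multiples of one vector,
  this is a positive multiple of the square of \<open>z $ 1 / z $ 2\<close>, or of
  \<open>z $ 1 / z $ 3\<close>; the symmetric sum treats both cases together. Like
  \<open>height\<close>, it is invariant under a common phase.\<close>

definition level :: "complex^3 \<Rightarrow> complex" where
  "level z = (cnj (z $ 2) ^ 2 + cnj (z $ 3) ^ 2) * (z $ 1) ^ 2"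

text \<open>The zero set of \<open>height\<close> on the link is a union of \<open>k\<close> disjoint tori, labelled by the argument of \<open>level\<close>,
  which is one of those of the \<open>tau j\<close>. The map \<open>separator i\<close> winds once around \<open>0\<close> on
  crossing the torus with label \<open>i\<close>, and does not meet the negative real axis elsewhere.\<close>

definition separator :: "nat \<Rightarrow> complex^3 \<Rightarrow> complex" where
  "separator i z = Complex (cos (pi / k) * norm (level z) - Re (level z * cnj (tau i))) (height z)"

lemma tau_power: "tau j ^ k = -1"
proof -
  have "tau j ^ k = cis (real j * (2 * pi) + pi)"
  proof -
    have "real k * (pi * (2 * j + 1) / k) = real j * (2 * pi) + pi" using k(1) by (simp add: field_simps)
    then show ?thesis by (simp only: tau_def Complex.DeMoivre)
  qed
  also have "\<dots> = -1"
    by (simp add: cis_mult[symmetric] cis.ctr sin_times_pi_eq_0 cos_add sin_add complex_eq_iff)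
      (metis cos_npi cos_2npi mult.commute mult.assoc sin_2npi)
  finally show ?thesis .
qed

lemma norm_tau: "norm (tau j) = 1" by (simp add: tau_def)

lemma level_power:
  assumes z: "z \<in> cone" "z \<noteq> 0" and h: "height z = 0"
  shows "\<exists>\<rho>>0. level z ^ k = - complex_of_real \<rho>"
proof -
  have s: "z $ 1 ^ d = - (z $ 2 ^ d + z $ 3 ^ d)"
    using z by (simp add: cone_sum eq_neg_iff_add_eq_0 algebra_simps)
  have d0: "d > 0" using d by simp
  have nn: "cnj w ^ d * w ^ d = complex_of_real (norm w ^ (2 * d))" for w
    by (metis complex_norm_square mult.commute of_real_power power_mult power_mult_distrib)
  have kk: "level z ^ k = (cnj (z $ 2) ^ 2 + cnj (z $ 3) ^ 2) ^ k * z $ 1 ^ d"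
    by (simp add: level_def power_mult_distrib k power_mult)
  show ?thesis
  proof (cases "z $ 2 = 0")
    case True
    have "z $ 3 \<noteq> 0"
    proof
      assume "z $ 3 = 0"
      then have "z $ 1 = 0" using s True d0 by (simp add: power_0_left)
      then show False using z(2) True \<open>z $ 3 = 0\<close> by (simp add: vec_eq_iff forall_3)
    qed
    moreover have "level z ^ k = - (cnj (z $ 3) ^ d * z $ 3 ^ d)"
    proof -
      have "level z ^ k = cnj (z $ 3) ^ d * z $ 1 ^ d"
        using True by (simp add: level_def power_mult_distrib k(2) power_mult)
      then show ?thesis unfolding s using True d0 by (simp add: power_0_left)
    qed
    ultimately show ?thesis unfolding nn by (intro exI[of _ "norm (z $ 3) ^ (2 * d)"]) simp
  next
    case False
    \<comment> \<open>The real ratio of the third coordinate to the second, which exists because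
      \<open>height\<close> vanishes.\<close>
    define r where "r = Re (cnj (z $ 2) * z $ 3) / (norm (z $ 2))\<^sup>2"
    have "cnj (z $ 2) * z $ 3 = of_real (Re (cnj (z $ 2) * z $ 3))"
      using h by (simp add: height_def complex_eq_iff)
    then have "z $ 2 * (cnj (z $ 2) * z $ 3) = z $ 2 * of_real (Re (cnj (z $ 2) * z $ 3))" by simp
    then have "of_real ((norm (z $ 2))\<^sup>2) * z $ 3 = z $ 2 * of_real (Re (cnj (z $ 2) * z $ 3))"
      by (simp only: complex_norm_square mult.assoc)
    then have z3: "z $ 3 = of_real r * z $ 2"
      using False by (simp add: r_def field_simps)
    have "level z ^ k = ((1 + of_real r ^ 2) * cnj (z $ 2) ^ 2) ^ k * - ((1 + of_real r ^ d) * z $ 2 ^ d)"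
      by (simp add: kk s z3 power_mult_distrib algebra_simps)
    also have "\<dots> = - ((1 + of_real r ^ 2) ^ k * (1 + of_real r ^ d) * (cnj (z $ 2) ^ d * z $ 2 ^ d))"
      by (simp add: power_mult_distrib k power_mult)
    also have "\<dots> = - complex_of_real ((1 + r ^ 2) ^ k * (1 + r ^ d) * norm (z $ 2) ^ (2 * d))"
      unfolding nn by simp
    finally have e: "level z ^ k = - complex_of_real ((1 + r ^ 2) ^ k * (1 + r ^ d) * norm (z $ 2) ^ (2 * d))" .
    \<comment> \<open>The second inequality uses that \<open>d\<close> is even.\<close>
    have "1 + r ^ 2 > 0" "1 + r ^ d > 0"
      using k by (auto intro!: add_pos_nonneg simp: power_mult)
    then have "(1 + r ^ 2) ^ k * (1 + r ^ d) * norm (z $ 2) ^ (2 * d) > 0"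
      using False by (intro mult_pos_pos zero_less_power) auto
    then show ?thesis using e by blast
  qed
qed

text \<open>At a zero, \<open>level z\<close> lies on the boundary of the sector of half-angle
  \<open>pi / k\<close> around \<open>tau i\<close>, or vanishes. Neighbouring labels are
  \<open>2 * pi / k\<close> apart, so on that boundary the \<open>k\<close>-th power has the wrong
  sign for \<open>level_power\<close>.\<close>

lemma separator_nonzero:
  assumes z: "z \<in> cone" "z \<noteq> 0"
  shows "separator i z \<noteq> 0"
proof
  assume "separator i z = 0"
  then have h: "height z = 0" and re: "Re (level z * cnj (tau i)) = cos (pi / k) * norm (level z)"
    by (simp_all add: separator_def complex_eq_iff)
  define w where "w = level z * cnj (tau i)"
  have nw: "norm w = norm (level z)" by (simp add: w_def norm_mult norm_tau)
  obtain \<rho> where \<rho>: "\<rho> > 0" "level z ^ k = - complex_of_real \<rho>" using level_power[OF z h] by blast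
  have wk: "w ^ k = of_real \<rho>"
    using tau_power[of i] by (simp add: w_def power_mult_distrib \<rho> complex_cnj_power[symmetric] del: complex_cnj_power)
  have re': "Re w = norm w * cos (pi / k)" using re by (simp add: w_def[symmetric] nw)
  have "(Im w)\<^sup>2 = (norm w * sin (pi / k))\<^sup>2"
    using re' cmod_power2[of w] by (simp add: power_mult_distrib sin_squared_eq algebra_simps)
  then have "Im w = norm w * sin (pi / k) \<or> Im w = - (norm w * sin (pi / k))"
    by (simp add: power2_eq_iff)
  then have "w = of_real (norm w) * cis (pi / k) \<or> w = of_real (norm w) * cis (- (pi / k))"
    using re' by (auto simp: complex_eq_iff)
  moreover have "cis (pi / k) ^ k = -1" "cis (- (pi / k)) ^ k = -1"
    using k(1) cis_pi_div_power[of k] by simp_all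
  ultimately have "w ^ k = - of_real (norm w ^ k)"
    by (metis mult.right_neutral mult_minus_right of_real_power power_mult_distrib)
  then have "complex_of_real \<rho> = complex_of_real (- (norm w ^ k))" using wk by simp
  then have "\<rho> = - (norm w ^ k)" by (simp only: of_real_eq_iff)
  then show False using \<rho>(1) zero_le_power[of "norm w" k] by simp
qed

text \<open>Real and imaginary parts are homogeneous of different degrees, but positive scaling
  preserves both signs, so signs may be read off before normalising the loops.\<close>

lemma separator_scale:
  assumes "r \<ge> 0"
  shows "Im (separator i (r *\<^sub>R z)) = r ^ 2 * Im (separator i z)"
    "Re (separator i (r *\<^sub>R z)) = r ^ 4 * Re (separator i z)"
proof -
  have l: "level (r *\<^sub>R z) = of_real (r ^ 4) * level z"
    by (simp add: level_def scaleR_conv_of_real[where 'a=complex] power_mult_distrib algebra_simps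
        power_add[symmetric])
  show "Im (separator i (r *\<^sub>R z)) = r ^ 2 * Im (separator i z)"
    by (simp add: separator_def height_def power2_eq_square algebra_simps)
  show "Re (separator i (r *\<^sub>R z)) = r ^ 4 * Re (separator i z)"
    unfolding separator_def l using assms by (simp add: norm_mult norm_power algebra_simps)
qed

lemma separator_continuous: "continuous_on S (separator i)"
  unfolding separator_def[abs_def] level_def height_def Complex_eq by (intro continuous_intros)

section \<open>Explicit loops and their intersection numbers\<close>

definition omega :: "nat \<Rightarrow> complex" where "omega j = cis (pi * (2 * j + 1) / d)"

text \<open>If \<open>c\<close> is \<open>x 0\<close> or \<open>- x 0\<close> on the unit circle,
  then \<open>(1 - c\<^sup>2) ^ k\<close> is \<open>x 1 ^ d\<close>, so the \<open>d\<close>-th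
  power of the profile is \<open>1 - x 1 ^ d\<close>. The values at 0 and 1 are 0 and 1.\<close>

definition profile :: "real \<Rightarrow> real" where "profile c = root d (1 - (1 - c\<^sup>2) ^ k)"

text \<open>The \<open>d\<close>-th powers of the entries are \<open>x 1 ^ d - 1\<close>, 1 and
  \<open>- (x 1 ^ d)\<close>. The first entry passes through 0 at \<open>x 0 = 0\<close>, which
  permits switching from the root \<open>omega 0\<close> to \<open>omega j\<close>. The height has
  the sign of \<open>x 1\<close>, so the loop crosses the torus labelled 0 at \<open>x 0 = 1\<close>
  and the one labelled \<open>j\<close> at \<open>x 0 = -1\<close>.\<close>

definition loop :: "nat \<Rightarrow> (nat \<Rightarrow> real) \<Rightarrow> complex^3" where
  "loop j x = vector [omega 0 * of_real (profile (max 0 (x 0))) + omega j * of_real (profile (max 0 (- x 0))),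
     1, of_real (\<bar>x 1\<bar> * cos (pi / d)) + \<i> * of_real (x 1 * sin (pi / d))]"

lemma omega_power: "omega j ^ d = -1" "omega j ^ 2 = tau j"
proof -
  show o2: "omega j ^ 2 = tau j" 
  proof -
    have "real 2 * (pi * (2 * j + 1) / d) = pi * (2 * j + 1) / k" by (simp add: k(2))
    then show ?thesis by (simp only: omega_def tau_def Complex.DeMoivre)
  qed
  show "omega j ^ d = -1" using o2 tau_power[of j] by (simp add: k power_mult)
qed

lemma loop_cone:
  assumes x: "x \<in> topspace (nsphere 1)"
  shows "loop j x \<in> cone" "loop j x \<noteq> 0"
proof -
  have d0: "d > 0" using d by simp
  have "(x 0)\<^sup>2 + (x 1)\<^sup>2 = 1" using x by (simp add: topspace_circle)
  then have c: "1 - (x 0)\<^sup>2 = (x 1)\<^sup>2" and c1: "(x 1)\<^sup>2 \<le> 1"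
    using zero_le_power2[of "x 0"] by linarith+
  have p0: "profile 0 = 0" using d0 by (simp add: profile_def)
  have pd: "complex_of_real (profile (x 0)) ^ d = 1 - of_real (x 1) ^ d"
    "complex_of_real (profile (- x 0)) ^ d = 1 - of_real (x 1) ^ d"
  proof -
    have "(x 1)\<^sup>2 ^ k \<le> 1" by (rule power_le_one[OF zero_le_power2 c1])
    then have "profile (x 0) ^ d = 1 - x 1 ^ d" "profile (- x 0) ^ d = 1 - x 1 ^ d"
      using d0 by (simp_all add: profile_def c power_mult[symmetric] k(2)[symmetric])
    then show "complex_of_real (profile (x 0)) ^ d = 1 - of_real (x 1) ^ d"
      "complex_of_real (profile (- x 0)) ^ d = 1 - of_real (x 1) ^ d"
      by (metis of_real_1 of_real_diff of_real_power)+
  qed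
  have "(loop j x $ 1) ^ d = - (1 - of_real (x 1) ^ d)"
  proof (cases "x 0 = 0")
    case True
    then show ?thesis using pd(1) d0 by (simp add: loop_def p0 power_0_left)
  next
    case False
    then show ?thesis
      by (cases "x 0 > 0") (simp_all add: loop_def max_def p0 power_mult_distrib pd omega_power)
  qed
  moreover have "(loop j x $ 3) ^ d = - (of_real (x 1) ^ d)"
  proof -
    have "loop j x $ 3 = of_real \<bar>x 1\<bar> * cis (if x 1 \<ge> 0 then pi / d else - (pi / d))"
      by (simp add: loop_def complex_eq_iff)
    moreover have "cis (if x 1 \<ge> 0 then pi / d else - (pi / d)) ^ d = -1"
      using d0 cis_pi_div_power[of d] by simp
    moreover have "complex_of_real \<bar>x 1\<bar> ^ d = of_real (x 1) ^ d"
      unfolding of_real_power[symmetric] using k by (simp add: power_even_abs)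
    ultimately show ?thesis by (simp add: power_mult_distrib)
  qed
  ultimately show "loop j x \<in> cone" by (simp add: cone_sum) (simp add: loop_def)
  show "loop j x \<noteq> 0" by (simp add: loop_def vec_eq_iff forall_3)
qed

definition loop_link :: "nat \<Rightarrow> (nat \<Rightarrow> real) \<Rightarrow> real^7" where
  "loop_link j x = J (loop j x /\<^sub>R norm (loop j x))"

lemma scale_cone: "z \<in> cone \<Longrightarrow> r *\<^sub>R z \<in> cone"
  by (simp add: cone_sum scaleR_conv_of_real[where 'a=complex] power_mult_distrib distrib_left[symmetric])

lemma loop_link:
  assumes x: "x \<in> topspace (nsphere 1)"
  shows "loop_link j x \<in> link"
  using scale_cone[OF loop_cone(1)[OF x]] loop_cone(2)[OF x] unfolding loop_link_def link_def
  by (intro imageI) (simp add: norm_eq_1[symmetric])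

lemma loop_link_continuous: "continuous_map (nsphere 1) (top_of_set link) (loop_link j)"
proof -
  have v: "(vector [a, b, c] :: complex^3) = (\<chi> i. if i = 1 then a else if i = 2 then b else c)" for a b c
    by (simp add: vec_eq_iff forall_3)
  \<comment> \<open>The same formula on the whole plane, so that continuity is checked on a
    euclidean space.\<close>
  define l where "l w = (vector [omega 0 * of_real (profile (max 0 (Re w))) + omega j * of_real (profile (max 0 (- Re w))),
     1, of_real (\<bar>Im w\<bar> * cos (pi / d)) + \<i> * of_real (Im w * sin (pi / d))] :: complex^3)" for w
  have "continuous_on UNIV l"
    unfolding l_def v
  proof (rule continuous_on_vec_lambda)
    show "continuous_on UNIV (\<lambda>w. if i = 1 then omega 0 * of_real (profile (max 0 (Re w))) + omega j * of_real (profile (max 0 (- Re w)))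
      else if i = 2 then 1 else of_real (\<bar>Im w\<bar> * cos (pi / d)) + \<i> * of_real (Im w * sin (pi / d)))" for i :: 3
      unfolding profile_def by (cases "i = 1"; cases "i = 2") (simp_all add: continuous_intros)
  qed
  then have "continuous_map (nsphere 1) euclidean (l \<circ> circle_point)"
    by (intro continuous_map_compose[OF continuous_circle_point]) simp
  moreover have "l \<circ> circle_point = loop j"
    by (simp add: fun_eq_iff l_def loop_def circle_point_def)
  ultimately have "continuous_map (nsphere 1) (top_of_set (- {0})) (loop j)"
    using loop_cone(2) by (auto simp: continuous_map_in_subtopology)
  moreover have "continuous_map (top_of_set (- {0})) euclidean (\<lambda>z. J (z /\<^sub>R norm z))"
  proof -
    have "continuous_on (- {0}) (\<lambda>z. J (z /\<^sub>R norm z))"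
      by (rule linear_continuous_on_compose[OF _ linJ]) (auto intro!: continuous_intros)
    then show ?thesis by simp
  qed
  ultimately have "continuous_map (nsphere 1) euclidean (loop_link j)"
    using continuous_map_compose[of "nsphere 1" _ "loop j" euclidean "\<lambda>z. J (z /\<^sub>R norm z)"]
    by (simp add: loop_link_def[abs_def] o_def)
  then show ?thesis using loop_link by (auto simp: continuous_map_in_subtopology)
qed

text \<open>The real part is \<open>cos (pi / k)\<close> minus the cosine of the angle between the
  labels \<open>i\<close> and \<open>m\<close>.\<close>

lemma separator_tau:
  assumes "level z = tau m" "i < k" "m < k"
  shows "if i = m then Re (separator i z) < 0 else Re (separator i z) > 0"
proof (cases "i = m")
  case True
  have "cos (pi / k) < 1"
    using cos_monotone_0_pi[of 0 "pi / k"] k by (simp add: field_simps)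
  moreover have "tau i * cnj (tau i) = 1" by (metis complex_norm_square norm_tau of_real_1 one_power2)
  ultimately show ?thesis using True assms by (simp add: separator_def norm_tau)
next
  case False
  define n where "n = (if i < m then m - i else i - m)"
  have n: "0 < n" "n < k" using False assms by (auto simp: n_def)
  have "Re (tau m * cnj (tau i)) = cos (pi * (2 * m + 1) / k - pi * (2 * i + 1) / k)"
    by (simp add: tau_def cos_diff)
  also have "pi * (2 * m + 1) / k - pi * (2 * i + 1) / k = 2 * pi * (real m - real i) / k"
    by (simp add: diff_divide_distrib[symmetric] algebra_simps)
  also have "cos \<dots> = cos (2 * pi * real n / k)"
  proof (cases "i < m")
    case False
    then have "2 * pi * (real m - real i) / k = - (2 * pi * real n / k)"
      by (simp add: n_def of_nat_diff minus_divide_left del: minus_divide_left[symmetric]) (simp add: algebra_simps)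
    then show ?thesis by simp
  qed (simp add: n_def of_nat_diff)
  finally show ?thesis
    using cos_lt_cos_pi_div[OF n] False assms by (simp add: separator_def norm_tau)
qed

text \<open>At the crossing of torus 0 the real part is positive because \<open>0 < i\<close>; at
  the crossing of torus \<open>j\<close> it is negative exactly when \<open>i = j\<close>.
  \<open>half_plane_degree\<close> turns these signs into the degree.\<close>

lemma separator_loop_degree:
  assumes i: "0 < i" "i < k" and j: "0 < j" "j < k"
  shows "Brouwer_degree2 1 ((\<lambda>p. circle_map (separator i (K p))) \<circ> loop_link j) = (if i = j then 1 else 0)"
proof -
  define g where "g x = separator i (loop j x /\<^sub>R norm (loop j x))" for x
  have d0: "d > 0" using d by simp
  have comp: "(\<lambda>p. circle_map (separator i (K p))) \<circ> loop_link j = (\<lambda>x. circle_map (g x))"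
    by (simp add: fun_eq_iff g_def loop_link_def)
  have Img: "Im (g x) = inverse (norm (loop j x)) ^ 2 * Im (separator i (loop j x))"
    and Reg: "Re (g x) = inverse (norm (loop j x)) ^ 4 * Re (separator i (loop j x))" for x
    unfolding g_def by (rule separator_scale; simp)+
  have g: "continuous_map (nsphere 1) euclidean g"
  proof -
    have "continuous_map (nsphere 1) euclidean (loop_link j)"
      using loop_link_continuous by (auto simp: continuous_map_in_subtopology)
    moreover have "continuous_on UNIV (\<lambda>p. separator i (K p))"
      by (rule continuous_on_compose2[OF separator_continuous[of UNIV]])
        (auto intro: linear_continuous_on simp: linear_conv_bounded_linear[symmetric] linK)
    ultimately show ?thesis
      using continuous_map_compose[of "nsphere 1" euclidean "loop_link j" euclidean "\<lambda>p. separator i (K p)"]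
      by (simp add: o_def g_def[abs_def] loop_link_def)
  qed
  have npos: "inverse (norm (loop j x)) > 0" if "x \<in> topspace (nsphere 1)" for x
    using loop_cone(2)[OF that] by simp
  have spos: "sin (pi / d) > 0"
    using d by (intro sin_gt_zero) (auto simp: field_simps)
  have p01: "profile 0 = 0" "profile 1 = 1" using d0 k(1) by (simp_all add: profile_def power_0_left)
  show ?thesis
    unfolding comp
  proof (rule half_plane_degree[OF g])
    fix x assume x: "x \<in> topspace (nsphere 1)"
    have "Im (separator i (loop j x)) = x 1 * sin (pi / d)"
      by (simp add: separator_def height_def loop_def)
    then have "Im (g x) * x 1 = inverse (norm (loop j x)) ^ 2 * sin (pi / d) * (x 1 * x 1)"
      by (simp add: Img)
    then show "Im (g x) * x 1 > 0" if "x 1 \<noteq> 0"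
      using npos[OF x] spos that by (metis mult_pos_pos not_real_square_gt_zero zero_less_power)
    {
      assume x01: "x 1 = 0" "x 0 = 1"
      have "level (loop j x) = tau 0"
        by (simp add: level_def loop_def x01 max_def p01 omega_power)
      from separator_tau[OF this i(2)] show "Re (g x) > 0"
        using i k npos[OF x] by (simp add: Reg)
    }
    {
      assume x01: "x 1 = 0" "x 0 = -1"
      have "level (loop j x) = tau j"
        by (simp add: level_def loop_def x01 max_def p01 omega_power)
      note st = separator_tau[OF this i(2) j(2)]
      have "inverse (norm (loop j x)) ^ 4 > 0" using npos[OF x] by (rule zero_less_power)
      from st mult_pos_neg[OF this] mult_pos_pos[OF this]
      show "if i = j then Re (g x) < 0 else Re (g x) > 0"
        unfolding Reg by presburger
    }
  qed
qed

text \<open>Label 0 is reserved for the return crossing of all loops, so indices are shifted by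
  \<open>Suc\<close> and \<open>k - 1\<close> classes remain.\<close>

lemma link_betti: "enat (k - 1) \<le> betti_number 1 (top_of_set link)"
proof (rule betti_number_ge[where \<gamma> = "\<lambda>j. loop_link (Suc j)" and f = "\<lambda>i p. circle_map (separator (Suc i) (K p))"])
  show "continuous_map (nsphere 1) (top_of_set link) (loop_link (Suc j))" for j
    by (rule loop_link_continuous)
  show "continuous_map (top_of_set link) (nsphere 1) (\<lambda>p. circle_map (separator (Suc i) (K p)))" for i
  proof (rule continuous_circle_map)
    have "continuous_on link (\<lambda>p. separator (Suc i) (K p))"
      by (rule continuous_on_compose2[OF separator_continuous[of UNIV]])
        (auto intro: linear_continuous_on simp: linear_conv_bounded_linear[symmetric] linK)
    then show "continuous_map (top_of_set link) euclidean (\<lambda>p. separator (Suc i) (K p))" by simp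
    show "separator (Suc i) (K p) \<noteq> 0" if "p \<in> topspace (top_of_set link)" for p
    proof -
      obtain z where z: "p = J z" "z \<in> cone" "z \<bullet> z = 1" using \<open>p \<in> _\<close> by (auto simp: link_def)
      then have "z \<noteq> 0" by auto
      then show ?thesis using separator_nonzero[OF z(2)] z(1) by simp
    qed
  qed
  show "Brouwer_degree2 1 ((\<lambda>p. circle_map (separator (Suc i) (K p))) \<circ> loop_link (Suc j)) = (if i = j then 1 else 0)"
    if "i < k - 1" "j < k - 1" for i j
    using separator_loop_degree[of "Suc i" "Suc j"] that by simp
qed

end

section \<open>The ambient isometry and the conclusion\<close>

lemma complex3_isometry:
  obtains J :: "complex^3 \<Rightarrow> real^7" and \<nu> where "linear J" "\<And>z. norm (J z) = norm z"
    "range J = {v. v \<bullet> \<nu> = 0}" "\<nu> \<bullet> \<nu> = 1"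
proof -
  define \<nu> :: "real^7" where "\<nu> = axis 1 1"
  have \<nu>: "\<nu> \<bullet> \<nu> = 1" by (simp add: \<nu>_def inner_axis_axis)
  then have "\<nu> \<noteq> 0" by auto
  have T: "{v. v \<bullet> \<nu> = 0} = {v. \<nu> \<bullet> v = 0}" by (simp add: inner_commute)
  have "dim {v. v \<bullet> \<nu> = 0} = 6"
    unfolding T using dim_hyperplane[OF \<open>\<nu> \<noteq> 0\<close>] by simp
  moreover have "subspace {v. v \<bullet> \<nu> = 0}" unfolding T by (rule subspace_hyperplane)
  ultimately obtain J :: "complex^3 \<Rightarrow> real^7" where "linear J" "J ` UNIV = {v. v \<bullet> \<nu> = 0}"
    "\<And>z. z \<in> UNIV \<Longrightarrow> norm (J z) = norm z"
    using isometry_subspaces[of "UNIV :: (complex^3) set" "{v. v \<bullet> \<nu> = 0}"] by auto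
  then show thesis using that[of J \<nu>] \<nu> by simp
qed

theorem mainTheorem6:
  fixes N :: int
  shows "\<exists>(M :: (real^7) topology) (A :: (real^7, 3) param set) g (f :: real^7 \<Rightarrow> real^7).
           riemannian_manifold M A g \<and> oriented_atlas A \<and>
           compact_space M \<and> connected_space M \<and>
           enat (nat N) \<le> betti_number 1 M \<and>
           isometric_immersion_unit_sphere A g f \<and>
           minimal_immersion A g f \<and>
           wintgen_ideal A g f"
proof -
  \<comment> \<open>Gives \<open>nat N \<le> k - 1\<close> together with \<open>2 \<le> k\<close>,
    the latter also for negative \<open>N\<close>.\<close>
  define k where "k = nat N + 2"
  obtain J :: "complex^3 \<Rightarrow> real^7" and \<nu> where J: "linear J" "\<And>z. norm (J z) = norm z"
    "range J = {v. v \<bullet> \<nu> = 0}" "\<nu> \<bullet> \<nu> = 1"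
    by (rule complex3_isometry) blast
  interpret even_fermat "2 * k" J \<nu> k
    by unfold_locales (use J linear_add[OF J(1)] linear_scale[OF J(1)] in \<open>auto simp: k_def\<close>)
  have "enat (nat N) \<le> enat (k - 1)" by (simp add: k_def)
  then have "enat (nat N) \<le> betti_number 1 (top_of_set link)"
    using link_betti by (rule order_trans)
  moreover have "compact_space (top_of_set link)"
    using link_compact by (simp add: compact_space_subtopology compactin_euclidean_iff)
  moreover have "connected_space (top_of_set link)"
    using connected_link by (simp add: connected_space_subtopology)
  \<comment> \<open>The link is already a subset of \<open>real^7\<close>: the immersion is the
    identity map and the metric in each chart is its Gram matrix.\<close>
  ultimately show ?thesis
    using link_manifold oriented isometric_minimal_wintgen by blast
qed

end
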